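(* Let $D\Gamma(N)$ be an $h$-normal $N$-linear connection on $E^*=J^{1*}(\mathcal T,M)$. Its torsion tensor $\mathbb T$ is determined by the following nine adapted local d-tensors (all other adapted components vanish): $$\mathbb T\Big(\tfrac{\delta}{\delta t^b},\tfrac{\delta}{\delta t^a}\Big)=R_{(r)ab}^{(f)}\tfrac{\partial}{\partial p_r^f},\qquad \mathbb T\Big(\tfrac{\delta}{\delta x^j},\tfrac{\delta}{\delta t^a}\Big)=T_{aj}^r\tfrac{\delta}{\delta x^r}+R_{(r)aj}^{(f)}\tfrac{\partial}{\partial p_r^f},$$ $$\mathbb T\Big(\tfrac{\partial}{\partial p_j^b},\tfrac{\delta}{\delta t^a}\Big)=P_{(r)a(b)}^{(f)\ (j)}\tfrac{\partial}{\partial p_r^f},\qquad \mathbb T\Big(\tfrac{\delta}{\delta x^j},\tfrac{\delta}{\delta x^i}\Big)=T_{ij}^r\tfrac{\delta}{\delta x^r}+R_{(r)ij}^{(f)}\tfrac{\partial}{\partial p_r^f},$$ $$\mathbb T\Big(\tfrac{\partial}{\partial p_j^b},\tfrac{\delta}{\delta x^i}\Big)=P_{i(b)}^{r(j)}\tfrac{\delta}{\delta x^r}+P_{(r)i(b)}^{(f)\ (j)}\tfrac{\partial}{\partial p_r^f},\qquad \mathbb T\Big(\tfrac{\partial}{\partial p_j^b},\tfrac{\partial}{\partial p_i^a}\Big)=S_{(r)(a)(b)}^{(f)(i)(j)}\tfrac{\partial}{\partial p_r^f},$$ where $$T_{aj}^r=-A_{ja}^r,\qquad T_{ij}^r=H_{ij}^r-H_{ji}^r,\qquad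 P_{i(b)}^{r(j)}=C_{i(b)}^{r(j)},$$ $$P_{(r)a(b)}^{(f)\ (j)}=\frac{\partial \underset{1}{N}{}_{(r)a}^{(f)}}{\partial p_j^b}+\delta_b^fA_{ra}^j-\delta_r^j\chi_{ba}^f,\qquad P_{(r)i(b)}^{(f)\ (j)}=\frac{\partial \underset{2}{N}{}_{(r)i}^{(f)}}{\partial p_j^b}+\delta_b^fH_{ri}^j,$$ $$R_{(r)ab}^{(f)}=\frac{\delta \underset{1}{N}{}_{(r)a}^{(f)}}{\delta t^b}-\frac{\delta \underset{1}{N}{}_{(r)b}^{(f)}}{\delta t^a},\quad R_{(r)aj}^{(f)}=\frac{\delta \underset{1}{N}{}_{(r)a}^{(f)}}{\delta x^j}-\frac{\delta \underset{2}{N}{}_{(r)j}^{(f)}}{\delta t^a},\quad R_{(r)ij}^{(f)}=\frac{\delta \underset{2}{N}{}_{(r)i}^{(f)}}{\delta x^j}-\frac{\delta \underset{2}{N}{}_{(r)j}^{(f)}}{\delta x^i},$$ $$S_{(r)(a)(b)}^{(f)(i)(j)}=-\big(\delta_a^fC_{r(b)}^{i(j)}-\delta_b^fC_{r(a)}^{j(i)}\big).$$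
   Context: Setting. $\mathcal{T}$ and $M$ are smooth real manifolds of dimensions $m$ and $n$ with local coordinates $(t^a)$, $(x^i)$; indices $a,b,c,d,e,f,g$ run over $1,\dots,m$ and $i,j,k,l,p,r,s$ over $1,\dots,n$; the Einstein summation convention is used. $E^{*}=J^{1*}(\mathcal{T},M)$ is the dual 1-jet bundle with induced coordinates $(t^a,x^i,p_i^a)$, transforming by $\tilde t^a=\tilde t^a(t^b)$, $\tilde x^i=\tilde x^i(x^j)$, $\tilde p_i^a=\frac{\partial x^j}{\partial\tilde x^i}\frac{\partial\tilde t^a}{\partial t^b}p_j^b$. Nonlinear connection. $N=(\underset{1}{N}{}_{(i)b}^{(a)},\underset{2}{N}{}_{(i)j}^{(a)})$ is a fixed nonlinear connection on $E^*$, i.e. a collection of local functions with transformation rules $\underset{1}{\tilde N}{}_{(j)c}^{(b)}\frac{\partial\tilde t^c}{\partial t^a}=\underset{1}{N}{}_{(k)a}^{(c)}\frac{\partial\tilde t^b}{\partial t^c}\frac{\partial x^k}{\partial\tilde x^j}-\frac{\partial\tilde p_j^b}{\partial t^a}$ and $\underset{2}{\tilde N}{}_{(j)k}^{(b)}\frac{\partial\tilde x^k}{\partial x^i}=\underset{2}{N}{}_{(k)i}^{(c)}\frac{\partial\tilde t^b}{\partial t^c}\frac{\partial x^k}{\partial\tilde x^j}-\frac{\partial\tilde p_j^b}{\partial x^i}$. The adapted basis is $\frac{\delta}{\delta t^a}=\frac{\partial}{\partial t^a}-\underset{1}{N}{}_{(j)a}^{(b)}\frac{\partial}{\partial p_j^b}$,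 $\frac{\delta}{\delta x^i}=\frac{\partial}{\partial x^i}-\underset{2}{N}{}_{(j)i}^{(b)}\frac{\partial}{\partial p_j^b}$, $\frac{\partial}{\partial p_i^a}$, with dual basis $dt^a$, $dx^i$, $\delta p_i^a=dp_i^a+\underset{1}{N}{}_{(i)b}^{(a)}dt^b+\underset{2}{N}{}_{(i)j}^{(a)}dx^j$. Let $h_{\mathcal T},h_M,v$ be the projections of vector fields onto the spans of $\{\delta/\delta t^a\}$, $\{\delta/\delta x^i\}$, $\{\partial/\partial p_i^a\}$. $N$-linear connection. A linear connection $D$ on $E^*$ with $Dh_{\mathcal T}=0$, $Dh_M=0$, $Dv=0$. Its nine adapted components are defined by $D_{\delta/\delta t^c}\frac{\delta}{\delta t^b}=A_{bc}^a\frac{\delta}{\delta t^a}$, $D_{\delta/\delta t^c}\frac{\delta}{\delta x^j}=A_{jc}^i\frac{\delta}{\delta x^i}$, $D_{\delta/\delta t^c}\frac{\partial}{\partial p_j^b}=-A_{(i)(b)c}^{(a)(j)}\frac{\partial}{\partial p_i^a}$; $D_{\delta/\delta x^k}\frac{\delta}{\delta t^b}=H_{bk}^a\frac{\delta}{\delta t^a}$, $D_{\delta/\delta x^k}\frac{\delta}{\delta x^j}=H_{jk}^i\frac{\delta}{\delta x^i}$, $D_{\delta/\delta x^k}\frac{\partial}{\partial p_j^b}=-H_{(i)(b)k}^{(a)(j)}\frac{\partial}{\partial p_i^a}$; $D_{\partial/\partial p_k^c}\frac{\delta}{\delta t^b}=C_{b(c)}^{a(k)}\frac{\delta}{\delta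 t^a}$, $D_{\partial/\partial p_k^c}\frac{\delta}{\delta x^j}=C_{j(c)}^{i(k)}\frac{\delta}{\delta x^i}$, $D_{\partial/\partial p_k^c}\frac{\partial}{\partial p_j^b}=-C_{(i)(b)(c)}^{(a)(j)(k)}\frac{\partial}{\partial p_i^a}$. $h$-normal. Fix a semi-Riemannian metric $h_{ab}(t)$ on $\mathcal T$ with Christoffel symbols $\chi_{bc}^a(t)$, and let $\mathbb J=h_{ab}\delta_j^i\,\delta p_i^a\otimes dt^b\otimes dx^j$. An $N$-linear connection is $h$-normal if $A_{bc}^a=\chi_{bc}^a$, $H_{bi}^a=0$, $C_{b(c)}^{a(i)}=0$ and $D\mathbb J=0$. For such a connection $A_{(i)(b)c}^{(a)(j)}=\delta_b^aA_{ic}^j-\delta_i^j\chi_{bc}^a$, $H_{(i)(b)k}^{(a)(j)}=\delta_b^aH_{ik}^j$, $C_{(i)(b)(c)}^{(a)(j)(k)}=\delta_b^aC_{i(c)}^{j(k)}$, so it is determined by $(\chi_{bc}^a,A_{jc}^i,H_{jk}^i,C_{j(c)}^{i(k)})$. Torsion: $\mathbb T(X,Y)=D_XY-D_YX-[X,Y]$. *)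

theory Defs
  imports "HOL-Analysis.Analysis"
begin

section \<open>Smooth manifolds given by an atlas\<close>

primrec Ck_on :: "nat \<Rightarrow> 'a::euclidean_space set \<Rightarrow> ('a \<Rightarrow> 'b::real_normed_vector) \<Rightarrow> bool" where
  "Ck_on 0 S f \<longleftrightarrow> continuous_on S f"
| "Ck_on (Suc k) S f \<longleftrightarrow>
     f differentiable_on S \<and> (\<forall>v. Ck_on k S (\<lambda>x. frechet_derivative f (at x) v))"

text \<open>Only used for open sets \<open>S\<close>.\<close>

definition smooth_on :: "'a::euclidean_space set \<Rightarrow> ('a \<Rightarrow> 'b::real_normed_vector) \<Rightarrow> bool" where
  "smooth_on S f \<longleftrightarrow> (\<forall>k. Ck_on k S f)"

text \<open>A chart is a pair of a domain and a coordinate map; the values of the map outside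
  of the domain are irrelevant.\<close>

type_synonym ('a, 'v) chart = "'a set \<times> ('a \<Rightarrow> 'v)"

definition smooth_atlas :: "('a, 'v::euclidean_space) chart set \<Rightarrow> bool" where
  "smooth_atlas \<A> \<longleftrightarrow>
     (\<forall>(U, \<phi>) \<in> \<A>. inj_on \<phi> U \<and> open (\<phi> ` U)) \<and>
     (\<forall>(U, \<phi>) \<in> \<A>. \<forall>(V, \<psi>) \<in> \<A>.
        open (\<phi> ` (U \<inter> V)) \<and> smooth_on (\<phi> ` (U \<inter> V)) (\<psi> \<circ> inv_into U \<phi>))"

definition atlas_carrier :: "('a, 'v) chart set \<Rightarrow> 'a set" where
  "atlas_carrier \<A> = (\<Union>c\<in>\<A>. fst c)"

text \<open>The unique topology on the carrier for which all charts are homeomorphisms from open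
  sets onto open sets.\<close>

definition atlas_topology :: "('a, 'v::euclidean_space) chart set \<Rightarrow> 'a topology" where
  "atlas_topology \<A> =
     topology (\<lambda>W. W \<subseteq> atlas_carrier \<A> \<and> (\<forall>(U, \<phi>) \<in> \<A>. open (\<phi> ` (U \<inter> W))))"

definition smooth_manifold :: "('a, 'v::euclidean_space) chart set \<Rightarrow> bool" where
  "smooth_manifold \<A> \<longleftrightarrow> smooth_atlas \<A> \<and>
     Hausdorff_space (atlas_topology \<A>) \<and> second_countable (atlas_topology \<A>)"

definition smooth_fun ::
    "('a, 'v::euclidean_space) chart set \<Rightarrow> 'a set \<Rightarrow> ('a \<Rightarrow> real) \<Rightarrow> bool" where
  "smooth_fun \<A> W f \<longleftrightarrow> (\<forall>(U, \<phi>) \<in> \<A>. smooth_on (\<phi> ` (U \<inter> W)) (f \<circ> inv_into U \<phi>))"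

definition smooth_at ::
    "('a, 'v::euclidean_space) chart set \<Rightarrow> 'a \<Rightarrow> ('a \<Rightarrow> real) \<Rightarrow> bool" where
  "smooth_at \<A> e f \<longleftrightarrow> (\<exists>W. openin (atlas_topology \<A>) W \<and> e \<in> W \<and> smooth_fun \<A> W f)"

text \<open>Derivative of \<open>f\<close> at \<open>e\<close> in the coordinate direction \<open>w\<close> of a chart.\<close>

definition pd :: "('a, 'v::euclidean_space) chart \<Rightarrow> 'v \<Rightarrow> ('a \<Rightarrow> real) \<Rightarrow> 'a \<Rightarrow> real" where
  "pd c w f e = frechet_derivative (f \<circ> inv_into (fst c) (snd c)) (at (snd c e)) w"

text \<open>\<open>jac c' c a b s\<close> is the partial derivative at \<open>s\<close> of the \<open>a\<close>-th coordinate of \<open>c'\<close>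
  with respect to the \<open>b\<close>-th coordinate of \<open>c\<close>.\<close>

definition jac ::
    "('a, real^'k) chart \<Rightarrow> ('a, real^'k) chart \<Rightarrow> 'k::finite \<Rightarrow> 'k \<Rightarrow> 'a \<Rightarrow> real" where
  "jac c' c a b s = pd c (axis b 1) (\<lambda>s'. snd c' s' $ a) s"

section \<open>Vector fields, linear connections and torsion\<close>

text \<open>Tangent vectors at \<open>e\<close> are derivations of the functions that are smooth near \<open>e\<close>.
  Being set to 0 on all other functions, they are equal iff they agree as derivations.\<close>

definition tangent_space ::
    "('a, 'v::euclidean_space) chart set \<Rightarrow> 'a \<Rightarrow> (('a \<Rightarrow> real) \<Rightarrow> real) set" where
  "tangent_space \<A> e = {v.
     (\<forall>f g. smooth_at \<A> e f \<and> smooth_at \<A> e g \<longrightarrow>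
        v (\<lambda>x. f x + g x) = v f + v g \<and>
        v (\<lambda>x. f x * g x) = f e * v g + g e * v f) \<and>
     (\<forall>f r. smooth_at \<A> e f \<longrightarrow> v (\<lambda>x. r * f x) = r * v f) \<and>
     (\<forall>f. \<not> smooth_at \<A> e f \<longrightarrow> v f = 0)}"

type_synonym 'a vfield = "'a \<Rightarrow> ('a \<Rightarrow> real) \<Rightarrow> real"

definition vector_fields ::
    "('a, 'v::euclidean_space) chart set \<Rightarrow> 'a set \<Rightarrow> 'a vfield set" where
  "vector_fields \<A> W = {X.
     (\<forall>e\<in>W. X e \<in> tangent_space \<A> e) \<and>
     (\<forall>W' f. openin (atlas_topology \<A>) W' \<and> W' \<subseteq> W \<and> smooth_fun \<A> W' f \<longrightarrow>
        smooth_fun \<A> W' (\<lambda>e. X e f))}"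

definition vf_add :: "'a vfield \<Rightarrow> 'a vfield \<Rightarrow> 'a vfield" where
  "vf_add X Y = (\<lambda>e g. X e g + Y e g)"

definition vf_scale :: "('a \<Rightarrow> real) \<Rightarrow> 'a vfield \<Rightarrow> 'a vfield" where
  "vf_scale f X = (\<lambda>e g. f e * X e g)"

definition lie_bracket ::
    "('a, 'v::euclidean_space) chart set \<Rightarrow> 'a vfield \<Rightarrow> 'a vfield \<Rightarrow> 'a vfield" where
  "lie_bracket \<A> X Y = (\<lambda>e f. if smooth_at \<A> e f
     then X e (\<lambda>e'. Y e' f) - Y e (\<lambda>e'. X e' f) else 0)"

text \<open>Operations on vector fields over arbitrary open subsets \<open>W\<close>, compatible with restriction.
  The values of a field outside of \<open>W\<close> are irrelevant, so a single operator represents the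
  operators over all \<open>W\<close>.  For linear connections this is the usual notion, since a connection
  on the whole manifold restricts uniquely to every open subset.\<close>

definition local_operator ::
    "('a, 'v::euclidean_space) chart set \<Rightarrow> ('a vfield \<Rightarrow> 'a vfield \<Rightarrow> 'a vfield) \<Rightarrow> bool" where
  "local_operator \<A> S \<longleftrightarrow>
     (\<forall>W. openin (atlas_topology \<A>) W \<longrightarrow>
       (\<forall>X\<in>vector_fields \<A> W. \<forall>Y\<in>vector_fields \<A> W.
          S X Y \<in> vector_fields \<A> W \<and>
          (\<forall>X' Y'. (\<forall>e\<in>W. X' e = X e \<and> Y' e = Y e) \<longrightarrow> (\<forall>e\<in>W. S X' Y' e = S X Y e))))"

definition linear_connection ::
    "('a, 'v::euclidean_space) chart set \<Rightarrow> ('a vfield \<Rightarrow> 'a vfield \<Rightarrow> 'a vfield) \<Rightarrow> bool" where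
  "linear_connection \<A> D \<longleftrightarrow> local_operator \<A> D \<and>
     (\<forall>W X X' Y Y' f e. openin (atlas_topology \<A>) W \<and> smooth_fun \<A> W f \<and>
        {X, X', Y, Y'} \<subseteq> vector_fields \<A> W \<and> e \<in> W \<longrightarrow>
        D (vf_add X X') Y e = vf_add (D X Y) (D X' Y) e \<and>
        D (vf_scale f X) Y e = vf_scale f (D X Y) e \<and>
        D X (vf_add Y Y') e = vf_add (D X Y) (D X Y') e \<and>
        D X (vf_scale f Y) e = vf_add (vf_scale (\<lambda>e'. X e' f) Y) (vf_scale f (D X Y)) e)"

text \<open>Vector-valued tensor fields with two vector arguments.\<close>

definition tensor_field ::
    "('a, 'v::euclidean_space) chart set \<Rightarrow> ('a vfield \<Rightarrow> 'a vfield \<Rightarrow> 'a vfield) \<Rightarrow> bool" where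
  "tensor_field \<A> S \<longleftrightarrow> local_operator \<A> S \<and>
     (\<forall>W X X' Y Y' f e. openin (atlas_topology \<A>) W \<and> smooth_fun \<A> W f \<and>
        {X, X', Y, Y'} \<subseteq> vector_fields \<A> W \<and> e \<in> W \<longrightarrow>
        S (vf_add X X') Y e = vf_add (S X Y) (S X' Y) e \<and>
        S (vf_scale f X) Y e = vf_scale f (S X Y) e \<and>
        S X (vf_add Y Y') e = vf_add (S X Y) (S X Y') e \<and>
        S X (vf_scale f Y) e = vf_scale f (S X Y) e)"

definition torsion :: "('a, 'v::euclidean_space) chart set \<Rightarrow>
    ('a vfield \<Rightarrow> 'a vfield \<Rightarrow> 'a vfield) \<Rightarrow> 'a vfield \<Rightarrow> 'a vfield \<Rightarrow> 'a vfield" where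
  "torsion \<A> D X Y = (\<lambda>e g. D X Y e g - D Y X e g - lie_bracket \<A> X Y e g)"

definition coord_field ::
    "('a, 'v::euclidean_space) chart set \<Rightarrow> ('a, 'v) chart \<Rightarrow> 'v \<Rightarrow> 'a vfield" where
  "coord_field \<A> c w = (\<lambda>e f. if smooth_at \<A> e f then pd c w f e else 0)"

section \<open>The dual 1-jet bundle\<close>

text \<open>Throughout, \<open>\<A>\<close> is an atlas of the manifold of the \<open>t\<^sup>a\<close> and \<open>\<B>\<close> an atlas of the manifold
  of the \<open>x\<^sup>i\<close>; \<open>c\<close> and \<open>d\<close> denote charts of these.
  A point of the bundle is a triple \<open>(t, x, p)\<close>, where \<open>p\<close> assigns to each pair of charts around
  \<open>t\<close> and \<open>x\<close> the components \<open>p c d $ i $ a\<close> (the fibre coordinates with lower index \<open>i\<close> and upper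
  index \<open>a\<close>), subject to the transformation law; \<open>p\<close> is set to 0 on all other arguments.\<close>

type_synonym ('t, 'x, 'm, 'n) jet =
  "'t \<times> 'x \<times> (('t, real^'m) chart \<Rightarrow> ('x, real^'n) chart \<Rightarrow> real^'m^'n)"

type_synonym ('m, 'n) jet_model = "(real^'m) \<times> (real^'n) \<times> (real^'m^'n)"

definition dual_jet :: "('t, real^'m::finite) chart set \<Rightarrow> ('x, real^'n::finite) chart set \<Rightarrow>
    ('t, 'x, 'm, 'n) jet set" where
  "dual_jet \<A> \<B> = {(t, x, p). t \<in> atlas_carrier \<A> \<and> x \<in> atlas_carrier \<B> \<and>
     (\<forall>c\<in>\<A>. \<forall>c'\<in>\<A>. \<forall>d\<in>\<B>. \<forall>d'\<in>\<B>. t \<in> fst c \<inter> fst c' \<and> x \<in> fst d \<inter> fst d' \<longrightarrow>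
        (\<forall>i a. p c' d' $ i $ a =
           (\<Sum>j\<in>UNIV. \<Sum>b\<in>UNIV. jac d d' j i x * jac c' c a b t * p c d $ j $ b))) \<and>
     (\<forall>c d. \<not> (c \<in> \<A> \<and> t \<in> fst c \<and> d \<in> \<B> \<and> x \<in> fst d) \<longrightarrow> p c d = 0)}"

definition jet_chart :: "('t, real^'m::finite) chart set \<Rightarrow> ('x, real^'n::finite) chart set \<Rightarrow>
    ('t, real^'m) chart \<Rightarrow> ('x, real^'n) chart \<Rightarrow>
    (('t, 'x, 'm, 'n) jet, ('m, 'n) jet_model) chart" where
  "jet_chart \<A> \<B> c d =
     ({(t, x, p). (t, x, p) \<in> dual_jet \<A> \<B> \<and> t \<in> fst c \<and> x \<in> fst d},
      (\<lambda>(t, x, p). (snd c t, snd d x, p c d)))"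

definition jet_atlas :: "('t, real^'m::finite) chart set \<Rightarrow> ('x, real^'n::finite) chart set \<Rightarrow>
    (('t, 'x, 'm, 'n) jet, ('m, 'n) jet_model) chart set" where
  "jet_atlas \<A> \<B> = {jet_chart \<A> \<B> c d | c d. c \<in> \<A> \<and> d \<in> \<B>}"

definition dir_t :: "'m::finite \<Rightarrow> ('m, 'n::finite) jet_model" where
  "dir_t a = (axis a 1, 0, 0)"

definition dir_x :: "'n::finite \<Rightarrow> ('m::finite, 'n) jet_model" where
  "dir_x i = (0, axis i 1, 0)"

definition dir_p :: "'n::finite \<Rightarrow> 'm::finite \<Rightarrow> ('m, 'n) jet_model" where
  "dir_p i a = (0, 0, axis i (axis a 1))"

section \<open>Nonlinear connections and adapted bases\<close>

text \<open>\<open>N1 c d i a b e\<close> and \<open>N2 c d i a j e\<close> are the components of the nonlinear connection in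
  the charts \<open>c\<close>, \<open>d\<close>: the temporal one with index pair \<open>(i)\<close> below, \<open>(a)\<close> above and \<open>b\<close> below,
  and the spatial one with \<open>(i)\<close> below, \<open>(a)\<close> above and \<open>j\<close> below.\<close>

type_synonym ('t, 'x, 'm, 'n) nlc1 = "('t, real^'m) chart \<Rightarrow> ('x, real^'n) chart \<Rightarrow>
  'n \<Rightarrow> 'm \<Rightarrow> 'm \<Rightarrow> ('t, 'x, 'm, 'n) jet \<Rightarrow> real"

type_synonym ('t, 'x, 'm, 'n) nlc2 = "('t, real^'m) chart \<Rightarrow> ('x, real^'n) chart \<Rightarrow>
  'n \<Rightarrow> 'm \<Rightarrow> 'n \<Rightarrow> ('t, 'x, 'm, 'n) jet \<Rightarrow> real"

definition nonlinear_connection ::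
    "('t, real^'m::finite) chart set \<Rightarrow> ('x, real^'n::finite) chart set \<Rightarrow>
     ('t, 'x, 'm, 'n) nlc1 \<Rightarrow> ('t, 'x, 'm, 'n) nlc2 \<Rightarrow> bool" where
  "nonlinear_connection \<A> \<B> N1 N2 \<longleftrightarrow>
     (\<forall>c\<in>\<A>. \<forall>d\<in>\<B>. \<forall>i a.
        (\<forall>b. smooth_fun (jet_atlas \<A> \<B>) (fst (jet_chart \<A> \<B> c d)) (N1 c d i a b)) \<and>
        (\<forall>j. smooth_fun (jet_atlas \<A> \<B>) (fst (jet_chart \<A> \<B> c d)) (N2 c d i a j))) \<and>
     (\<forall>c\<in>\<A>. \<forall>c'\<in>\<A>. \<forall>d\<in>\<B>. \<forall>d'\<in>\<B>. \<forall>t x p.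
        (t, x, p) \<in> fst (jet_chart \<A> \<B> c d) \<inter> fst (jet_chart \<A> \<B> c' d') \<longrightarrow>
        (\<forall>j b a. (\<Sum>g\<in>UNIV. N1 c' d' j b g (t, x, p) * jac c' c g a t) =
           (\<Sum>k\<in>UNIV. \<Sum>g\<in>UNIV. N1 c d k g a (t, x, p) * jac c' c b g t * jac d d' k j x)
           - pd (jet_chart \<A> \<B> c d) (dir_t a) (\<lambda>(_, _, q). q c' d' $ j $ b) (t, x, p)) \<and>
        (\<forall>j b i. (\<Sum>k\<in>UNIV. N2 c' d' j b k (t, x, p) * jac d' d k i x) =
           (\<Sum>k\<in>UNIV. \<Sum>g\<in>UNIV. N2 c d k g i (t, x, p) * jac c' c b g t * jac d d' k j x)
           - pd (jet_chart \<A> \<B> c d) (dir_x i) (\<lambda>(_, _, q). q c' d' $ j $ b) (t, x, p)))"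

definition par_t :: "('t, real^'m::finite) chart set \<Rightarrow> ('x, real^'n::finite) chart set \<Rightarrow>
    ('t, real^'m) chart \<Rightarrow> ('x, real^'n) chart \<Rightarrow> 'm \<Rightarrow> ('t, 'x, 'm, 'n) jet vfield" where
  "par_t \<A> \<B> c d a = coord_field (jet_atlas \<A> \<B>) (jet_chart \<A> \<B> c d) (dir_t a)"

definition par_x :: "('t, real^'m::finite) chart set \<Rightarrow> ('x, real^'n::finite) chart set \<Rightarrow>
    ('t, real^'m) chart \<Rightarrow> ('x, real^'n) chart \<Rightarrow> 'n \<Rightarrow> ('t, 'x, 'm, 'n) jet vfield" where
  "par_x \<A> \<B> c d i = coord_field (jet_atlas \<A> \<B>) (jet_chart \<A> \<B> c d) (dir_x i)"

definition par_p :: "('t, real^'m::finite) chart set \<Rightarrow> ('x, real^'n::finite) chart set \<Rightarrow>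
    ('t, real^'m) chart \<Rightarrow> ('x, real^'n) chart \<Rightarrow> 'n \<Rightarrow> 'm \<Rightarrow> ('t, 'x, 'm, 'n) jet vfield" where
  "par_p \<A> \<B> c d i a = coord_field (jet_atlas \<A> \<B>) (jet_chart \<A> \<B> c d) (dir_p i a)"

definition delta_t :: "('t, real^'m::finite) chart set \<Rightarrow> ('x, real^'n::finite) chart set \<Rightarrow>
    ('t, 'x, 'm, 'n) nlc1 \<Rightarrow>
    ('t, real^'m) chart \<Rightarrow> ('x, real^'n) chart \<Rightarrow> 'm \<Rightarrow> ('t, 'x, 'm, 'n) jet vfield" where
  "delta_t \<A> \<B> N1 c d a = (\<lambda>e f. par_t \<A> \<B> c d a e f -
     (\<Sum>j\<in>UNIV. \<Sum>b\<in>UNIV. N1 c d j b a e * par_p \<A> \<B> c d j b e f))"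

definition delta_x :: "('t, real^'m::finite) chart set \<Rightarrow> ('x, real^'n::finite) chart set \<Rightarrow>
    ('t, 'x, 'm, 'n) nlc2 \<Rightarrow>
    ('t, real^'m) chart \<Rightarrow> ('x, real^'n) chart \<Rightarrow> 'n \<Rightarrow> ('t, 'x, 'm, 'n) jet vfield" where
  "delta_x \<A> \<B> N2 c d i = (\<lambda>e f. par_x \<A> \<B> c d i e f -
     (\<Sum>j\<in>UNIV. \<Sum>b\<in>UNIV. N2 c d j b i e * par_p \<A> \<B> c d j b e f))"

text \<open>The dual basis: values of \<open>dt\<^sup>a\<close>, \<open>dx\<^sup>i\<close> and \<open>\<delta>p\<close> on a tangent vector \<open>v\<close> (at \<open>e\<close>).\<close>

definition co_t :: "('t, real^'m::finite) chart \<Rightarrow> 'm \<Rightarrow>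
    ((('t, 'x, 'm, 'n::finite) jet \<Rightarrow> real) \<Rightarrow> real) \<Rightarrow> real" where
  "co_t c a v = v (\<lambda>(t, _, _). snd c t $ a)"

definition co_x :: "('x, real^'n::finite) chart \<Rightarrow> 'n \<Rightarrow>
    ((('t, 'x, 'm::finite, 'n) jet \<Rightarrow> real) \<Rightarrow> real) \<Rightarrow> real" where
  "co_x d i v = v (\<lambda>(_, x, _). snd d x $ i)"

definition co_p :: "('t, 'x, 'm::finite, 'n::finite) nlc1 \<Rightarrow> ('t, 'x, 'm, 'n) nlc2 \<Rightarrow>
    ('t, real^'m) chart \<Rightarrow> ('x, real^'n) chart \<Rightarrow> 'n \<Rightarrow> 'm \<Rightarrow> ('t, 'x, 'm, 'n) jet \<Rightarrow>
    ((('t, 'x, 'm, 'n) jet \<Rightarrow> real) \<Rightarrow> real) \<Rightarrow> real" where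
  "co_p N1 N2 c d i a e v = v (\<lambda>(_, _, p). p c d $ i $ a)
     + (\<Sum>b\<in>UNIV. N1 c d i a b e * co_t c b v) + (\<Sum>j\<in>UNIV. N2 c d i a j e * co_x d j v)"

text \<open>The projections onto the temporal, spatial and vertical spans.  By the transformation
  laws of the adapted bases they do not depend on the charts around \<open>e\<close>.\<close>

definition proj_t :: "('t, real^'m::finite) chart set \<Rightarrow> ('x, real^'n::finite) chart set \<Rightarrow>
    ('t, 'x, 'm, 'n) nlc1 \<Rightarrow> ('t, real^'m) chart \<Rightarrow> ('x, real^'n) chart \<Rightarrow>
    ('t, 'x, 'm, 'n) jet vfield \<Rightarrow> ('t, 'x, 'm, 'n) jet vfield" where
  "proj_t \<A> \<B> N1 c d X = (\<lambda>e g. \<Sum>a\<in>UNIV. co_t c a (X e) * delta_t \<A> \<B> N1 c d a e g)"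

definition proj_x :: "('t, real^'m::finite) chart set \<Rightarrow> ('x, real^'n::finite) chart set \<Rightarrow>
    ('t, 'x, 'm, 'n) nlc2 \<Rightarrow> ('t, real^'m) chart \<Rightarrow> ('x, real^'n) chart \<Rightarrow>
    ('t, 'x, 'm, 'n) jet vfield \<Rightarrow> ('t, 'x, 'm, 'n) jet vfield" where
  "proj_x \<A> \<B> N2 c d X = (\<lambda>e g. \<Sum>i\<in>UNIV. co_x d i (X e) * delta_x \<A> \<B> N2 c d i e g)"

definition proj_v :: "('t, real^'m::finite) chart set \<Rightarrow> ('x, real^'n::finite) chart set \<Rightarrow>
    ('t, 'x, 'm, 'n) nlc1 \<Rightarrow> ('t, 'x, 'm, 'n) nlc2 \<Rightarrow>
    ('t, real^'m) chart \<Rightarrow> ('x, real^'n) chart \<Rightarrow>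
    ('t, 'x, 'm, 'n) jet vfield \<Rightarrow> ('t, 'x, 'm, 'n) jet vfield" where
  "proj_v \<A> \<B> N1 N2 c d X = (\<lambda>e g. \<Sum>i\<in>UNIV. \<Sum>a\<in>UNIV.
     co_p N1 N2 c d i a e (X e) * par_p \<A> \<B> c d i a e g)"

section \<open>N-linear and h-normal connections\<close>

type_synonym ('t, 'x, 'm, 'n) jet_connection = "('t, 'x, 'm, 'n) jet vfield \<Rightarrow>
  ('t, 'x, 'm, 'n) jet vfield \<Rightarrow> ('t, 'x, 'm, 'n) jet vfield"

text \<open>That the covariant derivative of a projection \<open>P\<close> vanishes means
  \<open>D X (P Y) = P (D X Y)\<close> for all vector fields.\<close>

definition N_linear :: "('t, real^'m::finite) chart set \<Rightarrow> ('x, real^'n::finite) chart set \<Rightarrow>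
    ('t, 'x, 'm, 'n) nlc1 \<Rightarrow> ('t, 'x, 'm, 'n) nlc2 \<Rightarrow> ('t, 'x, 'm, 'n) jet_connection \<Rightarrow> bool" where
  "N_linear \<A> \<B> N1 N2 D \<longleftrightarrow> linear_connection (jet_atlas \<A> \<B>) D \<and>
     (\<forall>c\<in>\<A>. \<forall>d\<in>\<B>. \<forall>W X Y e.
        openin (atlas_topology (jet_atlas \<A> \<B>)) W \<and> W \<subseteq> fst (jet_chart \<A> \<B> c d) \<and>
        {X, Y} \<subseteq> vector_fields (jet_atlas \<A> \<B>) W \<and> e \<in> W \<longrightarrow>
        D X (proj_t \<A> \<B> N1 c d Y) e = proj_t \<A> \<B> N1 c d (D X Y) e \<and>
        D X (proj_x \<A> \<B> N2 c d Y) e = proj_x \<A> \<B> N2 c d (D X Y) e \<and>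
        D X (proj_v \<A> \<B> N1 N2 c d Y) e = proj_v \<A> \<B> N1 N2 c d (D X Y) e)"

text \<open>Adapted components of \<open>D\<close>.  The coefficients of \<open>D X Y\<close> in the adapted basis are read off
  with the dual basis.  Arguments: upper index, then lower indices in the order of the
  subscripts; for the last two definitions \<open>(k)\<close> above and \<open>(g)\<close> below come last.  The three
  families describing the derivatives of the vertical basis are not needed below: for h-normal
  connections they are determined by the others.\<close>

definition A_t :: "('t, real^'m::finite) chart set \<Rightarrow> ('x, real^'n::finite) chart set \<Rightarrow>
    ('t, 'x, 'm, 'n) nlc1 \<Rightarrow> ('t, 'x, 'm, 'n) jet_connection \<Rightarrow>
    ('t, real^'m) chart \<Rightarrow> ('x, real^'n) chart \<Rightarrow>
    'm \<Rightarrow> 'm \<Rightarrow> 'm \<Rightarrow> ('t, 'x, 'm, 'n) jet \<Rightarrow> real" where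
  "A_t \<A> \<B> N1 D c d a b g e = co_t c a (D (delta_t \<A> \<B> N1 c d g) (delta_t \<A> \<B> N1 c d b) e)"

definition A_x :: "('t, real^'m::finite) chart set \<Rightarrow> ('x, real^'n::finite) chart set \<Rightarrow>
    ('t, 'x, 'm, 'n) nlc1 \<Rightarrow> ('t, 'x, 'm, 'n) nlc2 \<Rightarrow> ('t, 'x, 'm, 'n) jet_connection \<Rightarrow>
    ('t, real^'m) chart \<Rightarrow> ('x, real^'n) chart \<Rightarrow>
    'n \<Rightarrow> 'n \<Rightarrow> 'm \<Rightarrow> ('t, 'x, 'm, 'n) jet \<Rightarrow> real" where
  "A_x \<A> \<B> N1 N2 D c d i j g e = co_x d i (D (delta_t \<A> \<B> N1 c d g) (delta_x \<A> \<B> N2 c d j) e)"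

definition H_t :: "('t, real^'m::finite) chart set \<Rightarrow> ('x, real^'n::finite) chart set \<Rightarrow>
    ('t, 'x, 'm, 'n) nlc1 \<Rightarrow> ('t, 'x, 'm, 'n) nlc2 \<Rightarrow> ('t, 'x, 'm, 'n) jet_connection \<Rightarrow>
    ('t, real^'m) chart \<Rightarrow> ('x, real^'n) chart \<Rightarrow>
    'm \<Rightarrow> 'm \<Rightarrow> 'n \<Rightarrow> ('t, 'x, 'm, 'n) jet \<Rightarrow> real" where
  "H_t \<A> \<B> N1 N2 D c d a b k e = co_t c a (D (delta_x \<A> \<B> N2 c d k) (delta_t \<A> \<B> N1 c d b) e)"

definition H_x :: "('t, real^'m::finite) chart set \<Rightarrow> ('x, real^'n::finite) chart set \<Rightarrow>
    ('t, 'x, 'm, 'n) nlc2 \<Rightarrow> ('t, 'x, 'm, 'n) jet_connection \<Rightarrow>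
    ('t, real^'m) chart \<Rightarrow> ('x, real^'n) chart \<Rightarrow>
    'n \<Rightarrow> 'n \<Rightarrow> 'n \<Rightarrow> ('t, 'x, 'm, 'n) jet \<Rightarrow> real" where
  "H_x \<A> \<B> N2 D c d i j k e = co_x d i (D (delta_x \<A> \<B> N2 c d k) (delta_x \<A> \<B> N2 c d j) e)"

definition C_t :: "('t, real^'m::finite) chart set \<Rightarrow> ('x, real^'n::finite) chart set \<Rightarrow>
    ('t, 'x, 'm, 'n) nlc1 \<Rightarrow> ('t, 'x, 'm, 'n) jet_connection \<Rightarrow>
    ('t, real^'m) chart \<Rightarrow> ('x, real^'n) chart \<Rightarrow>
    'm \<Rightarrow> 'm \<Rightarrow> 'n \<Rightarrow> 'm \<Rightarrow> ('t, 'x, 'm, 'n) jet \<Rightarrow> real" where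
  "C_t \<A> \<B> N1 D c d a b k g e = co_t c a (D (par_p \<A> \<B> c d k g) (delta_t \<A> \<B> N1 c d b) e)"

definition C_x :: "('t, real^'m::finite) chart set \<Rightarrow> ('x, real^'n::finite) chart set \<Rightarrow>
    ('t, 'x, 'm, 'n) nlc2 \<Rightarrow> ('t, 'x, 'm, 'n) jet_connection \<Rightarrow>
    ('t, real^'m) chart \<Rightarrow> ('x, real^'n) chart \<Rightarrow>
    'n \<Rightarrow> 'n \<Rightarrow> 'n \<Rightarrow> 'm \<Rightarrow> ('t, 'x, 'm, 'n) jet \<Rightarrow> real" where
  "C_x \<A> \<B> N2 D c d i j k g e = co_x d i (D (par_p \<A> \<B> c d k g) (delta_x \<A> \<B> N2 c d j) e)"

text \<open>Semi-Riemannian metrics: symmetric, nondegenerate, of constant index.\<close>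

definition form_index :: "real^'m^'m::finite \<Rightarrow> nat" where
  "form_index G = Max {dim S | S. subspace S \<and> (\<forall>v\<in>S. v \<noteq> 0 \<longrightarrow> v \<bullet> (G *v v) < 0)}"

definition semi_riemannian_metric ::
    "('t, real^'m::finite) chart set \<Rightarrow> (('t, real^'m) chart \<Rightarrow> 't \<Rightarrow> real^'m^'m) \<Rightarrow> bool" where
  "semi_riemannian_metric \<A> h \<longleftrightarrow>
     (\<forall>c\<in>\<A>. \<forall>a b. smooth_fun \<A> (fst c) (\<lambda>t. h c t $ a $ b)) \<and>
     (\<forall>c\<in>\<A>. \<forall>t\<in>fst c. transpose (h c t) = h c t \<and> invertible (h c t)) \<and>
     (\<exists>q. \<forall>c\<in>\<A>. \<forall>t\<in>fst c. form_index (h c t) = q) \<and>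
     (\<forall>c\<in>\<A>. \<forall>c'\<in>\<A>. \<forall>t\<in>fst c \<inter> fst c'. \<forall>a b.
        h c t $ a $ b =
          (\<Sum>f\<in>UNIV. \<Sum>g\<in>UNIV. h c' t $ f $ g * jac c' c f a t * jac c' c g b t))"

definition christoffel :: "(('t, real^'m::finite) chart \<Rightarrow> 't \<Rightarrow> real^'m^'m) \<Rightarrow>
    ('t, real^'m) chart \<Rightarrow> 'm \<Rightarrow> 'm \<Rightarrow> 'm \<Rightarrow> 't \<Rightarrow> real" where
  "christoffel h c a b g t = (\<Sum>f\<in>UNIV. matrix_inv (h c t) $ a $ f / 2 *
     (pd c (axis b 1) (\<lambda>s. h c s $ f $ g) t
      + pd c (axis g 1) (\<lambda>s. h c s $ b $ f) t
      - pd c (axis f 1) (\<lambda>s. h c s $ b $ g) t))"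

definition kron :: "'k \<Rightarrow> 'k \<Rightarrow> real" where
  "kron i j = (if i = j then 1 else 0)"

definition JJ :: "('t, 'x, 'm::finite, 'n::finite) nlc1 \<Rightarrow> ('t, 'x, 'm, 'n) nlc2 \<Rightarrow>
    (('t, real^'m) chart \<Rightarrow> 't \<Rightarrow> real^'m^'m) \<Rightarrow> ('t, real^'m) chart \<Rightarrow> ('x, real^'n) chart \<Rightarrow>
    ('t, 'x, 'm, 'n) jet vfield \<Rightarrow> ('t, 'x, 'm, 'n) jet vfield \<Rightarrow> ('t, 'x, 'm, 'n) jet vfield \<Rightarrow>
    ('t, 'x, 'm, 'n) jet \<Rightarrow> real" where
  "JJ N1 N2 h c d X Y Z e = (\<Sum>a\<in>UNIV. \<Sum>b\<in>UNIV. \<Sum>i\<in>UNIV. \<Sum>j\<in>UNIV.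
     h c (fst e) $ a $ b * kron i j *
     co_p N1 N2 c d i a e (X e) * co_t c b (Y e) * co_x d j (Z e))"

definition h_normal :: "('t, real^'m::finite) chart set \<Rightarrow> ('x, real^'n::finite) chart set \<Rightarrow>
    ('t, 'x, 'm, 'n) nlc1 \<Rightarrow> ('t, 'x, 'm, 'n) nlc2 \<Rightarrow>
    (('t, real^'m) chart \<Rightarrow> 't \<Rightarrow> real^'m^'m) \<Rightarrow> ('t, 'x, 'm, 'n) jet_connection \<Rightarrow> bool" where
  "h_normal \<A> \<B> N1 N2 h D \<longleftrightarrow> N_linear \<A> \<B> N1 N2 D \<and>
     (\<forall>c\<in>\<A>. \<forall>d\<in>\<B>. \<forall>e\<in>fst (jet_chart \<A> \<B> c d). \<forall>a b g i.
        A_t \<A> \<B> N1 D c d a b g e = christoffel h c a b g (fst e) \<and>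
        H_t \<A> \<B> N1 N2 D c d a b i e = 0 \<and>
        C_t \<A> \<B> N1 D c d a b i g e = 0) \<and>
     (\<forall>c\<in>\<A>. \<forall>d\<in>\<B>. \<forall>W V X Y Z e.
        openin (atlas_topology (jet_atlas \<A> \<B>)) W \<and> W \<subseteq> fst (jet_chart \<A> \<B> c d) \<and>
        {V, X, Y, Z} \<subseteq> vector_fields (jet_atlas \<A> \<B>) W \<and> e \<in> W \<longrightarrow>
        V e (JJ N1 N2 h c d X Y Z) - JJ N1 N2 h c d (D V X) Y Z e
          - JJ N1 N2 h c d X (D V Y) Z e - JJ N1 N2 h c d X Y (D V Z) e = 0)"

section \<open>d-tensors\<close>

text \<open>Families of smooth local functions, indexed by \<open>k\<close> upper and \<open>l\<close> lower temporal indices and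
  by \<open>q\<close> upper and \<open>r\<close> lower spatial indices (given as lists, in this order), which transform
  tensorially under changes of charts.\<close>

definition d_tensor :: "('t, real^'m::finite) chart set \<Rightarrow> ('x, real^'n::finite) chart set \<Rightarrow>
    nat \<Rightarrow> nat \<Rightarrow> nat \<Rightarrow> nat \<Rightarrow>
    (('t, real^'m) chart \<Rightarrow> ('x, real^'n) chart \<Rightarrow>
     'm list \<Rightarrow> 'm list \<Rightarrow> 'n list \<Rightarrow> 'n list \<Rightarrow> ('t, 'x, 'm, 'n) jet \<Rightarrow> real) \<Rightarrow> bool" where
  "d_tensor \<A> \<B> k l q r K \<longleftrightarrow>
     (\<forall>as bs us vs. length as = k \<and> length bs = l \<and> length us = q \<and> length vs = r \<longrightarrow>
       (\<forall>c\<in>\<A>. \<forall>d\<in>\<B>.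
          smooth_fun (jet_atlas \<A> \<B>) (fst (jet_chart \<A> \<B> c d)) (K c d as bs us vs)) \<and>
       (\<forall>c\<in>\<A>. \<forall>c'\<in>\<A>. \<forall>d\<in>\<B>. \<forall>d'\<in>\<B>. \<forall>t x p.
          (t, x, p) \<in> fst (jet_chart \<A> \<B> c d) \<inter> fst (jet_chart \<A> \<B> c' d') \<longrightarrow>
          K c' d' as bs us vs (t, x, p) =
            (\<Sum>as' | length as' = k. \<Sum>bs' | length bs' = l.
             \<Sum>us' | length us' = q. \<Sum>vs' | length vs' = r.
               (\<Prod>s<k. jac c' c (as ! s) (as' ! s) t) *
               (\<Prod>s<l. jac c c' (bs' ! s) (bs ! s) t) *
               (\<Prod>s<q. jac d' d (us ! s) (us' ! s) x) *
               (\<Prod>s<r. jac d d' (vs' ! s) (vs ! s) x) *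
               K c d as' bs' us' vs' (t, x, p))))"

section \<open>The torsion components of an h-normal connection\<close>

text \<open>Index arguments follow the order of the printed indices from left to right, with an
  upper index preceding the lower index of the same pair, e.g. \<open>P_tp \<dots> f r a j b\<close> has \<open>(f)\<close> above
  \<open>(r)\<close>, then \<open>a\<close> below, then \<open>(j)\<close> above \<open>(b)\<close>.\<close>

definition T_tx where
  "T_tx \<A> \<B> N1 N2 D c d r a j e = - A_x \<A> \<B> N1 N2 D c d r j a e"

definition T_xx where
  "T_xx \<A> \<B> N2 D c d r i j e = H_x \<A> \<B> N2 D c d r i j e - H_x \<A> \<B> N2 D c d r j i e"

definition P_xp where
  "P_xp \<A> \<B> N2 D c d r i j b e = C_x \<A> \<B> N2 D c d r i j b e"

definition P_tp where
  "P_tp \<A> \<B> N1 N2 h D c d f r a j b e =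
     par_p \<A> \<B> c d j b e (N1 c d r f a)
     + kron b f * A_x \<A> \<B> N1 N2 D c d j r a e - kron r j * christoffel h c f b a (fst e)"

definition P_xpv where
  "P_xpv \<A> \<B> N2 D c d f r i j b e =
     par_p \<A> \<B> c d j b e (N2 c d r f i) + kron b f * H_x \<A> \<B> N2 D c d j r i e"

definition R_tt where
  "R_tt \<A> \<B> N1 c d f r a b e =
     delta_t \<A> \<B> N1 c d b e (N1 c d r f a) - delta_t \<A> \<B> N1 c d a e (N1 c d r f b)"

definition R_tx where
  "R_tx \<A> \<B> N1 N2 c d f r a j e =
     delta_x \<A> \<B> N2 c d j e (N1 c d r f a) - delta_t \<A> \<B> N1 c d a e (N2 c d r f j)"

definition R_xx where
  "R_xx \<A> \<B> N2 c d f r i j e =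
     delta_x \<A> \<B> N2 c d j e (N2 c d r f i) - delta_x \<A> \<B> N2 c d i e (N2 c d r f j)"

definition S_pp where
  "S_pp \<A> \<B> N2 D c d f r i a j b e =
     - (kron a f * C_x \<A> \<B> N2 D c d i r j b e - kron b f * C_x \<A> \<B> N2 D c d j r i a e)"

end

theory Submission
  imports Defs
begin

text \<open>The adapted basis fields are fields \<open>w - F\<^sup>b\<^sub>j \<partial>/\<partial>p\<^sup>b\<^sub>j\<close> with a constant coordinate direction \<open>w\<close>, so by the
  symmetry of second derivatives their brackets are vertical, with the derivatives of the nonlinear connection
  as coefficients.  Commuting with the three projections, \<open>D\<close> preserves the spans of the adapted basis;
  this gives the coefficients of \<open>D\<close> without having to know that derivations at a point are spanned by the
  coordinate derivatives.  The vertical coefficients follow from \<open>D J = 0\<close> by cancelling the metric, where the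
  Christoffel symbols enter through metric compatibility.  Finally, all nine families are coefficients of the
  torsion, which is bilinear over functions, on the adapted frames, and these frames change tensorially.\<close>

section \<open>Calculus of smooth functions\<close>

text \<open>Vector fields live on open sets and equations between them hold only there, whereas
  \<open>D\<close> and the bracket act on total functions whose values elsewhere are arbitrary.
  Every identity between frames is therefore used through a locality statement. Tensoriality of the
  nine families is not computed from their formulas, in which Christoffel symbols and derivatives of
  the nonlinear connection transform inhomogeneously. Each family is instead a value of the dual
  coframe on the torsion of two frame fields: changing charts in the arguments and in the coframe
  produces exactly the Jacobian factors. All inhomogeneous terms are absorbed in the transformation
  laws of \<open>delta_t\<close> and \<open>delta_x\<close>, which is where the law of the nonlinear
  connection enters. For the vertical coefficients of \<open>D\<close>, the tensor J is evaluated on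
  the triple \<open>par_p\<close>, \<open>delta_t\<close>, \<open>delta_x\<close> only; there it is
  a Kronecker delta times a component of the metric, and the unknown coefficient occurs in a single
  term.\<close>

lemma frechet_derivative_cong_open:
  assumes "open S" "x \<in> S" "\<And>y. y \<in> S \<Longrightarrow> f y = g y"
  shows "frechet_derivative f (at x) = frechet_derivative g (at x)"
proof -
  have "(f has_derivative F) (at x) \<longleftrightarrow> (g has_derivative F) (at x)" for F
    using assms has_derivative_transform_within_open[of f F x UNIV S g]
      has_derivative_transform_within_open[of g F x UNIV S f] by auto
  then show ?thesis unfolding frechet_derivative_def by simp
qed

lemma differentiable_on_open_iff:
  "open S \<Longrightarrow> f differentiable_on S \<longleftrightarrow> (\<forall>x\<in>S. f differentiable at x)"
  by (simp add: differentiable_on_eq_differentiable_at)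

text \<open>Openness enters through the derivatives: \<open>frechet_derivative\<close> looks at a
  full neighbourhood of the point, while differentiability within \<open>S\<close> depends on the
  values on \<open>S\<close> only.\<close>

lemma Ck_on_cong:
  assumes "open S" "\<And>x. x \<in> S \<Longrightarrow> f x = g x"
  shows "Ck_on k S f \<longleftrightarrow> Ck_on k S g"
  using assms(2)
proof (induction k arbitrary: f g)
  case 0
  then show ?case by (simp cong: continuous_on_cong)
next
  case (Suc k)
  have "f differentiable_on S \<longleftrightarrow> g differentiable_on S"
    unfolding differentiable_on_def differentiable_def
    using Suc.prems has_derivative_transform by metis
  moreover have "Ck_on k S (\<lambda>x. frechet_derivative f (at x) v) \<longleftrightarrow>
      Ck_on k S (\<lambda>x. frechet_derivative g (at x) v)" for v
    by (rule Suc.IH) (metis assms(1) frechet_derivative_cong_open Suc.prems)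
  ultimately show ?case by simp
qed

lemma Ck_on_SucD: "Ck_on (Suc k) S f \<Longrightarrow> Ck_on k S f"
  by (induction k arbitrary: f) (auto intro: differentiable_imp_continuous_on)

lemma Ck_on_subset: "Ck_on k S f \<Longrightarrow> T \<subseteq> S \<Longrightarrow> Ck_on k T f"
  by (induction k arbitrary: f) (auto intro: continuous_on_subset differentiable_on_subset)

lemma Ck_on_const: "Ck_on k S (\<lambda>x. c)"
  by (induction k arbitrary: c) (auto simp: differentiable_on_const)

lemma Ck_on_bounded_linear:
  assumes "open S" "bounded_linear L"
  shows "Ck_on k S f \<Longrightarrow> Ck_on k S (\<lambda>x. L (f x))"
proof (induction k arbitrary: f)
  case 0
  then show ?case using assms by (auto intro: bounded_linear.continuous_on)
next
  case (Suc k)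
  have d: "((\<lambda>x. L (f x)) has_derivative (\<lambda>v. L (frechet_derivative f (at x) v))) (at x)" if "x \<in> S" for x
    using Suc.prems that assms
    by (auto intro!: bounded_linear.has_derivative[OF assms(2)]
        simp: differentiable_on_open_iff frechet_derivative_works)
  have "Ck_on k S (\<lambda>x. frechet_derivative (\<lambda>x. L (f x)) (at x) v)" for v
  proof (subst Ck_on_cong[OF assms(1)])
    show "frechet_derivative (\<lambda>x. L (f x)) (at x) v = L (frechet_derivative f (at x) v)"
      if "x \<in> S" for x using frechet_derivative_at[OF d[OF that]] by metis
    show "Ck_on k S (\<lambda>x. L (frechet_derivative f (at x) v))" using Suc by simp
  qed
  then show ?case using d assms(1) by (auto simp: differentiable_on_open_iff differentiable_def)
qed

lemma Ck_on_add:
  assumes "open S"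
  shows "Ck_on k S f \<Longrightarrow> Ck_on k S g \<Longrightarrow> Ck_on k S (\<lambda>x. f x + g x)"
proof (induction k arbitrary: f g)
  case 0
  then show ?case by (auto intro: continuous_on_add)
next
  case (Suc k)
  have d: "((\<lambda>x. f x + g x) has_derivative
      (\<lambda>v. frechet_derivative f (at x) v + frechet_derivative g (at x) v)) (at x)" if "x \<in> S" for x
    using Suc.prems that assms
    by (auto intro!: has_derivative_add simp: differentiable_on_open_iff frechet_derivative_works)
  have "Ck_on k S (\<lambda>x. frechet_derivative (\<lambda>x. f x + g x) (at x) v)" for v
  proof (subst Ck_on_cong[OF assms(1)])
    show "frechet_derivative (\<lambda>x. f x + g x) (at x) v =
        frechet_derivative f (at x) v + frechet_derivative g (at x) v"
      if "x \<in> S" for x using frechet_derivative_at[OF d[OF that]] by metis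
    show "Ck_on k S (\<lambda>x. frechet_derivative f (at x) v + frechet_derivative g (at x) v)"
      using Suc by simp
  qed
  then show ?case using d assms(1) by (auto simp: differentiable_on_open_iff differentiable_def)
qed

text \<open>The product rule leaves one factor undifferentiated, so the induction step needs
  \<open>f\<close> and \<open>g\<close> themselves at the lower order, which
  \<open>Ck_on_SucD\<close> supplies.\<close>

lemma Ck_on_bilinear:
  assumes "open S" "bounded_bilinear B"
  shows "Ck_on k S f \<Longrightarrow> Ck_on k S g \<Longrightarrow> Ck_on k S (\<lambda>x. B (f x) (g x))"
proof (induction k arbitrary: f g)
  case 0
  then show ?case using bounded_bilinear.continuous_on[OF assms(2)] by simp
next
  case (Suc k)
  have d: "((\<lambda>x. B (f x) (g x)) has_derivative
      (\<lambda>v. B (f x) (frechet_derivative g (at x) v) + B (frechet_derivative f (at x) v) (g x))) (at x)"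
    if "x \<in> S" for x
    using Suc.prems that assms
    by (auto intro!: bounded_bilinear.FDERIV[OF assms(2)]
        simp: differentiable_on_open_iff frechet_derivative_works)
  have "Ck_on k S (\<lambda>x. frechet_derivative (\<lambda>x. B (f x) (g x)) (at x) v)" for v
  proof (subst Ck_on_cong[OF assms(1)])
    show "frechet_derivative (\<lambda>x. B (f x) (g x)) (at x) v =
        B (f x) (frechet_derivative g (at x) v) + B (frechet_derivative f (at x) v) (g x)"
      if "x \<in> S" for x using frechet_derivative_at[OF d[OF that]] by metis
    show "Ck_on k S (\<lambda>x. B (f x) (frechet_derivative g (at x) v) + B (frechet_derivative f (at x) v) (g x))"
      using Suc.prems Suc.IH Ck_on_SucD[OF Suc.prems(1)] Ck_on_SucD[OF Suc.prems(2)]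
      by (intro Ck_on_add[OF assms(1)]) auto
  qed
  then show ?case using d assms(1) by (auto simp: differentiable_on_open_iff differentiable_def)
qed

lemma Ck_on_sum:
  assumes "open S" "\<And>i. i \<in> I \<Longrightarrow> Ck_on k S (f i)"
  shows "Ck_on k S (\<lambda>x. \<Sum>i\<in>I. f i x)"
  using assms(2)
  by (induction I rule: infinite_finite_induct) (auto intro: Ck_on_add[OF assms(1)] simp: Ck_on_const)

text \<open>\<open>Ck_on\<close> speaks only of derivatives in constant directions. Expanding along
  \<open>Basis\<close> reduces a direction that varies with the point to these, with the components
  of the direction as coefficients.\<close>

lemma frechet_derivative_Basis:
  fixes f :: "'a::euclidean_space \<Rightarrow> 'b::real_normed_vector"
  assumes "f differentiable at x"
  shows "frechet_derivative f (at x) v = (\<Sum>b\<in>Basis. (v \<bullet> b) *\<^sub>R frechet_derivative f (at x) b)"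
proof -
  interpret linear "frechet_derivative f (at x)"
    using assms by (rule linear_frechet_derivative)
  have "frechet_derivative f (at x) v = frechet_derivative f (at x) (\<Sum>b\<in>Basis. (v \<bullet> b) *\<^sub>R b)"
    by (simp add: euclidean_representation)
  also have "\<dots> = (\<Sum>b\<in>Basis. (v \<bullet> b) *\<^sub>R frechet_derivative f (at x) b)"
    by (simp add: sum scaleR)
  finally show ?thesis .
qed

text \<open>Induction on the order with \<open>f\<close> generalised: by the chain rule the
  derivative of the composite is a sum over \<open>Basis\<close> of components of the derivative of
  \<open>g\<close> times directional derivatives of \<open>f\<close> composed with \<open>g\<close>,
  and the latter have order one less.\<close>

lemma Ck_on_compose:
  fixes f :: "'b::euclidean_space \<Rightarrow> 'c::real_normed_vector" and g :: "'a::euclidean_space \<Rightarrow> 'b"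
  assumes "open S" "open T" "g ` S \<subseteq> T"
  shows "Ck_on k T f \<Longrightarrow> Ck_on k S g \<Longrightarrow> Ck_on k S (\<lambda>x. f (g x))"
proof (induction k arbitrary: f)
  case 0
  then show ?case using assms continuous_on_compose2[of T f S g] by auto
next
  case (Suc k)
  have d: "((\<lambda>x. f (g x)) has_derivative
      (\<lambda>v. frechet_derivative f (at (g x)) (frechet_derivative g (at x) v))) (at x)" if "x \<in> S" for x
  proof -
    have "(g has_derivative frechet_derivative g (at x)) (at x)"
      using Suc.prems that assms by (auto simp: differentiable_on_open_iff frechet_derivative_works)
    moreover have "(f has_derivative frechet_derivative f (at (g x))) (at (g x))"
      using Suc.prems that assms by (auto simp: differentiable_on_open_iff frechet_derivative_works)
    ultimately show ?thesis by (rule has_derivative_compose)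
  qed
  have "Ck_on k S (\<lambda>x. frechet_derivative (\<lambda>x. f (g x)) (at x) v)" for v
  proof (subst Ck_on_cong[OF assms(1)])
    show "frechet_derivative (\<lambda>x. f (g x)) (at x) v = (\<Sum>b\<in>Basis.
        (frechet_derivative g (at x) v \<bullet> b) *\<^sub>R frechet_derivative f (at (g x)) b)"
      if "x \<in> S" for x
    proof -
      have "f differentiable at (g x)"
        using Suc.prems that assms by (auto simp: differentiable_on_open_iff)
      then show ?thesis
        unfolding frechet_derivative_at[OF d[OF that], symmetric] by (rule frechet_derivative_Basis)
    qed
    show "Ck_on k S (\<lambda>x. \<Sum>b\<in>Basis.
        (frechet_derivative g (at x) v \<bullet> b) *\<^sub>R frechet_derivative f (at (g x)) b)"
      using Suc.prems Suc.IH Ck_on_SucD[OF Suc.prems(2)] assms(1)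
      by (intro Ck_on_sum Ck_on_bilinear[OF _ bounded_bilinear_scaleR]
          Ck_on_bounded_linear[OF _ bounded_linear_inner_left]) auto
  qed
  then show ?case using d assms(1) by (auto simp: differentiable_on_open_iff differentiable_def)
qed

lemma smooth_on_cong:
  "open S \<Longrightarrow> (\<And>x. x \<in> S \<Longrightarrow> f x = g x) \<Longrightarrow> smooth_on S f \<longleftrightarrow> smooth_on S g"
  unfolding smooth_on_def using Ck_on_cong[of S f g] by blast

lemma smooth_on_subset: "smooth_on S f \<Longrightarrow> T \<subseteq> S \<Longrightarrow> smooth_on T f"
  unfolding smooth_on_def using Ck_on_subset by blast

lemma smooth_on_const: "smooth_on S (\<lambda>x. c)"
  unfolding smooth_on_def using Ck_on_const by blast

lemma smooth_on_bounded_linear: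
  "open S \<Longrightarrow> bounded_linear L \<Longrightarrow> smooth_on S f \<Longrightarrow> smooth_on S (\<lambda>x. L (f x))"
  unfolding smooth_on_def using Ck_on_bounded_linear[of S L _ f] by blast

lemma smooth_on_add:
  "open S \<Longrightarrow> smooth_on S f \<Longrightarrow> smooth_on S g \<Longrightarrow> smooth_on S (\<lambda>x. f x + g x)"
  unfolding smooth_on_def using Ck_on_add[of S _ f g] by blast

lemma smooth_on_bilinear:
  "open S \<Longrightarrow> bounded_bilinear B \<Longrightarrow> smooth_on S f \<Longrightarrow> smooth_on S g \<Longrightarrow>
    smooth_on S (\<lambda>x. B (f x) (g x))"
  unfolding smooth_on_def using Ck_on_bilinear[of S B _ f g] by blast

lemmas smooth_on_mult = smooth_on_bilinear[OF _ bounded_bilinear_mult]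
lemmas smooth_on_scaleR = smooth_on_bilinear[OF _ bounded_bilinear_scaleR]

lemma smooth_on_diff:
  assumes "open S" "smooth_on S f" "smooth_on S g"
  shows "smooth_on S (\<lambda>x. f x - g x)"
  using smooth_on_add[OF assms(1,2) smooth_on_bounded_linear[OF assms(1)
      bounded_linear_minus[OF bounded_linear_ident] assms(3)]] by simp

lemma smooth_on_sum:
  "open S \<Longrightarrow> (\<And>i. i \<in> I \<Longrightarrow> smooth_on S (f i)) \<Longrightarrow> smooth_on S (\<lambda>x. \<Sum>i\<in>I. f i x)"
  unfolding smooth_on_def using Ck_on_sum[of S I _ f] by blast

lemma smooth_on_compose:
  fixes f :: "'b::euclidean_space \<Rightarrow> 'c::real_normed_vector" and g :: "'a::euclidean_space \<Rightarrow> 'b"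
  shows "open S \<Longrightarrow> open T \<Longrightarrow> g ` S \<subseteq> T \<Longrightarrow> smooth_on T f \<Longrightarrow> smooth_on S g \<Longrightarrow>
    smooth_on S (\<lambda>x. f (g x))"
  unfolding smooth_on_def using Ck_on_compose[of S T g _ f] by blast

lemma smooth_on_derivative: "smooth_on S f \<Longrightarrow> smooth_on S (\<lambda>x. frechet_derivative f (at x) v)"
  unfolding smooth_on_def
proof
  fix k assume "\<forall>k. Ck_on k S f"
  then have "Ck_on (Suc k) S f" ..
  then show "Ck_on k S (\<lambda>x. frechet_derivative f (at x) v)" by simp
qed

lemma smooth_on_linear:
  fixes L :: "'a::euclidean_space \<Rightarrow> 'b::real_normed_vector"
  assumes "open S" "bounded_linear L"
  shows "smooth_on S L"
  unfolding smooth_on_def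
proof
  fix k
  show "Ck_on k S L"
  proof (cases k)
    case 0
    then show ?thesis using assms(2) by (simp add: linear_continuous_on)
  next
    case (Suc l)
    have "frechet_derivative L (at x) = L" for x
      using assms(2) bounded_linear_imp_has_derivative frechet_derivative_at by metis
    then show ?thesis
      using Suc assms(2) by (simp add: Ck_on_const bounded_linear_imp_differentiable_on)
  qed
qed

lemma smooth_on_euclidean:
  fixes f :: "'a::euclidean_space \<Rightarrow> 'b::euclidean_space"
  assumes "open S" "\<And>b. b \<in> Basis \<Longrightarrow> smooth_on S (\<lambda>x. f x \<bullet> b)"
  shows "smooth_on S f"
proof -
  have "smooth_on S (\<lambda>x. \<Sum>b\<in>Basis. (f x \<bullet> b) *\<^sub>R b)"
    by (rule smooth_on_sum[OF assms(1)], rule smooth_on_scaleR[OF assms(1) assms(2) smooth_on_const])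
  then show ?thesis by (simp add: euclidean_representation)
qed

lemma smooth_on_vec:
  fixes f :: "'a::euclidean_space \<Rightarrow> 'b::euclidean_space^'k"
  assumes "open S" "\<And>i. smooth_on S (\<lambda>x. f x $ i)"
  shows "smooth_on S f"
proof (rule smooth_on_euclidean[OF assms(1)])
  fix b :: "'b^'k" assume "b \<in> Basis"
  then obtain i u where "b = axis i u" "u \<in> Basis" unfolding Basis_vec_def by blast
  moreover have "smooth_on S (\<lambda>x. f x $ i \<bullet> u)"
    by (rule smooth_on_bounded_linear[OF assms(1) bounded_linear_inner_left assms(2)])
  ultimately show "smooth_on S (\<lambda>x. f x \<bullet> b)"
    by (simp add: inner_axis)
qed

lemma smooth_on_Pair:
  fixes f :: "'a::euclidean_space \<Rightarrow> 'b::euclidean_space" and g :: "'a \<Rightarrow> 'c::euclidean_space"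
  assumes "open S" "smooth_on S f" "smooth_on S g"
  shows "smooth_on S (\<lambda>x. (f x, g x))"
proof -
  have "smooth_on S (\<lambda>x. (f x, 0) + (0, g x))"
    by (intro smooth_on_add[OF assms(1)]
        smooth_on_bounded_linear[OF assms(1) _ assms(2), of "\<lambda>y. (y, 0)"]
        smooth_on_bounded_linear[OF assms(1) _ assms(3), of "\<lambda>y. (0, y)"]
        bounded_linear_Pair bounded_linear_ident bounded_linear_zero)
  then show ?thesis by simp
qed

lemma smooth_on_imp_differentiable: "smooth_on S f \<Longrightarrow> open S \<Longrightarrow> x \<in> S \<Longrightarrow> f differentiable at x"
  unfolding smooth_on_def by (drule spec[of _ "Suc 0"]) (simp add: differentiable_on_open_iff)

lemma smooth_on_imp_has_derivative:
  "smooth_on S f \<Longrightarrow> open S \<Longrightarrow> x \<in> S \<Longrightarrow> (f has_derivative frechet_derivative f (at x)) (at x)"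
  using smooth_on_imp_differentiable frechet_derivative_works by blast

lemma smooth_on_imp_continuous_on: "smooth_on S f \<Longrightarrow> continuous_on S f"
  unfolding smooth_on_def by (drule spec[of _ 0]) simp

text \<open>This is the coordinate expression of a vector field with coefficient map
  \<open>\<xi>\<close> applied to a function; it is the reason why such fields preserve
  smoothness.\<close>

lemma smooth_on_derivative_along:
  fixes f :: "'a::euclidean_space \<Rightarrow> 'b::real_normed_vector"
  assumes "open S" "smooth_on S f" "smooth_on S \<xi>"
  shows "smooth_on S (\<lambda>x. frechet_derivative f (at x) (\<xi> x))"
proof (subst smooth_on_cong[OF assms(1)])
  show "frechet_derivative f (at x) (\<xi> x) = (\<Sum>b\<in>Basis. (\<xi> x \<bullet> b) *\<^sub>R frechet_derivative f (at x) b)"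
    if "x \<in> S" for x
    by (rule frechet_derivative_Basis[OF smooth_on_imp_differentiable[OF assms(2,1) that]])
  show "smooth_on S (\<lambda>x. \<Sum>b\<in>Basis. (\<xi> x \<bullet> b) *\<^sub>R frechet_derivative f (at x) b)"
    by (rule smooth_on_sum[OF assms(1)], rule smooth_on_scaleR[OF assms(1)
          smooth_on_bounded_linear[OF assms(1) bounded_linear_inner_left assms(3)]
          smooth_on_derivative[OF assms(2)]])
qed

section \<open>Symmetry of second derivatives, and derivatives along a varying direction\<close>

lemma double_difference:
  fixes f :: "'a::euclidean_space \<Rightarrow> real"
  assumes S: "open S" and f: "smooth_on S f" and h: "0 < h"
    and sq: "\<And>s t. 0 \<le> s \<Longrightarrow> s \<le> h \<Longrightarrow> 0 \<le> t \<Longrightarrow> t \<le> h \<Longrightarrow> x + s *\<^sub>R v + t *\<^sub>R w \<in> S"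
  shows "\<exists>s t. 0 \<le> s \<and> s \<le> h \<and> 0 \<le> t \<and> t \<le> h \<and>
    f (x + h *\<^sub>R v + h *\<^sub>R w) - f (x + h *\<^sub>R v) - f (x + h *\<^sub>R w) + f x =
      h * h * frechet_derivative (\<lambda>y. frechet_derivative f (at y) v) (at (x + s *\<^sub>R v + t *\<^sub>R w)) w"
proof -
  let ?Dv = "\<lambda>y. frechet_derivative f (at y) v"
  \<comment> \<open>On a line, a smooth function becomes a function of one real variable, to which
    the mean value theorem applies.\<close>
  have along: "((\<lambda>s. F (p + s *\<^sub>R u)) has_real_derivative frechet_derivative F (at (p + s *\<^sub>R u)) u) (at s)"
    if F: "smooth_on S F" and "p + s *\<^sub>R u \<in> S" for F :: "'a \<Rightarrow> real" and p u s
  proof -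
    have "((\<lambda>s. F (p + s *\<^sub>R u)) has_derivative (\<lambda>r. frechet_derivative F (at (p + s *\<^sub>R u)) (r *\<^sub>R u))) (at s)"
      by (rule has_derivative_compose[of "\<lambda>s. p + s *\<^sub>R u" "\<lambda>r. r *\<^sub>R u" s UNIV F,
            OF _ smooth_on_imp_has_derivative[OF F S that(2)]])
        (auto intro!: derivative_eq_intros)
    moreover have "frechet_derivative F (at (p + s *\<^sub>R u)) (r *\<^sub>R u) =
        frechet_derivative F (at (p + s *\<^sub>R u)) u * r" for r
      using linear_frechet_derivative[OF smooth_on_imp_differentiable[OF F S that(2)]]
      by (simp add: linear_cmul mult.commute)
    ultimately show ?thesis by (simp add: has_field_derivative_def)
  qed
  \<comment> \<open>The second difference is the increment, as \<open>s\<close> runs from 0 to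
    \<open>h\<close>, of \<open>f (x + h *\<^sub>R w + s *\<^sub>R v) - f (x + s *\<^sub>R
    v)\<close>. The mean value theorem leaves a difference of derivatives along \<open>v\<close> at
    two points that differ by \<open>h *\<^sub>R w\<close>, to which it is applied again.\<close>
  have "\<exists>s. 0 < s \<and> s < h \<and> (f (x + h *\<^sub>R w + h *\<^sub>R v) - f (x + h *\<^sub>R v)) - (f (x + h *\<^sub>R w + 0 *\<^sub>R v) - f (x + 0 *\<^sub>R v)) =
     (h - 0) * (?Dv (x + h *\<^sub>R w + s *\<^sub>R v) - ?Dv (x + s *\<^sub>R v))"
    using sq[of _ h] sq[of _ 0] h
    by (intro MVT2[OF h] DERIV_diff along f) (auto simp: add_ac)
  then obtain s where s: "0 < s" "s < h"
    and 1: "f (x + h *\<^sub>R w + h *\<^sub>R v) - f (x + h *\<^sub>R v) - (f (x + h *\<^sub>R w) - f x) =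
     h * (?Dv (x + h *\<^sub>R w + s *\<^sub>R v) - ?Dv (x + s *\<^sub>R v))" by auto
  have "\<exists>t. 0 < t \<and> t < h \<and> ?Dv (x + s *\<^sub>R v + h *\<^sub>R w) - ?Dv (x + s *\<^sub>R v + 0 *\<^sub>R w) =
     (h - 0) * frechet_derivative ?Dv (at (x + s *\<^sub>R v + t *\<^sub>R w)) w"
    using sq[of s] h s
    by (intro MVT2[OF h] along smooth_on_derivative f) (auto simp: add_ac)
  then obtain t where t: "0 < t" "t < h" and 2: "?Dv (x + s *\<^sub>R v + h *\<^sub>R w) - ?Dv (x + s *\<^sub>R v) =
     h * frechet_derivative ?Dv (at (x + s *\<^sub>R v + t *\<^sub>R w)) w" by auto
  show ?thesis
    using 1 2 s t by (intro exI[of _ s] exI[of _ t]) (simp add: add_ac)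
qed

text \<open>The second difference over the parallelogram with sides \<open>h *\<^sub>R v\<close> and
  \<open>h *\<^sub>R w\<close> is symmetric in \<open>v\<close> and \<open>w\<close>, so the two
  mixed derivatives take a common value at two points of it. For small \<open>h\<close> this
  contradicts continuity if they differ at \<open>x\<close>.\<close>

lemma symmetric_second_derivative:
  fixes f :: "'a::euclidean_space \<Rightarrow> real"
  assumes S: "open S" and f: "smooth_on S f" and x: "x \<in> S"
  shows "frechet_derivative (\<lambda>y. frechet_derivative f (at y) v) (at x) w =
    frechet_derivative (\<lambda>y. frechet_derivative f (at y) w) (at x) v"
    (is "?A x = ?B x")
proof (rule ccontr)
  assume ne: "?A x \<noteq> ?B x"
  let ?e = "\<bar>?A x - ?B x\<bar> / 2"
  have cA: "continuous (at x) ?A" and cB: "continuous (at x) ?B"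
    using smooth_on_imp_continuous_on[OF smooth_on_derivative[OF smooth_on_derivative[OF f]]] S x
    by (auto simp: continuous_on_eq_continuous_at)
  have e: "?e > 0" using ne by simp
  obtain d1 where d1: "d1 > 0" "\<And>y. dist y x < d1 \<Longrightarrow> dist (?A y) (?A x) < ?e"
    using cA e unfolding continuous_at_eps_delta by (metis dist_commute)
  obtain d2 where d2: "d2 > 0" "\<And>y. dist y x < d2 \<Longrightarrow> dist (?B y) (?B x) < ?e"
    using cB e unfolding continuous_at_eps_delta by (metis dist_commute)
  obtain d3 where d3: "d3 > 0" "\<And>y. dist y x < d3 \<Longrightarrow> y \<in> S"
    using S x unfolding open_dist by blast
  define d where "d = min d1 (min d2 d3)"
  \<comment> \<open>This size keeps the parallelogram within distance \<open>d\<close> of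
    \<open>x\<close>; the summand 1 keeps the denominator positive when \<open>v\<close> and
    \<open>w\<close> both vanish.\<close>
  define h where "h = d / (2 * (norm v + norm w + 1))"
  have pos: "norm v + norm w + 1 > 0" by (smt (verit) norm_ge_zero)
  have h: "h > 0" unfolding h_def d_def using d1 d2 d3 pos by auto
  have near: "dist (x + s *\<^sub>R v + t *\<^sub>R w) x < d" if "0 \<le> s" "s \<le> h" "0 \<le> t" "t \<le> h" for s t
  proof -
    have "dist (x + s *\<^sub>R v + t *\<^sub>R w) x = norm (s *\<^sub>R v + t *\<^sub>R w)" by (simp add: dist_norm add.assoc)
    also have "\<dots> \<le> s * norm v + t * norm w"
      by (rule order_trans[OF norm_triangle_ineq]) (use that in simp)
    also have "\<dots> \<le> h * norm v + h * norm w" using that by (intro add_mono mult_right_mono) auto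
    also have "\<dots> < 2 * (h * (norm v + norm w + 1))"
      using h by (simp add: algebra_simps) (smt (verit) mult_nonneg_nonneg norm_ge_zero)
    also have "\<dots> = d" unfolding h_def using pos by (simp add: field_simps)
    finally show ?thesis .
  qed
  have sq: "x + s *\<^sub>R v + t *\<^sub>R w \<in> S" if "0 \<le> s" "s \<le> h" "0 \<le> t" "t \<le> h" for s t
    using near[OF that] d3(2) unfolding d_def by auto
  then have sq': "x + t *\<^sub>R w + s *\<^sub>R v \<in> S" if "0 \<le> s" "s \<le> h" "0 \<le> t" "t \<le> h" for s t
    using that by (metis add.assoc add.commute)
  obtain s t where st: "0 \<le> s" "s \<le> h" "0 \<le> t" "t \<le> h"
      "f (x + h *\<^sub>R v + h *\<^sub>R w) - f (x + h *\<^sub>R v) - f (x + h *\<^sub>R w) + f x = h * h * ?A (x + s *\<^sub>R v + t *\<^sub>R w)"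
    using double_difference[OF S f h sq] by blast
  obtain s' t' where st': "0 \<le> s'" "s' \<le> h" "0 \<le> t'" "t' \<le> h"
      "f (x + h *\<^sub>R w + h *\<^sub>R v) - f (x + h *\<^sub>R w) - f (x + h *\<^sub>R v) + f x = h * h * ?B (x + t' *\<^sub>R w + s' *\<^sub>R v)"
    using double_difference[OF S f h sq'] by blast
  have "f (x + h *\<^sub>R w + h *\<^sub>R v) = f (x + h *\<^sub>R v + h *\<^sub>R w)" by (simp add: add_ac)
  then have "h * h * ?A (x + s *\<^sub>R v + t *\<^sub>R w) = h * h * ?B (x + t' *\<^sub>R w + s' *\<^sub>R v)"
    using st(5) st'(5) by linarith
  then have "?A (x + s *\<^sub>R v + t *\<^sub>R w) = ?B (x + t' *\<^sub>R w + s' *\<^sub>R v)"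
    using h by simp
  moreover have "x + t' *\<^sub>R w + s' *\<^sub>R v = x + s' *\<^sub>R v + t' *\<^sub>R w" by simp
  ultimately have "?A (x + s *\<^sub>R v + t *\<^sub>R w) = ?B (x + s' *\<^sub>R v + t' *\<^sub>R w)" by simp
  moreover have "dist (?A (x + s *\<^sub>R v + t *\<^sub>R w)) (?A x) < ?e"
    using near[OF st(1-4)] unfolding d_def by (intro d1) auto
  moreover have "dist (?B (x + s' *\<^sub>R v + t' *\<^sub>R w)) (?B x) < ?e"
    using near[OF st'(1-4)] unfolding d_def by (intro d2) auto
  moreover have "False" if "p = q" "dist p a < \<bar>a - b\<bar> / 2" "dist q b < \<bar>a - b\<bar> / 2" for p q a b :: real
    using that unfolding dist_real_def by argo
  ultimately show False by blast
qed

text \<open>Product rule for the pairing of the derivative of \<open>G\<close> with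
  \<open>\<eta>\<close>: one term keeps the direction frozen at \<open>\<eta> x\<close>, the other
  differentiates the direction.\<close>

lemma frechet_derivative_along:
  fixes G :: "'a::euclidean_space \<Rightarrow> real"
  assumes V: "open V" and G: "smooth_on V G" and \<eta>: "smooth_on V \<eta>" and x: "x \<in> V"
  shows "frechet_derivative (\<lambda>y. frechet_derivative G (at y) (\<eta> y)) (at x) u =
    frechet_derivative (\<lambda>y. frechet_derivative G (at y) (\<eta> x)) (at x) u +
    frechet_derivative G (at x) (frechet_derivative \<eta> (at x) u)"
proof -
  let ?D = "\<lambda>b y. frechet_derivative G (at y) b"
  have D: "(?D b has_derivative frechet_derivative (?D b) (at x)) (at x)" for b
    by (rule smooth_on_imp_has_derivative[OF smooth_on_derivative[OF G] V x])
  have E: "(\<eta> has_derivative frechet_derivative \<eta> (at x)) (at x)"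
    by (rule smooth_on_imp_has_derivative[OF \<eta> V x])
  have expand: "frechet_derivative G (at y) w = (\<Sum>b\<in>Basis. (w \<bullet> b) * ?D b y)" if "y \<in> V" for y w
    using frechet_derivative_Basis[OF smooth_on_imp_differentiable[OF G V that], of w]
    by (simp only: real_scaleR_def)
  have d1: "((\<lambda>y. \<Sum>b\<in>Basis. (\<eta> y \<bullet> b) * ?D b y) has_derivative
      (\<lambda>u. \<Sum>b\<in>Basis. (\<eta> x \<bullet> b) * frechet_derivative (?D b) (at x) u +
        (frechet_derivative \<eta> (at x) u \<bullet> b) * ?D b x)) (at x)"
  proof (rule has_derivative_sum)
    fix b :: 'a
    show "((\<lambda>y. (\<eta> y \<bullet> b) * ?D b y) has_derivative
        (\<lambda>u. (\<eta> x \<bullet> b) * frechet_derivative (?D b) (at x) u +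
          (frechet_derivative \<eta> (at x) u \<bullet> b) * ?D b x)) (at x)"
      by (rule has_derivative_mult[OF bounded_linear.has_derivative[OF bounded_linear_inner_left E] D])
  qed
  have d2: "((\<lambda>y. \<Sum>b\<in>Basis. (\<eta> x \<bullet> b) * ?D b y) has_derivative
      (\<lambda>u. \<Sum>b\<in>Basis. (\<eta> x \<bullet> b) * frechet_derivative (?D b) (at x) u)) (at x)"
  proof (rule has_derivative_sum)
    fix b :: 'a
    show "((\<lambda>y. (\<eta> x \<bullet> b) * ?D b y) has_derivative
        (\<lambda>u. (\<eta> x \<bullet> b) * frechet_derivative (?D b) (at x) u)) (at x)"
      by (rule has_derivative_mult_right[OF D])
  qed
  have "frechet_derivative (\<lambda>y. ?D (\<eta> y) y) (at x) =
      frechet_derivative (\<lambda>y. \<Sum>b\<in>Basis. (\<eta> y \<bullet> b) * ?D b y) (at x)"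
    using expand by (intro frechet_derivative_cong_open[OF V x])
  moreover have "frechet_derivative (\<lambda>y. ?D (\<eta> x) y) (at x) =
      frechet_derivative (\<lambda>y. \<Sum>b\<in>Basis. (\<eta> x \<bullet> b) * ?D b y) (at x)"
    using expand by (intro frechet_derivative_cong_open[OF V x])
  ultimately show ?thesis
    unfolding frechet_derivative_at[OF d1, symmetric] frechet_derivative_at[OF d2, symmetric]
      expand[OF x, of "frechet_derivative \<eta> (at x) u"]
    by (simp add: sum.distrib)
qed

section \<open>Calculus on a smooth atlas\<close>

abbreviation rep :: "('a, 'v) chart \<Rightarrow> ('a \<Rightarrow> 'b) \<Rightarrow> 'v \<Rightarrow> 'b" where
  "rep C f \<equiv> f \<circ> inv_into (fst C) (snd C)"

locale atlas =
  fixes A :: "('a, 'v::euclidean_space) chart set"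
  assumes smooth_atlas: "smooth_atlas A"
begin

lemma chart_inj: "C \<in> A \<Longrightarrow> inj_on (snd C) (fst C)"
  using smooth_atlas unfolding smooth_atlas_def by fastforce

lemma transition_open: "C \<in> A \<Longrightarrow> C' \<in> A \<Longrightarrow> open (snd C ` (fst C \<inter> fst C'))"
  using smooth_atlas unfolding smooth_atlas_def by fastforce

lemma transition_smooth: "C \<in> A \<Longrightarrow> C' \<in> A \<Longrightarrow> smooth_on (snd C ` (fst C \<inter> fst C')) (rep C (snd C'))"
  using smooth_atlas unfolding smooth_atlas_def by fastforce

lemma chart_inv: "C \<in> A \<Longrightarrow> e \<in> fst C \<Longrightarrow> inv_into (fst C) (snd C) (snd C e) = e"
  using chart_inj by (simp add: inv_into_f_f)

lemma rep_apply: "C \<in> A \<Longrightarrow> e \<in> fst C \<Longrightarrow> rep C f (snd C e) = f e"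
  using chart_inj by (simp add: inv_into_f_f)

lemma image_Int: "C \<in> A \<Longrightarrow> snd C ` (fst C \<inter> (S \<inter> T)) = snd C ` (fst C \<inter> S) \<inter> snd C ` (fst C \<inter> T)"
  using inj_on_image_Int[OF chart_inj, of C "fst C \<inter> S" "fst C \<inter> T"] by (simp add: Int_ac)

abbreviation "open_in \<equiv> openin (atlas_topology A)"

text \<open>\<open>topology\<close> returns the intended open sets only for predicates satisfying
  \<open>istopology\<close>. Stability under intersection rests on the injectivity of charts, which
  makes images commute with intersections.\<close>

lemma openin_iff:
  "open_in W \<longleftrightarrow>
    W \<subseteq> atlas_carrier A \<and> (\<forall>C\<in>A. open (snd C ` (fst C \<inter> W)))"
proof -
  let ?P = "\<lambda>W. W \<subseteq> atlas_carrier A \<and> (\<forall>(U, \<phi>) \<in> A. open (\<phi> ` (U \<inter> W)))"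
  have "istopology ?P"
    unfolding istopology_def
  proof (intro conjI allI impI)
    fix S T assume ST: "?P S" "?P T"
    then show "S \<inter> T \<subseteq> atlas_carrier A" by blast
    show "\<forall>(U, \<phi>)\<in>A. open (\<phi> ` (U \<inter> (S \<inter> T)))"
      using ST image_Int by (fastforce intro: open_Int)
  next
    fix K assume K: "\<forall>S\<in>K. ?P S"
    then show "\<Union>K \<subseteq> atlas_carrier A" by blast
    show "\<forall>(U, \<phi>)\<in>A. open (\<phi> ` (U \<inter> \<Union>K))"
    proof clarify
      fix U \<phi> assume "(U, \<phi>) \<in> A"
      then have "open (\<Union>S\<in>K. \<phi> ` (U \<inter> S))" using K by (intro open_UN) auto
      moreover have "\<phi> ` (U \<inter> \<Union>K) = (\<Union>S\<in>K. \<phi> ` (U \<inter> S))" by blast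
      ultimately show "open (\<phi> ` (U \<inter> \<Union>K))" by simp
    qed
  qed
  then show ?thesis unfolding atlas_topology_def by (simp add: topology_inverse' split_beta)
qed

lemma openin_image: "open_in W \<Longrightarrow> C \<in> A \<Longrightarrow> open (snd C ` (fst C \<inter> W))"
  by (simp add: openin_iff)

lemma openin_image_sub: "open_in W \<Longrightarrow> C \<in> A \<Longrightarrow> W \<subseteq> fst C \<Longrightarrow> open (snd C ` W)"
  using openin_image[of W C] by (simp add: Int_absorb1)

lemma openin_chart: "C \<in> A \<Longrightarrow> open_in (fst C)"
  unfolding openin_iff using transition_open by (auto simp: atlas_carrier_def)

lemma smooth_fun_iff:
  "smooth_fun A W f \<longleftrightarrow> (\<forall>C\<in>A. smooth_on (snd C ` (fst C \<inter> W)) (rep C f))"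
  unfolding smooth_fun_def by (simp add: split_beta)

lemma smooth_fun_subset: "smooth_fun A W f \<Longrightarrow> W' \<subseteq> W \<Longrightarrow> smooth_fun A W' f"
  unfolding smooth_fun_iff by (meson smooth_on_subset image_mono Int_mono order_refl)

lemma smooth_fun_cong:
  assumes "open_in W" "\<And>e. e \<in> W \<Longrightarrow> f e = g e"
  shows "smooth_fun A W f \<longleftrightarrow> smooth_fun A W g"
proof -
  have "smooth_on (snd C ` (fst C \<inter> W)) (rep C f) \<longleftrightarrow> smooth_on (snd C ` (fst C \<inter> W)) (rep C g)"
    if C: "C \<in> A" for C
  proof (rule smooth_on_cong[OF openin_image[OF assms(1) C]])
    fix y assume "y \<in> snd C ` (fst C \<inter> W)"
    then obtain e where "e \<in> fst C" "e \<in> W" "y = snd C e" by blast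
    then show "rep C f y = rep C g y" using chart_inv[OF C, of e] assms(2) by simp
  qed
  then show ?thesis unfolding smooth_fun_iff by blast
qed

lemma smooth_fun_const: "smooth_fun A W (\<lambda>_. c)"
  unfolding smooth_fun_iff by (simp add: comp_def smooth_on_const)

lemma smooth_fun_add:
  "open_in W \<Longrightarrow> smooth_fun A W f \<Longrightarrow> smooth_fun A W g \<Longrightarrow>
    smooth_fun A W (\<lambda>e. f e + g e)"
  unfolding smooth_fun_iff comp_def by (simp add: smooth_on_add openin_image)

lemma smooth_fun_mult:
  "open_in W \<Longrightarrow> smooth_fun A W f \<Longrightarrow> smooth_fun A W g \<Longrightarrow>
    smooth_fun A W (\<lambda>e. f e * g e)"
  unfolding smooth_fun_iff comp_def by (simp add: smooth_on_mult openin_image)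

lemma smooth_fun_cmult:
  "open_in W \<Longrightarrow> smooth_fun A W f \<Longrightarrow> smooth_fun A W (\<lambda>e. r * f e)"
  using smooth_fun_mult[OF _ smooth_fun_const] by blast

lemma smooth_fun_diff:
  "open_in W \<Longrightarrow> smooth_fun A W f \<Longrightarrow> smooth_fun A W g \<Longrightarrow>
    smooth_fun A W (\<lambda>e. f e - g e)"
  unfolding smooth_fun_iff comp_def by (simp add: smooth_on_diff openin_image)

lemma smooth_fun_sum:
  assumes "open_in W" "\<And>i. i \<in> I \<Longrightarrow> smooth_fun A W (f i)"
  shows "smooth_fun A W (\<lambda>e. \<Sum>i\<in>I. f i e)"
  using assms(2)
  by (induction I rule: infinite_finite_induct) (auto intro: smooth_fun_add[OF assms(1)] smooth_fun_const)

text \<open>One chart suffices: the representation in any other chart is the given one composed with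
  a smooth transition map.\<close>

lemma smooth_fun_chartI:
  assumes C: "C \<in> A" and W: "open_in W" "W \<subseteq> fst C"
    and f: "smooth_on (snd C ` W) (rep C f)"
  shows "smooth_fun A W f"
  unfolding smooth_fun_iff
proof
  fix C' assume C': "C' \<in> A"
  have op: "open (snd C' ` (fst C' \<inter> W))" by (rule openin_image[OF W(1) C'])
  have sub: "rep C' (snd C) ` (snd C' ` (fst C' \<inter> W)) \<subseteq> snd C ` W"
    using chart_inv[OF C'] by fastforce
  have "smooth_on (snd C' ` (fst C' \<inter> W)) (\<lambda>y. rep C f (rep C' (snd C) y))"
    using smooth_on_subset[OF transition_smooth[OF C' C], of "snd C' ` (fst C' \<inter> W)"] W(2)
    by (intro smooth_on_compose[OF op openin_image_sub[OF W(1) C W(2)] sub f]) auto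
  moreover have "rep C' f y = rep C f (rep C' (snd C) y)" if y: "y \<in> snd C' ` (fst C' \<inter> W)" for y
  proof -
    obtain e where "e \<in> fst C'" "e \<in> W" "y = snd C' e" using y by blast
    then show ?thesis using chart_inv[OF C', of e] chart_inv[OF C, of e] W(2) by auto
  qed
  ultimately show "smooth_on (snd C' ` (fst C' \<inter> W)) (rep C' f)"
    using smooth_on_cong[OF op, of "rep C' f" "\<lambda>y. rep C f (rep C' (snd C) y)"] by blast
qed

lemma smooth_fun_chartD:
  assumes "C \<in> A" "W \<subseteq> fst C" "smooth_fun A W f"
  shows "smooth_on (snd C ` W) (rep C f)"
  using assms unfolding smooth_fun_iff by (metis Int_absorb1)

lemma smooth_atI:
  "open_in W \<Longrightarrow> smooth_fun A W f \<Longrightarrow> e \<in> W \<Longrightarrow> smooth_at A e f"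
  unfolding smooth_at_def by blast

lemma smooth_at2E:
  assumes "smooth_at A e f" "smooth_at A e g"
  obtains W where "open_in W" "e \<in> W" "smooth_fun A W f" "smooth_fun A W g"
proof -
  obtain W1 W2 where *: "open_in W1" "e \<in> W1" "smooth_fun A W1 f"
    "open_in W2" "e \<in> W2" "smooth_fun A W2 g"
    using assms unfolding smooth_at_def by blast
  show ?thesis
    by (rule that[of "W1 \<inter> W2"]) (use * smooth_fun_subset in auto)
qed

lemma smooth_at_add: "smooth_at A e f \<Longrightarrow> smooth_at A e g \<Longrightarrow> smooth_at A e (\<lambda>x. f x + g x)"
  by (erule (1) smooth_at2E) (blast intro: smooth_atI smooth_fun_add)

lemma smooth_at_mult: "smooth_at A e f \<Longrightarrow> smooth_at A e g \<Longrightarrow> smooth_at A e (\<lambda>x. f x * g x)"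
  by (erule (1) smooth_at2E) (blast intro: smooth_atI smooth_fun_mult)

lemma smooth_at_cmult: "smooth_at A e f \<Longrightarrow> smooth_at A e (\<lambda>x. r * f x)"
  unfolding smooth_at_def using smooth_fun_cmult by blast

lemma smooth_at_carrier: "smooth_at A e f \<Longrightarrow> e \<in> atlas_carrier A"
  unfolding smooth_at_def using openin_iff by blast

lemma smooth_at_const: "e \<in> atlas_carrier A \<Longrightarrow> smooth_at A e (\<lambda>_. c)"
  unfolding atlas_carrier_def using smooth_atI[OF openin_chart smooth_fun_const] by blast

lemma smooth_at_cong:
  assumes W: "open_in W" "e \<in> W" "\<And>e'. e' \<in> W \<Longrightarrow> f e' = g e'"
  shows "smooth_at A e f \<longleftrightarrow> smooth_at A e g"
proof -
  have "smooth_at A e g" if "smooth_at A e f" "\<And>e'. e' \<in> W \<Longrightarrow> f e' = g e'" for f g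
  proof -
    obtain W1 where W1: "open_in W1" "e \<in> W1" "smooth_fun A W1 f"
      using \<open>smooth_at A e f\<close> unfolding smooth_at_def by blast
    have o: "open_in (W \<inter> W1)" using W W1 by blast
    have "smooth_fun A (W \<inter> W1) f" using W1(3) smooth_fun_subset by blast
    then have "smooth_fun A (W \<inter> W1) g" using smooth_fun_cong[OF o, of f g] that(2) by blast
    then show ?thesis using smooth_atI[OF o] W W1 by blast
  qed
  then show ?thesis using W(3) by metis
qed

section \<open>Tangent vectors, vector fields and Lie brackets\<close>

lemma tangent_add:
  "v \<in> tangent_space A e \<Longrightarrow> smooth_at A e f \<Longrightarrow> smooth_at A e g \<Longrightarrow> v (\<lambda>x. f x + g x) = v f + v g"
  unfolding tangent_space_def by blast

lemma tangent_mult: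
  "v \<in> tangent_space A e \<Longrightarrow> smooth_at A e f \<Longrightarrow> smooth_at A e g \<Longrightarrow>
    v (\<lambda>x. f x * g x) = f e * v g + g e * v f"
  unfolding tangent_space_def by blast

lemma tangent_cmult:
  "v \<in> tangent_space A e \<Longrightarrow> smooth_at A e f \<Longrightarrow> v (\<lambda>x. r * f x) = r * v f"
  unfolding tangent_space_def by blast

lemma tangent_not_smooth: "v \<in> tangent_space A e \<Longrightarrow> \<not> smooth_at A e f \<Longrightarrow> v f = 0"
  unfolding tangent_space_def by blast

text \<open>Derivations are local even without bump functions: if \<open>h\<close> vanishes on the open set \<open>W\<close> and
  \<open>u\<close> is the indicator function of its complement, then \<open>u\<close> is smooth near \<open>e\<close> and \<open>h = h u\<close>.\<close>

lemma tangent_cong: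
  assumes v: "v \<in> tangent_space A e"
    and W: "open_in W" "e \<in> W" "\<And>e'. e' \<in> W \<Longrightarrow> f e' = g e'"
  shows "v f = v g"
proof (cases "smooth_at A e f")
  case False
  then show ?thesis using v smooth_at_cong[of W e f g] W unfolding tangent_space_def by auto
next
  case True
  then have g: "smooth_at A e g" using smooth_at_cong[of W e f g] W by blast
  define h where "h = (\<lambda>x. f x + (-1) * g x)"
  define u where "u = (\<lambda>x. if x \<in> W then 0 else 1 :: real)"
  have ng: "smooth_at A e (\<lambda>x. (-1) * g x)" using smooth_at_cmult[OF g] .
  have h: "smooth_at A e h" unfolding h_def by (rule smooth_at_add[OF True ng])
  have u: "smooth_at A e u"
    using smooth_at_cong[of W e u "\<lambda>_. 0"] smooth_at_const[of e 0] smooth_at_carrier[OF True] W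
    unfolding u_def by auto
  have "(\<lambda>x. h x * u x) = h" using W(3) unfolding h_def u_def by auto
  moreover have "v (\<lambda>x. h x * u x) = h e * v u + u e * v h" by (rule tangent_mult[OF v h u])
  moreover have "h e = 0" "u e = 0" using W unfolding h_def u_def by auto
  moreover have "v h = v f + v (\<lambda>x. (-1) * g x)" unfolding h_def by (rule tangent_add[OF v True ng])
  moreover have "v (\<lambda>x. (-1) * g x) = (-1) * v g" by (rule tangent_cmult[OF v g])
  ultimately show ?thesis by simp
qed

text \<open>The Leibniz rule for the product 1 times 1 shows that \<open>v\<close> annihilates 1. A
  constant fails to be smooth only at points outside the carrier, and there the value 0 is
  prescribed.\<close>

lemma tangent_const:
  assumes "v \<in> tangent_space A e"
  shows "v (\<lambda>_. c) = 0"
proof (cases "smooth_at A e (\<lambda>_. c)")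
  case True
  then have 1: "smooth_at A e (\<lambda>_. 1)" using smooth_at_carrier smooth_at_const by blast
  have "v (\<lambda>_. 1 * 1) = 1 * v (\<lambda>_. 1) + 1 * v (\<lambda>_. 1)"
    using tangent_mult[OF assms 1 1] .
  then show ?thesis using tangent_cmult[OF assms 1, of c] by simp
qed (use tangent_not_smooth[OF assms] in blast)

lemma vf_tangent: "X \<in> vector_fields A W \<Longrightarrow> e \<in> W \<Longrightarrow> X e \<in> tangent_space A e"
  unfolding vector_fields_def by blast

lemma vf_smooth:
  "X \<in> vector_fields A W \<Longrightarrow> open_in W' \<Longrightarrow> W' \<subseteq> W \<Longrightarrow> smooth_fun A W' f \<Longrightarrow>
    smooth_fun A W' (\<lambda>e. X e f)"
  unfolding vector_fields_def by blast

lemma vf_subset: "X \<in> vector_fields A W \<Longrightarrow> W' \<subseteq> W \<Longrightarrow> X \<in> vector_fields A W'"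
  unfolding vector_fields_def by blast

lemma vf_cong:
  assumes X: "X \<in> vector_fields A W" and eq: "\<And>e. e \<in> W \<Longrightarrow> X' e = X e"
  shows "X' \<in> vector_fields A W"
  unfolding vector_fields_def
proof (intro CollectI conjI ballI allI impI)
  fix e assume "e \<in> W"
  then show "X' e \<in> tangent_space A e" using eq vf_tangent[OF X] by simp
next
  fix W' f assume W': "open_in W' \<and> W' \<subseteq> W \<and> smooth_fun A W' f"
  then have "smooth_fun A W' (\<lambda>e. X e f)" using vf_smooth[OF X] by blast
  moreover have "X e f = X' e f" if "e \<in> W'" for e using eq W' that by (metis subsetD)
  ultimately show "smooth_fun A W' (\<lambda>e. X' e f)"
    using smooth_fun_cong[of W' "\<lambda>e. X e f" "\<lambda>e. X' e f"] W' by blast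
qed

lemma vf_smooth_at:
  assumes X: "X \<in> vector_fields A W" and W: "open_in W" "e \<in> W" and f: "smooth_at A e f"
  shows "smooth_at A e (\<lambda>e'. X e' f)"
proof -
  obtain W' where W': "open_in W'" "e \<in> W'" "smooth_fun A W' f"
    using f unfolding smooth_at_def by blast
  have o: "open_in (W \<inter> W')" using W W' by blast
  show ?thesis
    by (rule smooth_atI[OF o vf_smooth[OF X o]]) (use W W' smooth_fun_subset in auto)
qed

lemma tangent_space_lincomb:
  assumes "v \<in> tangent_space A e" "w \<in> tangent_space A e"
  shows "(\<lambda>g. a * v g + b * w g) \<in> tangent_space A e"
  using assms unfolding tangent_space_def by (auto simp: algebra_simps)

lemma vf_add_mem:
  assumes "open_in W" "X \<in> vector_fields A W" "Y \<in> vector_fields A W"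
  shows "vf_add X Y \<in> vector_fields A W"
  unfolding vector_fields_def vf_add_def
proof (intro CollectI conjI ballI allI impI)
  fix e assume "e \<in> W"
  then show "(\<lambda>g. X e g + Y e g) \<in> tangent_space A e"
    using tangent_space_lincomb[of "X e" e "Y e" 1 1] vf_tangent assms by simp
next
  fix W' f assume "open_in W' \<and> W' \<subseteq> W \<and> smooth_fun A W' f"
  then show "smooth_fun A W' (\<lambda>e. X e f + Y e f)"
    by (metis smooth_fun_add vf_smooth assms(2,3))
qed

lemma vf_scale_mem:
  assumes "open_in W" "X \<in> vector_fields A W" "smooth_fun A W f"
  shows "vf_scale f X \<in> vector_fields A W"
  unfolding vector_fields_def vf_scale_def
proof (intro CollectI conjI ballI allI impI)
  fix e assume "e \<in> W"
  then show "(\<lambda>g. f e * X e g) \<in> tangent_space A e"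
    using tangent_space_lincomb[of "X e" e "X e" "f e" 0] vf_tangent assms by simp
next
  fix W' g assume "open_in W' \<and> W' \<subseteq> W \<and> smooth_fun A W' g"
  then show "smooth_fun A W' (\<lambda>e. f e * X e g)"
    by (metis smooth_fun_mult vf_smooth smooth_fun_subset assms(2,3))
qed

lemma vf_zero_mem: "(\<lambda>e g. 0) \<in> vector_fields A W"
  unfolding vector_fields_def tangent_space_def by (auto simp: smooth_fun_const)

lemma vf_sum_mem:
  assumes "open_in W" "finite I"
    and "\<And>k. k \<in> I \<Longrightarrow> X k \<in> vector_fields A W" "\<And>k. k \<in> I \<Longrightarrow> smooth_fun A W (f k)"
  shows "(\<lambda>e g. \<Sum>k\<in>I. f k e * X k e g) \<in> vector_fields A W"
  using assms(2-4)
proof (induction I)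
  case empty
  then show ?case using vf_zero_mem by simp
next
  case (insert k I)
  then have "vf_add (vf_scale (f k) (X k)) (\<lambda>e g. \<Sum>k\<in>I. f k e * X k e g) \<in> vector_fields A W"
    by (intro vf_add_mem vf_scale_mem assms(1)) auto
  then show ?case using insert(1,2) by (simp add: vf_add_def vf_scale_def)
qed

lemma smooth_atE:
  assumes "C \<in> A" "e \<in> fst C" "smooth_at A e f"
  obtains W where "open_in W" "W \<subseteq> fst C" "e \<in> W" "smooth_fun A W f"
proof -
  obtain W where W: "open_in W" "e \<in> W" "smooth_fun A W f"
    using assms unfolding smooth_at_def by blast
  show ?thesis
    by (rule that[of "fst C \<inter> W"]) (use W assms openin_chart[OF assms(1)] smooth_fun_subset[OF W(3)] in auto)
qed

lemma rep_has_derivative: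
  assumes C: "C \<in> A" "e \<in> fst C" and f: "smooth_at A e f"
  shows "(rep C f has_derivative frechet_derivative (rep C f) (at (snd C e))) (at (snd C e))"
proof -
  obtain W where W: "open_in W" "W \<subseteq> fst C" "e \<in> W" "smooth_fun A W f"
    using smooth_atE[OF C f] .
  show ?thesis
    by (rule smooth_on_imp_has_derivative[OF smooth_fun_chartD[OF C(1) W(2,4)] openin_image_sub[OF W(1) C(1) W(2)]])
      (use W in blast)
qed

lemma frechet_derivative_rep_cong:
  assumes C: "C \<in> A" and W: "open_in W" "W \<subseteq> fst C" "e \<in> W"
    and eq: "\<And>e'. e' \<in> W \<Longrightarrow> f e' = g e'"
  shows "frechet_derivative (rep C f) (at (snd C e)) = frechet_derivative (rep C g) (at (snd C e))"
proof (rule frechet_derivative_cong_open[OF openin_image_sub[OF W(1) C W(2)]])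
  show "snd C e \<in> snd C ` W" using W by blast
  fix y assume "y \<in> snd C ` W"
  then obtain e' where "e' \<in> W" "y = snd C e'" by blast
  then show "rep C f y = rep C g y" using chart_inv[OF C, of e'] eq W by auto
qed

lemma pd_cong:
  assumes "C \<in> A" "open_in W" "W \<subseteq> fst C" "e \<in> W" "\<And>e'. e' \<in> W \<Longrightarrow> f e' = g e'"
  shows "pd C w f e = pd C w g e"
  unfolding pd_def using frechet_derivative_rep_cong[OF assms] by simp

lemma coord_field_eq: "smooth_at A e f \<Longrightarrow> coord_field A C w e f = pd C w f e"
  unfolding coord_field_def by simp

lemma coord_field_tangent:
  assumes C: "C \<in> A" "e \<in> fst C"
  shows "coord_field A C w e \<in> tangent_space A e"
  unfolding tangent_space_def
proof (intro CollectI conjI allI impI)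
  fix f g assume "smooth_at A e f \<and> smooth_at A e g"
  then have f: "smooth_at A e f" and g: "smooth_at A e g" by auto
  note df = rep_has_derivative[OF C f] and dg = rep_has_derivative[OF C g]
  have "((\<lambda>y. rep C f y + rep C g y) has_derivative (\<lambda>w. frechet_derivative (rep C f) (at (snd C e)) w +
      frechet_derivative (rep C g) (at (snd C e)) w)) (at (snd C e))"
    by (rule has_derivative_add[OF df dg])
  from frechet_derivative_at[OF this, symmetric]
  show "coord_field A C w e (\<lambda>x. f x + g x) = coord_field A C w e f + coord_field A C w e g"
    using smooth_at_add[OF f g] f g by (simp add: coord_field_eq pd_def comp_def)
  have "((\<lambda>y. rep C f y * rep C g y) has_derivative
      (\<lambda>w. rep C f (snd C e) * frechet_derivative (rep C g) (at (snd C e)) w +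
      frechet_derivative (rep C f) (at (snd C e)) w * rep C g (snd C e))) (at (snd C e))"
    by (rule has_derivative_mult[OF df dg])
  from frechet_derivative_at[OF this, symmetric]
  show "coord_field A C w e (\<lambda>x. f x * g x) = f e * coord_field A C w e g + g e * coord_field A C w e f"
    using smooth_at_mult[OF f g] f g chart_inv[OF C]
    by (simp add: coord_field_eq pd_def comp_def)
next
  fix f and r :: real assume f: "smooth_at A e f"
  have "((\<lambda>y. r * rep C f y) has_derivative (\<lambda>w. r * frechet_derivative (rep C f) (at (snd C e)) w)) (at (snd C e))"
    by (rule has_derivative_mult_right[OF rep_has_derivative[OF C f]])
  from frechet_derivative_at[OF this, symmetric]
  show "coord_field A C w e (\<lambda>x. r * f x) = r * coord_field A C w e f"
    using smooth_at_cmult[OF f, of r] f by (simp add: coord_field_eq pd_def comp_def)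
next
  fix f assume "\<not> smooth_at A e f"
  then show "coord_field A C w e f = 0" by (simp add: coord_field_def)
qed

lemma coord_field_linear:
  assumes C: "C \<in> A" "e \<in> fst C"
  shows "linear (\<lambda>w. coord_field A C w e f)"
proof (cases "smooth_at A e f")
  case True
  then show ?thesis
    using has_derivative_linear[OF rep_has_derivative[OF C True]]
    by (simp add: coord_field_eq pd_def)
qed (simp add: coord_field_def linear_zero)

text \<open>The direction \<open>\<xi>\<close> may vary with the point, as it does for the adapted
  fields, whose directions involve the coefficients of the nonlinear connection.\<close>

lemma coord_vf:
  assumes C: "C \<in> A" and W: "open_in W" "W \<subseteq> fst C"
    and \<xi>: "smooth_on (snd C ` W) (rep C \<xi>)"
  shows "(\<lambda>e. coord_field A C (\<xi> e) e) \<in> vector_fields A W"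
  unfolding vector_fields_def
proof (intro CollectI conjI ballI allI impI)
  fix e assume "e \<in> W"
  then show "coord_field A C (\<xi> e) e \<in> tangent_space A e"
    using coord_field_tangent[OF C, of e] W by blast
next
  fix W' f assume "open_in W' \<and> W' \<subseteq> W \<and> smooth_fun A W' f"
  then have W': "open_in W'" "W' \<subseteq> W" "W' \<subseteq> fst C" and f: "smooth_fun A W' f"
    using W by auto
  have op: "open (snd C ` W')" by (rule openin_image_sub[OF W'(1) C W'(3)])
  have \<xi>': "smooth_on (snd C ` W') (rep C \<xi>)"
    using smooth_on_subset[OF \<xi>, of "snd C ` W'"] W' by blast
  have "smooth_on (snd C ` W') (rep C (\<lambda>e. coord_field A C (\<xi> e) e f)) \<longleftrightarrow>
    smooth_on (snd C ` W') (\<lambda>y. frechet_derivative (rep C f) (at y) (rep C \<xi> y))"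
  proof (rule smooth_on_cong[OF op])
    fix y assume "y \<in> snd C ` W'"
    then obtain e where e: "e \<in> W'" "y = snd C e" by blast
    then have "smooth_at A e f" using smooth_atI[OF W'(1) f] by blast
    then show "rep C (\<lambda>e. coord_field A C (\<xi> e) e f) y = frechet_derivative (rep C f) (at y) (rep C \<xi> y)"
      using e chart_inv[OF C, of e] W'(3) by (auto simp: coord_field_eq pd_def)
  qed
  then have "smooth_on (snd C ` W') (rep C (\<lambda>e. coord_field A C (\<xi> e) e f))"
    using smooth_on_derivative_along[OF op smooth_fun_chartD[OF C W'(3) f] \<xi>'] by blast
  then show "smooth_fun A W' (\<lambda>e. coord_field A C (\<xi> e) e f)"
    by (rule smooth_fun_chartI[OF C W'(1,3)])
qed

lemma coord_field_coord_field:
  assumes C: "C \<in> A" and W: "open_in W" "W \<subseteq> fst C" "e \<in> W"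
    and \<eta>: "smooth_on (snd C ` W) (rep C \<eta>)" and f: "smooth_at A e f"
  shows "coord_field A C w e (\<lambda>e'. coord_field A C (\<eta> e') e' f) =
    frechet_derivative (\<lambda>y. frechet_derivative (rep C f) (at y) (\<eta> e)) (at (snd C e)) w +
    coord_field A C (frechet_derivative (rep C \<eta>) (at (snd C e)) w) e f"
proof -
  have eC: "e \<in> fst C" using W by blast
  obtain W1 where W1: "open_in W1" "e \<in> W1" "smooth_fun A W1 f"
    using smooth_atE[OF C eC f] by blast
  define W' where "W' = W \<inter> W1"
  have W': "open_in W'" "W' \<subseteq> fst C" "e \<in> W'" and fW: "smooth_fun A W' f"
    using W W1 smooth_fun_subset[OF W1(3)] unfolding W'_def by auto
  have op: "open (snd C ` W')" by (rule openin_image_sub[OF W'(1) C W'(2)])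
  have \<eta>': "smooth_on (snd C ` W') (rep C \<eta>)"
    using smooth_on_subset[OF \<eta>, of "snd C ` W'"] unfolding W'_def by blast
  have sm: "smooth_at A e (\<lambda>e'. coord_field A C (\<eta> e') e' f)"
    by (rule vf_smooth_at[OF coord_vf[OF C W'(1,2) \<eta>'] W'(1,3) f])
  have eW: "snd C e \<in> snd C ` W'" using W' by blast
  have "coord_field A C w e (\<lambda>e'. coord_field A C (\<eta> e') e' f) =
      frechet_derivative (rep C (\<lambda>e'. coord_field A C (\<eta> e') e' f)) (at (snd C e)) w"
    using sm by (simp add: coord_field_eq pd_def)
  also have "frechet_derivative (rep C (\<lambda>e'. coord_field A C (\<eta> e') e' f)) (at (snd C e)) =
      frechet_derivative (\<lambda>y. frechet_derivative (rep C f) (at y) (rep C \<eta> y)) (at (snd C e))"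
  proof (rule frechet_derivative_cong_open[OF op eW])
    fix y assume "y \<in> snd C ` W'"
    then obtain e' where e': "e' \<in> W'" "y = snd C e'" by blast
    then have "smooth_at A e' f" using smooth_atI[OF W'(1) fW] by blast
    then show "rep C (\<lambda>e'. coord_field A C (\<eta> e') e' f) y = frechet_derivative (rep C f) (at y) (rep C \<eta> y)"
      using e' chart_inv[OF C, of e'] W'(2) by (auto simp: coord_field_eq pd_def)
  qed
  also have "frechet_derivative (\<lambda>y. frechet_derivative (rep C f) (at y) (rep C \<eta> y)) (at (snd C e)) w =
    frechet_derivative (\<lambda>y. frechet_derivative (rep C f) (at y) (rep C \<eta> (snd C e))) (at (snd C e)) w +
    frechet_derivative (rep C f) (at (snd C e)) (frechet_derivative (rep C \<eta>) (at (snd C e)) w)"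
    by (rule frechet_derivative_along[OF op smooth_fun_chartD[OF C W'(2) fW] \<eta>' eW])
  finally show ?thesis
    using rep_apply[OF C eC, of \<eta>] f by (simp only: coord_field_eq pd_def)
qed

text \<open>The second derivatives of \<open>g\<close> in the two iterated derivatives agree by
  \<open>symmetric_second_derivative\<close>, so only the derivatives of the coefficient maps
  survive. On a function that is not smooth at \<open>e\<close> both sides are 0.\<close>

lemma lie_bracket_coord:
  assumes C: "C \<in> A" and W: "open_in W" "W \<subseteq> fst C" "e \<in> W"
    and \<xi>: "smooth_on (snd C ` W) (rep C \<xi>)" and \<eta>: "smooth_on (snd C ` W) (rep C \<eta>)"
  shows "lie_bracket A (\<lambda>e. coord_field A C (\<xi> e) e) (\<lambda>e. coord_field A C (\<eta> e) e) e g =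
    coord_field A C (frechet_derivative (rep C \<eta>) (at (snd C e)) (\<xi> e)) e g -
    coord_field A C (frechet_derivative (rep C \<xi>) (at (snd C e)) (\<eta> e)) e g"
proof (cases "smooth_at A e g")
  case True
  have eC: "e \<in> fst C" using W by blast
  obtain W1 where W1: "open_in W1" "W1 \<subseteq> fst C" "e \<in> W1" "smooth_fun A W1 g"
    using smooth_atE[OF C eC True] .
  have sym: "frechet_derivative (\<lambda>y. frechet_derivative (rep C g) (at y) v) (at (snd C e)) w =
      frechet_derivative (\<lambda>y. frechet_derivative (rep C g) (at y) w) (at (snd C e)) v" for v w
    by (rule symmetric_second_derivative[OF openin_image_sub[OF W1(1) C W1(2)] smooth_fun_chartD[OF C W1(2,4)]])
      (use W1 in blast)
  show ?thesis
    unfolding lie_bracket_def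
    using True coord_field_coord_field[OF C W \<eta> True, of "\<xi> e"]
      coord_field_coord_field[OF C W \<xi> True, of "\<eta> e"] sym[of "\<xi> e" "\<eta> e"] by simp
qed (simp add: lie_bracket_def coord_field_def)

text \<open>Chain rule through the transition map, whose derivative carries the direction into the
  second chart. Functions that are not smooth at \<open>e\<close> are sent to 0 by both sides, so
  the two tangent vectors are equal as functionals.\<close>

lemma coord_field_change:
  assumes C: "C \<in> A" "C' \<in> A" and e: "e \<in> fst C" "e \<in> fst C'"
  shows "coord_field A C w e = coord_field A C' (frechet_derivative (rep C (snd C')) (at (snd C e)) w) e"
proof
  fix f
  show "coord_field A C w e f = coord_field A C' (frechet_derivative (rep C (snd C')) (at (snd C e)) w) e f"
  proof (cases "smooth_at A e f")
    case True
    let ?V = "snd C ` (fst C \<inter> fst C')"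
    have V: "open ?V" "snd C e \<in> ?V" using transition_open[OF C] e by auto
    have "(rep C (snd C') has_derivative frechet_derivative (rep C (snd C')) (at (snd C e))) (at (snd C e))"
      by (rule smooth_on_imp_has_derivative[OF transition_smooth[OF C] V])
    moreover have "(rep C' f has_derivative frechet_derivative (rep C' f) (at (snd C' e)))
        (at (rep C (snd C') (snd C e)))"
      using rep_has_derivative[OF C(2) e(2) True] rep_apply[OF C(1) e(1), of "snd C'"] by simp
    ultimately have "((\<lambda>y. rep C' f (rep C (snd C') y)) has_derivative (\<lambda>w.
        frechet_derivative (rep C' f) (at (snd C' e)) (frechet_derivative (rep C (snd C')) (at (snd C e)) w)))
        (at (snd C e))"
      by (rule has_derivative_compose)
    note 1 = frechet_derivative_at[OF this, symmetric]
    have "frechet_derivative (rep C f) (at (snd C e)) =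
        frechet_derivative (\<lambda>y. rep C' f (rep C (snd C') y)) (at (snd C e))"
    proof (rule frechet_derivative_cong_open[OF V])
      fix y assume "y \<in> ?V"
      then obtain e' where "e' \<in> fst C" "e' \<in> fst C'" "y = snd C e'" by blast
      then show "rep C f y = rep C' f (rep C (snd C') y)"
        using chart_inv[OF C(1), of e'] chart_inv[OF C(2), of e'] by simp
    qed
    then show ?thesis using True 1 by (simp add: coord_field_eq pd_def)
  qed (simp add: coord_field_def)
qed

text \<open>The cross terms, a derivative of \<open>f\<close> along one field times a derivative of
  \<open>g\<close> along the other, cancel in the commutator. The rules for sums and products under
  the inner field hold only near \<open>e\<close>, hence the appeals to
  \<open>tangent_cong\<close>.\<close>

lemma lie_bracket_tangent:
  assumes W: "open_in W" "e \<in> W"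
    and X: "X \<in> vector_fields A W" and Y: "Y \<in> vector_fields A W"
  shows "lie_bracket A X Y e \<in> tangent_space A e"
  unfolding tangent_space_def
proof (intro CollectI conjI allI impI)
  note Xe = vf_tangent[OF X W(2)] and Ye = vf_tangent[OF Y W(2)]
  fix f g assume "smooth_at A e f \<and> smooth_at A e g"
  then have f: "smooth_at A e f" and g: "smooth_at A e g" by auto
  obtain W' where W': "open_in W'" "e \<in> W'" "smooth_fun A W' f" "smooth_fun A W' g"
    using smooth_at2E[OF f g] .
  define V where "V = W \<inter> W'"
  have V: "open_in V" "e \<in> V" using W W' unfolding V_def by auto
  have sm: "smooth_at A x f" "smooth_at A x g" if "x \<in> V" for x
    using that W' smooth_atI unfolding V_def by blast+
  have VX: "X x \<in> tangent_space A x" "Y x \<in> tangent_space A x" if "x \<in> V" for x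
    using that vf_tangent X Y unfolding V_def by blast+
  note Xf = vf_smooth_at[OF X W f] and Xg = vf_smooth_at[OF X W g]
    and Yf = vf_smooth_at[OF Y W f] and Yg = vf_smooth_at[OF Y W g]
  have aX: "Y e (\<lambda>x. X x (\<lambda>x. f x + g x)) = Y e (\<lambda>x. X x f + X x g)"
    by (rule tangent_cong[OF Ye V tangent_add[OF VX(1) sm]])
  have aY: "X e (\<lambda>x. Y x (\<lambda>x. f x + g x)) = X e (\<lambda>x. Y x f + Y x g)"
    by (rule tangent_cong[OF Xe V tangent_add[OF VX(2) sm]])
  show "lie_bracket A X Y e (\<lambda>x. f x + g x) = lie_bracket A X Y e f + lie_bracket A X Y e g"
    unfolding lie_bracket_def
    using f g smooth_at_add[OF f g] aX aY tangent_add[OF Ye Xf Xg] tangent_add[OF Xe Yf Yg] by simp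
  have mX: "Y e (\<lambda>x. X x (\<lambda>x. f x * g x)) = Y e (\<lambda>x. f x * X x g + g x * X x f)"
    by (rule tangent_cong[OF Ye V tangent_mult[OF VX(1) sm]])
  have mY: "X e (\<lambda>x. Y x (\<lambda>x. f x * g x)) = X e (\<lambda>x. f x * Y x g + g x * Y x f)"
    by (rule tangent_cong[OF Xe V tangent_mult[OF VX(2) sm]])
  show "lie_bracket A X Y e (\<lambda>x. f x * g x) = f e * lie_bracket A X Y e g + g e * lie_bracket A X Y e f"
    unfolding lie_bracket_def
    using f g smooth_at_mult[OF f g] mX mY
      tangent_add[OF Ye smooth_at_mult[OF f Xg] smooth_at_mult[OF g Xf]]
      tangent_add[OF Xe smooth_at_mult[OF f Yg] smooth_at_mult[OF g Yf]]
      tangent_mult[OF Ye f Xg] tangent_mult[OF Ye g Xf] tangent_mult[OF Xe f Yg] tangent_mult[OF Xe g Yf]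
    by (simp add: algebra_simps)
next
  note Xe = vf_tangent[OF X W(2)] and Ye = vf_tangent[OF Y W(2)]
  fix f and r :: real assume f: "smooth_at A e f"
  obtain W' where W': "open_in W'" "e \<in> W'" "smooth_fun A W' f"
    using f unfolding smooth_at_def by blast
  define V where "V = W \<inter> W'"
  have V: "open_in V" "e \<in> V" using W W' unfolding V_def by auto
  have sm: "smooth_at A x f" if "x \<in> V" for x
    using that W' smooth_atI unfolding V_def by blast
  have VX: "X x \<in> tangent_space A x" "Y x \<in> tangent_space A x" if "x \<in> V" for x
    using that vf_tangent X Y unfolding V_def by blast+
  have "Y e (\<lambda>x. X x (\<lambda>x. r * f x)) = Y e (\<lambda>x. r * X x f)"
    by (rule tangent_cong[OF Ye V tangent_cmult[OF VX(1) sm]])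
  moreover have "X e (\<lambda>x. Y x (\<lambda>x. r * f x)) = X e (\<lambda>x. r * Y x f)"
    by (rule tangent_cong[OF Xe V tangent_cmult[OF VX(2) sm]])
  ultimately show "lie_bracket A X Y e (\<lambda>x. r * f x) = r * lie_bracket A X Y e f"
    unfolding lie_bracket_def
    using f smooth_at_cmult[OF f, of r] tangent_cmult[OF Ye vf_smooth_at[OF X W f], of r]
      tangent_cmult[OF Xe vf_smooth_at[OF Y W f], of r]
    by (simp add: algebra_simps)
next
  fix f assume "\<not> smooth_at A e f"
  then show "lie_bracket A X Y e f = 0" by (simp add: lie_bracket_def)
qed

lemma lie_bracket_vf:
  assumes W: "open_in W" and X: "X \<in> vector_fields A W" and Y: "Y \<in> vector_fields A W"
  shows "lie_bracket A X Y \<in> vector_fields A W"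
  unfolding vector_fields_def
proof (intro CollectI conjI ballI allI impI)
  fix e assume "e \<in> W"
  then show "lie_bracket A X Y e \<in> tangent_space A e" by (rule lie_bracket_tangent[OF W _ X Y])
next
  fix W' f assume "open_in W' \<and> W' \<subseteq> W \<and> smooth_fun A W' f"
  then have W': "open_in W'" "W' \<subseteq> W" and f: "smooth_fun A W' f" by auto
  have "smooth_fun A W' (\<lambda>e. X e (\<lambda>e'. Y e' f) - Y e (\<lambda>e'. X e' f))"
    by (rule smooth_fun_diff[OF W'(1) vf_smooth[OF X W' vf_smooth[OF Y W' f]] vf_smooth[OF Y W' vf_smooth[OF X W' f]]])
  moreover have "lie_bracket A X Y e f = X e (\<lambda>e'. Y e' f) - Y e (\<lambda>e'. X e' f)" if "e \<in> W'" for e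
    using smooth_atI[OF W'(1) f that] by (simp add: lie_bracket_def)
  ultimately show "smooth_fun A W' (\<lambda>e. lie_bracket A X Y e f)"
    using smooth_fun_cong[OF W'(1), of "\<lambda>e. lie_bracket A X Y e f" "\<lambda>e. X e (\<lambda>e'. Y e' f) - Y e (\<lambda>e'. X e' f)"]
    by blast
qed

lemma lie_bracket_cong:
  assumes W: "open_in W" "e \<in> W"
    and X: "X \<in> vector_fields A W" and Y: "Y \<in> vector_fields A W"
    and eq: "\<And>e. e \<in> W \<Longrightarrow> X' e = X e" "\<And>e. e \<in> W \<Longrightarrow> Y' e = Y e"
  shows "lie_bracket A X' Y' e = lie_bracket A X Y e"
proof
  fix f
  have "X e (\<lambda>e'. Y' e' f) = X e (\<lambda>e'. Y e' f)"
    by (rule tangent_cong[OF vf_tangent[OF X W(2)] W]) (simp add: eq)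
  moreover have "Y e (\<lambda>e'. X' e' f) = Y e (\<lambda>e'. X e' f)"
    by (rule tangent_cong[OF vf_tangent[OF Y W(2)] W]) (simp add: eq)
  ultimately show "lie_bracket A X' Y' e f = lie_bracket A X Y e f"
    using eq W(2) by (simp add: lie_bracket_def)
qed

lemma lie_bracket_add_left:
  assumes W: "open_in W" "e \<in> W"
    and "X \<in> vector_fields A W" "X' \<in> vector_fields A W" "Y \<in> vector_fields A W"
  shows "lie_bracket A (vf_add X X') Y e g = lie_bracket A X Y e g + lie_bracket A X' Y e g"
proof (cases "smooth_at A e g")
  case True
  show ?thesis
    unfolding lie_bracket_def vf_add_def
    using tangent_add[OF vf_tangent[OF assms(5) W(2)] vf_smooth_at[OF assms(3) W True] vf_smooth_at[OF assms(4) W True]]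
    by simp
qed (simp add: lie_bracket_def)

text \<open>The term \<open>Y e f * X e g\<close> is the Leibniz defect that, in the torsion,
  cancels the one of \<open>D Y (vf_scale f X)\<close>.\<close>

lemma lie_bracket_scale_left:
  assumes W: "open_in W" "e \<in> W"
    and "X \<in> vector_fields A W" "Y \<in> vector_fields A W" "smooth_fun A W f"
  shows "lie_bracket A (vf_scale f X) Y e g = f e * lie_bracket A X Y e g - Y e f * X e g"
proof (cases "smooth_at A e g")
  case True
  show ?thesis
    unfolding lie_bracket_def vf_scale_def
    using True tangent_mult[OF vf_tangent[OF assms(4) W(2)] smooth_atI[OF W(1) assms(5) W(2)] vf_smooth_at[OF assms(3) W True]]
    by (simp add: algebra_simps)
next
  case False
  then show ?thesis using tangent_not_smooth[OF vf_tangent[OF assms(3) W(2)]] by (simp add: lie_bracket_def)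
qed

section \<open>The torsion as a tensor field\<close>

lemma torsion_skew: "torsion A D Y X e g = - torsion A D X Y e g"
  by (simp add: torsion_def lie_bracket_def)

lemma local_operatorD:
  assumes "local_operator A S" "open_in W" "X \<in> vector_fields A W" "Y \<in> vector_fields A W"
  shows "S X Y \<in> vector_fields A W"
    and "(\<And>e. e \<in> W \<Longrightarrow> X' e = X e) \<Longrightarrow> (\<And>e. e \<in> W \<Longrightarrow> Y' e = Y e) \<Longrightarrow> e \<in> W \<Longrightarrow> S X' Y' e = S X Y e"
proof -
  have *: "S X Y \<in> vector_fields A W \<and>
      (\<forall>X' Y'. (\<forall>e\<in>W. X' e = X e \<and> Y' e = Y e) \<longrightarrow> (\<forall>e\<in>W. S X' Y' e = S X Y e))"
    by (rule assms(1)[unfolded local_operator_def, THEN spec, THEN mp, OF assms(2),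
          THEN bspec, OF assms(3), THEN bspec, OF assms(4)])
  then show "S X Y \<in> vector_fields A W" ..
  show "S X' Y' e = S X Y e" if "\<And>e. e \<in> W \<Longrightarrow> X' e = X e" "\<And>e. e \<in> W \<Longrightarrow> Y' e = Y e" "e \<in> W"
    by (rule *[THEN conjunct2, THEN spec, THEN spec, THEN mp, THEN bspec]) (use that in simp_all)
qed

lemma linear_connectionD:
  assumes D: "linear_connection A D" and W: "open_in W" "e \<in> W" and f: "smooth_fun A W f"
    and "X \<in> vector_fields A W" "X' \<in> vector_fields A W" "Y \<in> vector_fields A W" "Y' \<in> vector_fields A W"
  shows "D (vf_add X X') Y e = vf_add (D X Y) (D X' Y) e"
    and "D (vf_scale f X) Y e = vf_scale f (D X Y) e"
    and "D X (vf_add Y Y') e = vf_add (D X Y) (D X Y') e"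
    and "D X (vf_scale f Y) e = vf_add (vf_scale (\<lambda>e'. X e' f) Y) (vf_scale f (D X Y)) e"
  using D[unfolded linear_connection_def, THEN conjunct2, rule_format, of W f X X' Y Y' e] assms
  by simp_all

lemma tensor_fieldD:
  assumes S: "tensor_field A S" and W: "open_in W" "e \<in> W" and f: "smooth_fun A W f"
    and "X \<in> vector_fields A W" "X' \<in> vector_fields A W" "Y \<in> vector_fields A W"
  shows "S (vf_add X X') Y e = vf_add (S X Y) (S X' Y) e"
    and "S (vf_scale f X) Y e = vf_scale f (S X Y) e"
  using S[unfolded tensor_field_def, THEN conjunct2, rule_format, of W f X X' Y Y e] assms
  by simp_all

lemma torsion_local:
  assumes D: "local_operator A D"
  shows "local_operator A (torsion A D)"
  unfolding local_operator_def
proof (intro allI impI ballI conjI)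
  fix W X Y assume W: "open_in W" and X: "X \<in> vector_fields A W" and Y: "Y \<in> vector_fields A W"
  note m1 = local_operatorD(1)[OF D W X Y] and m2 = local_operatorD(1)[OF D W Y X]
    and m3 = lie_bracket_vf[OF W X Y]
  have "vf_add (D X Y) (vf_scale (\<lambda>_. - 1) (vf_add (D Y X) (lie_bracket A X Y))) \<in> vector_fields A W"
    by (rule vf_add_mem[OF W m1 vf_scale_mem[OF W vf_add_mem[OF W m2 m3] smooth_fun_const]])
  moreover have "vf_add (D X Y) (vf_scale (\<lambda>_. - 1) (vf_add (D Y X) (lie_bracket A X Y))) = torsion A D X Y"
    by (simp add: vf_add_def vf_scale_def torsion_def fun_eq_iff)
  ultimately show "torsion A D X Y \<in> vector_fields A W" by simp
  fix X' Y' e assume eq: "\<forall>e\<in>W. X' e = X e \<and> Y' e = Y e" and e: "e \<in> W"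
  have "D X' Y' e = D X Y e" "D Y' X' e = D Y X e" "lie_bracket A X' Y' e = lie_bracket A X Y e"
    using local_operatorD(2)[OF D W X Y, of X' Y' e] local_operatorD(2)[OF D W Y X, of Y' X' e]
      lie_bracket_cong[OF W e X Y, of X' Y'] eq e by simp_all
  then show "torsion A D X' Y' e = torsion A D X Y e" by (simp add: torsion_def)
qed

text \<open>Linearity over functions is checked in the left argument, where the Leibniz terms of the
  connection and of the bracket cancel; skew-symmetry transfers it to the right one.\<close>

lemma torsion_tensor:
  assumes D: "linear_connection A D"
  shows "tensor_field A (torsion A D)"
  unfolding tensor_field_def
proof (intro conjI allI impI)
  show "local_operator A (torsion A D)"
    using D torsion_local unfolding linear_connection_def by blast
next
  have left: "torsion A D (vf_add X X') Y e g = torsion A D X Y e g + torsion A D X' Y e g"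
      "torsion A D (vf_scale f X) Y e g = f e * torsion A D X Y e g"
    if "open_in W" "smooth_fun A W f" "X \<in> vector_fields A W" "X' \<in> vector_fields A W"
      "Y \<in> vector_fields A W" "e \<in> W" for W f X X' Y e g
  proof -
    note D1 = linear_connectionD(1,2)[OF D that(1,6,2,3,4,5,5)] linear_connectionD(3,4)[OF D that(1,6,2,5,5,3,4)]
    show "torsion A D (vf_add X X') Y e g = torsion A D X Y e g + torsion A D X' Y e g"
      unfolding torsion_def D1 lie_bracket_add_left[OF that(1,6,3,4,5)] by (simp add: vf_add_def)
    show "torsion A D (vf_scale f X) Y e g = f e * torsion A D X Y e g"
      unfolding torsion_def D1 lie_bracket_scale_left[OF that(1,6,3,5,2)]
      by (simp add: vf_add_def vf_scale_def algebra_simps)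
  qed
  fix W X X' Y Y' f e
  assume "open_in W \<and> smooth_fun A W f \<and> {X, X', Y, Y'} \<subseteq> vector_fields A W \<and> e \<in> W"
  then have *: "open_in W" "smooth_fun A W f" "X \<in> vector_fields A W" "X' \<in> vector_fields A W"
      "Y \<in> vector_fields A W" "Y' \<in> vector_fields A W" "e \<in> W" by auto
  show "torsion A D (vf_add X X') Y e = vf_add (torsion A D X Y) (torsion A D X' Y) e"
    using left(1)[OF *(1-5,7)] by (simp add: vf_add_def fun_eq_iff)
  show "torsion A D (vf_scale f X) Y e = vf_scale f (torsion A D X Y) e"
    using left(2)[OF *(1-5,7)] by (simp add: vf_scale_def fun_eq_iff)
  show "torsion A D X (vf_add Y Y') e = vf_add (torsion A D X Y) (torsion A D X Y') e"
    using left(1)[OF *(1,2,5,6,3,7)]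
      torsion_skew[of D X "vf_add Y Y'"] torsion_skew[of D X Y] torsion_skew[of D X Y']
    by (simp add: vf_add_def fun_eq_iff)
  show "torsion A D X (vf_scale f Y) e = vf_scale f (torsion A D X Y) e"
    using left(2)[OF *(1,2,5,6,3,7)] torsion_skew[of D X "vf_scale f Y"] torsion_skew[of D X Y]
    by (simp add: vf_scale_def fun_eq_iff)
qed

lemma tensor_sum_left:
  assumes S: "tensor_field A S" and W: "open_in W" "e \<in> W" and "finite I"
    and "\<And>k. k \<in> I \<Longrightarrow> X k \<in> vector_fields A W" "\<And>k. k \<in> I \<Longrightarrow> smooth_fun A W (f k)"
    and Y: "Y \<in> vector_fields A W"
  shows "S (\<lambda>e g. \<Sum>k\<in>I. f k e * X k e g) Y e g = (\<Sum>k\<in>I. f k e * S (X k) Y e g)"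
  using assms(4-6)
proof (induction I)
  case empty
  \<comment> \<open>The empty sum is the zero field, which is 0 times itself, so homogeneity forces
    the value 0.\<close>
  have "S (vf_scale (\<lambda>_. 0) (\<lambda>e g. 0)) Y e = vf_scale (\<lambda>_. 0) (S (\<lambda>e g. 0) Y) e"
    by (rule tensor_fieldD(2)[OF S W smooth_fun_const vf_zero_mem vf_zero_mem Y])
  then show ?case by (simp add: vf_scale_def)
next
  case (insert k I)
  let ?X = "\<lambda>e g. \<Sum>k\<in>I. f k e * X k e g"
  have 1: "?X \<in> vector_fields A W" using insert by (intro vf_sum_mem[OF W(1)]) auto
  have 2: "vf_scale (f k) (X k) \<in> vector_fields A W" using insert by (intro vf_scale_mem[OF W(1)]) auto
  have fk: "smooth_fun A W (f k)" and Xk: "X k \<in> vector_fields A W" using insert by simp_all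
  have "S (vf_add (vf_scale (f k) (X k)) ?X) Y e = vf_add (S (vf_scale (f k) (X k)) Y) (S ?X Y) e"
      "S (vf_scale (f k) (X k)) Y e = vf_scale (f k) (S (X k) Y) e"
    by (rule tensor_fieldD(1)[OF S W fk 2 1 Y], rule tensor_fieldD(2)[OF S W fk Xk Xk Y])
  moreover have "vf_add (vf_scale (f k) (X k)) ?X = (\<lambda>e g. \<Sum>k\<in>insert k I. f k e * X k e g)"
    using insert(1,2) by (simp add: vf_add_def vf_scale_def)
  ultimately show ?case using insert by (simp add: vf_add_def vf_scale_def)
qed

end

section \<open>Jacobians of coordinate changes\<close>

locale vec_atlas = atlas A for A :: "('a, real^'k::finite) chart set"
begin

lemma chart_component_smooth:
  assumes "c \<in> A"
  shows "smooth_fun A (fst c) (\<lambda>s. snd c s $ a)"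
proof (rule smooth_fun_chartI[OF assms openin_chart[OF assms] order_refl])
  have op: "open (snd c ` fst c)" using openin_image_sub[OF openin_chart[OF assms] assms order_refl] .
  have "smooth_on (snd c ` fst c) (\<lambda>y. y $ a)"
    by (rule smooth_on_linear[OF op bounded_linear_vec_nth])
  moreover have "rep c (\<lambda>s. snd c s $ a) y = y $ a" if "y \<in> snd c ` fst c" for y
    using that chart_inv[OF assms] by auto
  ultimately show "smooth_on (snd c ` fst c) (rep c (\<lambda>s. snd c s $ a))"
    using smooth_on_cong[OF op, of "rep c (\<lambda>s. snd c s $ a)" "\<lambda>y. y $ a"] by blast
qed

lemma jac_eq_coord_field:
  assumes "c \<in> A" "c' \<in> A" "t \<in> fst c" "t \<in> fst c'"
  shows "jac c' c a b t = coord_field A c (axis b 1) t (\<lambda>s. snd c' s $ a)"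
  using smooth_atI[OF openin_chart chart_component_smooth] assms
  by (simp add: coord_field_eq jac_def)

lemma transition_derivative_nth:
  assumes c: "c \<in> A" "c' \<in> A" and t: "t \<in> fst c" "t \<in> fst c'"
  shows "frechet_derivative (rep c (snd c')) (at (snd c t)) w $ a = pd c w (\<lambda>s. snd c' s $ a) t"
proof -
  have "(rep c (snd c') has_derivative frechet_derivative (rep c (snd c')) (at (snd c t))) (at (snd c t))"
    by (rule smooth_on_imp_has_derivative[OF transition_smooth[OF c] transition_open[OF c]]) (use t in blast)
  then have "((\<lambda>y. rep c (snd c') y $ a) has_derivative
      (\<lambda>w. frechet_derivative (rep c (snd c')) (at (snd c t)) w $ a)) (at (snd c t))"
    by (rule bounded_linear.has_derivative[OF bounded_linear_vec_nth])
  from frechet_derivative_at[OF this] show ?thesis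
    by (simp add: pd_def comp_def) metis
qed

lemma coord_field_expand:
  assumes c: "c \<in> A" and t: "t \<in> fst c"
  shows "coord_field A c w t f = (\<Sum>b\<in>UNIV. w $ b * coord_field A c (axis b 1) t f)"
proof -
  interpret linear "\<lambda>w. coord_field A c w t f" by (rule coord_field_linear[OF c t])
  have "coord_field A c w t f = coord_field A c (\<Sum>b\<in>UNIV. w $ b *\<^sub>R axis b 1) t f"
    using basis_expansion[of w] by (simp add: scalar_mult_eq_scaleR)
  also have "\<dots> = (\<Sum>b\<in>UNIV. w $ b * coord_field A c (axis b 1) t f)"
    by (simp add: sum scaleR)
  finally show ?thesis .
qed

text \<open>A coordinate of \<open>c''\<close> is differentiated along a coordinate field of
  \<open>c\<close> that is re-expressed in the chart \<open>c'\<close>. This cocycle property makes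
  the fibre transformation law of the jet bundle consistent.\<close>

lemma jac_chain:
  assumes c: "c \<in> A" "c' \<in> A" "c'' \<in> A" and t: "t \<in> fst c" "t \<in> fst c'" "t \<in> fst c''"
  shows "jac c'' c a b t = (\<Sum>g\<in>UNIV. jac c'' c' a g t * jac c' c g b t)"
proof -
  let ?w = "frechet_derivative (rep c (snd c')) (at (snd c t)) (axis b 1)"
  have "jac c'' c a b t = coord_field A c' ?w t (\<lambda>s. snd c'' s $ a)"
    unfolding jac_eq_coord_field[OF c(1,3) t(1,3)] coord_field_change[OF c(1,2) t(1,2)] ..
  also have "\<dots> = (\<Sum>g\<in>UNIV. ?w $ g * coord_field A c' (axis g 1) t (\<lambda>s. snd c'' s $ a))"
    by (rule coord_field_expand[OF c(2) t(2)])
  also have "\<dots> = (\<Sum>g\<in>UNIV. jac c'' c' a g t * jac c' c g b t)"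
    by (simp add: transition_derivative_nth[OF c(1,2) t(1,2)] jac_eq_coord_field[OF c(2,3) t(2,3)]
        jac_def[of c' c] mult.commute)
  finally show ?thesis .
qed

lemma jac_self:
  assumes c: "c \<in> A" and t: "t \<in> fst c"
  shows "jac c c a b t = kron a b"
proof -
  have op: "open (snd c ` fst c)" using openin_image_sub[OF openin_chart[OF c] c order_refl] .
  have "frechet_derivative (rep c (\<lambda>s. snd c s $ a)) (at (snd c t)) = frechet_derivative (\<lambda>y. y $ a) (at (snd c t))"
    by (rule frechet_derivative_cong_open[OF op]) (use t chart_inv[OF c] in auto)
  also have "\<dots> = (\<lambda>y. y $ a)"
    by (rule frechet_derivative_at[symmetric], rule bounded_linear_imp_has_derivative, rule bounded_linear_vec_nth)
  finally show ?thesis by (simp add: jac_def pd_def kron_def axis_def)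
qed

text \<open>Since a Jacobian entry is a coordinate field applied to a coordinate function, its
  smoothness is an instance of vector fields preserving smoothness.\<close>

lemma jac_smooth:
  assumes c: "c \<in> A" "c' \<in> A"
  shows "smooth_fun A (fst c \<inter> fst c') (jac c' c a b)"
proof -
  have W: "openin (atlas_topology A) (fst c \<inter> fst c')" using openin_chart c by blast
  have 1: "smooth_fun A (fst c \<inter> fst c') (\<lambda>s. snd c' s $ a)"
    using chart_component_smooth[OF c(2)] smooth_fun_subset by blast
  have "(\<lambda>e. coord_field A c (axis b 1) e) \<in> vector_fields A (fst c \<inter> fst c')"
    by (rule coord_vf[OF c(1) W]) (auto simp: comp_def smooth_on_const)
  then have "smooth_fun A (fst c \<inter> fst c') (\<lambda>e. coord_field A c (axis b 1) e (\<lambda>s. snd c' s $ a))"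
    by (rule vf_smooth[OF _ W order_refl 1])
  then show ?thesis
    using smooth_fun_cong[OF W, of "jac c' c a b" "\<lambda>e. coord_field A c (axis b 1) e (\<lambda>s. snd c' s $ a)"]
      jac_eq_coord_field[OF c] by blast
qed

end

lemma kron_simps [simp]: "kron a a = 1" "a \<noteq> b \<Longrightarrow> kron a b = 0"
  by (auto simp: kron_def)

lemma sum_kron [simp]:
  fixes f :: "'k::finite \<Rightarrow> real"
  shows "(\<Sum>g\<in>UNIV. kron a g * f g) = f a" "(\<Sum>g\<in>UNIV. kron g a * f g) = f a"
    "(\<Sum>g\<in>UNIV. f g * kron a g) = f a" "(\<Sum>g\<in>UNIV. f g * kron g a) = f a"
  by (simp_all add: kron_def if_distrib[of "\<lambda>x. x * _"] if_distrib[of "\<lambda>x. _ * x"] cong: if_cong)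

section \<open>The atlas of the dual 1-jet bundle\<close>

locale jet_bundle = T: vec_atlas \<A> + X: vec_atlas \<B>
  for \<A> :: "('t, real^'m::finite) chart set" and \<B> :: "('x, real^'n::finite) chart set"
begin

abbreviation J where "J \<equiv> jet_chart \<A> \<B>"
abbreviation JA where "JA \<equiv> jet_atlas \<A> \<B>"

text \<open>The part of the bundle over \<open>S\<close> and \<open>R\<close>. Chart domains are
  boxes; so are their intersections and the mixed sets, over an overlap in one base and a full chart
  in the other, on which functions of one base are pulled back.\<close>

definition box :: "'t set \<Rightarrow> 'x set \<Rightarrow> ('t, 'x, 'm, 'n) jet set" where
  "box S R = {(t, x, p). (t, x, p) \<in> dual_jet \<A> \<B> \<and> t \<in> S \<and> x \<in> R}"

lemma jet_chart_dom: "fst (J c d) = box (fst c) (fst d)"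
  by (auto simp: jet_chart_def box_def)

lemma jet_dom: "e \<in> fst (J c d) \<Longrightarrow> fst e \<in> fst c" "e \<in> fst (J c d) \<Longrightarrow> fst (snd e) \<in> fst d"
  by (auto simp: jet_chart_dom box_def)

lemma jet_chart_apply: "snd (J c d) (t, x, p) = (snd c t, snd d x, p c d)"
  by (simp add: jet_chart_def)

lemma box_Int: "box S R \<inter> box S' R' = box (S \<inter> S') (R \<inter> R')"
  by (auto simp: box_def)

lemma jet_transform:
  assumes "(t, x, p) \<in> dual_jet \<A> \<B>" "c \<in> \<A>" "c' \<in> \<A>" "d \<in> \<B>" "d' \<in> \<B>"
    "t \<in> fst c" "t \<in> fst c'" "x \<in> fst d" "x \<in> fst d'"
  shows "p c' d' $ i $ a = (\<Sum>j\<in>UNIV. \<Sum>b\<in>UNIV. jac d d' j i x * jac c' c a b t * p c d $ j $ b)"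
  using assms unfolding dual_jet_def by blast

lemma jet_zero:
  assumes "(t, x, p) \<in> dual_jet \<A> \<B>" "\<not> (c \<in> \<A> \<and> t \<in> fst c \<and> d \<in> \<B> \<and> x \<in> fst d)"
  shows "p c d = 0"
  using assms unfolding dual_jet_def by blast

text \<open>The components in one pair of charts determine those in all other pairs around the point
  by the transformation law, and \<open>p\<close> is 0 on all remaining arguments. This is
  injectivity of the fibre coordinates.\<close>

lemma jet_eqI:
  assumes "(t, x, p) \<in> dual_jet \<A> \<B>" "(t, x, p') \<in> dual_jet \<A> \<B>"
    and c: "c \<in> \<A>" "t \<in> fst c" and d: "d \<in> \<B>" "x \<in> fst d" and eq: "p c d = p' c d"
  shows "p = p'"
proof (intro ext)
  fix c' d'
  show "p c' d' = p' c' d'"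
  proof (cases "c' \<in> \<A> \<and> t \<in> fst c' \<and> d' \<in> \<B> \<and> x \<in> fst d'")
    case True
    then show ?thesis
      using jet_transform[OF assms(1), of c c' d d'] jet_transform[OF assms(2), of c c' d d'] c d eq
      by (simp add: vec_eq_iff)
  next
    case False
    then show ?thesis using jet_zero[OF assms(1) False] jet_zero[OF assms(2) False] by simp
  qed
qed

text \<open>Surjectivity of the fibre coordinates: the prescribed components \<open>q\<close> in one
  pair of charts are spread to all others by the transformation law, whose consistency is the chain
  rule for Jacobians.\<close>

lemma jet_exists:
  assumes c: "c \<in> \<A>" "t \<in> fst c" and d: "d \<in> \<B>" "x \<in> fst d"
  shows "\<exists>p. (t, x, p) \<in> dual_jet \<A> \<B> \<and> p c d = q"
proof -
  define p where "p c' d' = (if c' \<in> \<A> \<and> t \<in> fst c' \<and> d' \<in> \<B> \<and> x \<in> fst d'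
    then \<chi> i a. \<Sum>j\<in>UNIV. \<Sum>b\<in>UNIV. jac d d' j i x * jac c' c a b t * q $ j $ b else 0)" for c' d'
  have trans: "p c'' d'' $ i $ a = (\<Sum>j\<in>UNIV. \<Sum>b\<in>UNIV. jac d' d'' j i x * jac c'' c' a b t * p c' d' $ j $ b)"
    if c': "c' \<in> \<A>" "t \<in> fst c'" "d' \<in> \<B>" "x \<in> fst d'" and c'': "c'' \<in> \<A>" "t \<in> fst c''" "d'' \<in> \<B>" "x \<in> fst d''"
    for c' d' c'' d'' i a
  proof -
    \<comment> \<open>The Jacobians between \<open>c\<close>, \<open>d\<close> and
      \<open>c''\<close>, \<open>d''\<close> are factored through \<open>c'\<close>,
      \<open>d'\<close>; what follows only reorders the four sums.\<close>
    have "p c'' d'' $ i $ a = (\<Sum>k\<in>UNIV. \<Sum>g\<in>UNIV. (\<Sum>j\<in>UNIV. jac d d' k j x * jac d' d'' j i x) *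
        (\<Sum>b\<in>UNIV. jac c'' c' a b t * jac c' c b g t) * q $ k $ g)"
      using c d c' c'' X.jac_chain[of d'' d' d x] T.jac_chain[of c c' c'' t] unfolding p_def
      by simp
    also have "\<dots> = (\<Sum>k\<in>UNIV. \<Sum>g\<in>UNIV. \<Sum>j\<in>UNIV. \<Sum>b\<in>UNIV. jac d d' k j x * jac d' d'' j i x *
        (jac c'' c' a b t * jac c' c b g t) * q $ k $ g)"
      unfolding sum_product by (simp only: sum_distrib_right)
    also have "\<dots> = (\<Sum>k\<in>UNIV. \<Sum>j\<in>UNIV. \<Sum>g\<in>UNIV. \<Sum>b\<in>UNIV. jac d d' k j x * jac d' d'' j i x *
        (jac c'' c' a b t * jac c' c b g t) * q $ k $ g)"
      by (rule sum.cong[OF refl], rule sum.swap)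
    also have "\<dots> = (\<Sum>k\<in>UNIV. \<Sum>j\<in>UNIV. \<Sum>b\<in>UNIV. \<Sum>g\<in>UNIV. jac d d' k j x * jac d' d'' j i x *
        (jac c'' c' a b t * jac c' c b g t) * q $ k $ g)"
      by (rule sum.cong[OF refl], rule sum.cong[OF refl], rule sum.swap)
    also have "\<dots> = (\<Sum>j\<in>UNIV. \<Sum>k\<in>UNIV. \<Sum>b\<in>UNIV. \<Sum>g\<in>UNIV. jac d d' k j x * jac d' d'' j i x *
        (jac c'' c' a b t * jac c' c b g t) * q $ k $ g)"
      by (rule sum.swap)
    also have "\<dots> = (\<Sum>j\<in>UNIV. \<Sum>b\<in>UNIV. \<Sum>k\<in>UNIV. \<Sum>g\<in>UNIV. jac d d' k j x * jac d' d'' j i x *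
        (jac c'' c' a b t * jac c' c b g t) * q $ k $ g)"
      by (rule sum.cong[OF refl], rule sum.swap)
    also have "\<dots> = (\<Sum>j\<in>UNIV. \<Sum>b\<in>UNIV. jac d' d'' j i x * jac c'' c' a b t * p c' d' $ j $ b)"
      using c' unfolding p_def by (simp add: sum_distrib_left algebra_simps)
    finally show ?thesis .
  qed
  have "(t, x, p) \<in> dual_jet \<A> \<B>"
    unfolding dual_jet_def mem_Collect_eq case_prod_conv
  proof (intro conjI ballI impI allI)
    show "t \<in> atlas_carrier \<A>" "x \<in> atlas_carrier \<B>" using c d by (auto simp: atlas_carrier_def)
    show "p c' d' = 0" if "\<not> (c' \<in> \<A> \<and> t \<in> fst c' \<and> d' \<in> \<B> \<and> x \<in> fst d')" for c' d'
      using that unfolding p_def by (rule if_not_P)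
  qed (rule trans, auto)
  moreover have "p c d = q"
    using c d by (simp add: p_def vec_eq_iff X.jac_self T.jac_self mult.assoc flip: sum_distrib_left)
  ultimately show ?thesis by blast
qed

text \<open>By \<open>jet_exists\<close> the fibre coordinates take all values, so the image is a
  full product and its openness reduces to the two base atlases.\<close>

lemma jet_chart_image:
  assumes c: "c \<in> \<A>" and d: "d \<in> \<B>"
  shows "snd (J c d) ` (fst (J c d) \<inter> box S R) = (snd c ` (fst c \<inter> S)) \<times> (snd d ` (fst d \<inter> R)) \<times> UNIV"
proof (intro equalityI subsetI)
  fix y assume "y \<in> (snd c ` (fst c \<inter> S)) \<times> (snd d ` (fst d \<inter> R)) \<times> (UNIV :: (real^'m^'n) set)"
  then obtain t x q where t: "t \<in> fst c" "t \<in> S" and x: "x \<in> fst d" "x \<in> R" and y: "y = (snd c t, snd d x, q)"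
    by blast
  obtain p where "(t, x, p) \<in> dual_jet \<A> \<B>" "p c d = q" using jet_exists[OF c t(1) d x(1)] by blast
  then show "y \<in> snd (J c d) ` (fst (J c d) \<inter> box S R)"
    using t x y unfolding jet_chart_dom box_Int
    by (intro image_eqI[of _ _ "(t, x, p)"]) (auto simp: jet_chart_apply box_def)
qed (auto simp: jet_chart_dom box_def jet_chart_apply)

lemma jet_chart_inj:
  assumes c: "c \<in> \<A>" and d: "d \<in> \<B>"
  shows "inj_on (snd (J c d)) (fst (J c d))"
proof (rule inj_onI)
  fix e e' assume e: "e \<in> fst (J c d)" "e' \<in> fst (J c d)" and eq: "snd (J c d) e = snd (J c d) e'"
  obtain t x p t' x' p' where ee: "e = (t, x, p)" "e' = (t', x', p')" by (metis prod_cases3)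
  have *: "snd c t = snd c t'" "snd d x = snd d x'" "p c d = p' c d"
    "t \<in> fst c" "t' \<in> fst c" "x \<in> fst d" "x' \<in> fst d" "(t, x, p) \<in> dual_jet \<A> \<B>" "(t', x', p') \<in> dual_jet \<A> \<B>"
    using e eq unfolding ee by (auto simp: jet_chart_dom box_def jet_chart_apply)
  have "t = t'" "x = x'"
    using inj_onD[OF T.chart_inj[OF c]] inj_onD[OF X.chart_inj[OF d]] * by blast+
  then show "e = e'" using jet_eqI[of t x p p' c d] * c d ee by simp
qed

lemma jet_chart_inv:
  assumes "c \<in> \<A>" "d \<in> \<B>" "e \<in> fst (J c d)"
  shows "inv_into (fst (J c d)) (snd (J c d)) (snd (J c d) e) = e"
  using jet_chart_inj assms by (simp add: inv_into_f_f)

lemma jet_transition_smooth: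
  assumes c: "c \<in> \<A>" "c' \<in> \<A>" and d: "d \<in> \<B>" "d' \<in> \<B>"
  shows "open (snd (J c d) ` (fst (J c d) \<inter> fst (J c' d')))"
    and "smooth_on (snd (J c d) ` (fst (J c d) \<inter> fst (J c' d'))) (rep (J c d) (snd (J c' d')))"
proof -
  let ?V = "snd (J c d) ` (fst (J c d) \<inter> fst (J c' d'))"
  let ?S = "snd c ` (fst c \<inter> fst c')" and ?R = "snd d ` (fst d \<inter> fst d')"
  have V: "?V = ?S \<times> ?R \<times> UNIV"
    unfolding jet_chart_dom[of c' d'] by (rule jet_chart_image[OF c(1) d(1)])
  have oS: "open ?S" and oR: "open ?R" using T.transition_open[OF c] X.transition_open[OF d] .
  show op: "open ?V" unfolding V using oS oR by (intro open_Times open_UNIV)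
  \<comment> \<open>The transition map in closed form: base transitions in the first two components
    and, in the fibre, a linear map whose coefficients are Jacobians of the base. The agreement with
    the actual map is needed on the overlap only.\<close>
  define F where "F z = (rep c (snd c') (fst z), rep d (snd d') (fst (snd z)), \<chi> i a. \<Sum>j\<in>UNIV. \<Sum>b\<in>UNIV.
      rep d (jac d d' j i) (fst (snd z)) * rep c (jac c' c a b) (fst z) * snd (snd z) $ j $ b)"
    for z :: "('m, 'n) jet_model"
  have l1: "bounded_linear (fst :: ('m, 'n) jet_model \<Rightarrow> _)" by (rule bounded_linear_fst)
  have l2: "bounded_linear (\<lambda>z :: ('m, 'n) jet_model. fst (snd z))"
    by (intro bounded_linear_compose[OF bounded_linear_fst] bounded_linear_snd)
  have l3: "bounded_linear (\<lambda>z :: ('m, 'n) jet_model. snd (snd z) $ j $ b)" for j b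
    by (intro bounded_linear_compose[OF bounded_linear_vec_nth] bounded_linear_compose[OF bounded_linear_snd] bounded_linear_snd)
  have cS: "smooth_on ?V (\<lambda>z. f (fst z))" if "smooth_on ?S f" for f :: "real^'m \<Rightarrow> 'z::real_normed_vector"
    by (rule smooth_on_compose[OF op oS _ that smooth_on_linear[OF op l1]]) (auto simp: V)
  have cR: "smooth_on ?V (\<lambda>z. f (fst (snd z)))" if "smooth_on ?R f" for f :: "real^'n \<Rightarrow> 'z::real_normed_vector"
    by (rule smooth_on_compose[OF op oR _ that smooth_on_linear[OF op l2]]) (auto simp: V)
  have jT: "smooth_on ?S (rep c (jac c' c a b))" for a b
    using T.smooth_fun_chartD[OF c(1) _ T.jac_smooth[OF c]] by blast
  have jX: "smooth_on ?R (rep d (jac d d' j i))" for j i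
    using X.smooth_fun_chartD[OF d(1) _ X.jac_smooth[OF d(2,1)]] by (simp add: Int_commute)
  have "smooth_on ?V (\<lambda>z. \<Sum>j\<in>UNIV. \<Sum>b\<in>UNIV.
      rep d (jac d d' j i) (fst (snd z)) * rep c (jac c' c a b) (fst z) * snd (snd z) $ j $ b)" for i a
    by (rule smooth_on_sum[OF op], rule smooth_on_sum[OF op], rule smooth_on_mult[OF op smooth_on_mult[OF op
          cR[OF jX] cS[OF jT]] smooth_on_linear[OF op l3]])
  then have "smooth_on ?V (\<lambda>z. \<chi> i a. \<Sum>j\<in>UNIV. \<Sum>b\<in>UNIV.
      rep d (jac d d' j i) (fst (snd z)) * rep c (jac c' c a b) (fst z) * snd (snd z) $ j $ b)"
    by (intro smooth_on_vec[OF op]) simp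
  then have F: "smooth_on ?V F"
    unfolding F_def
    by (intro smooth_on_Pair[OF op] cS[OF T.transition_smooth[OF c]] cR[OF X.transition_smooth[OF d]])
  have "rep (J c d) (snd (J c' d')) z = F z" if z: "z \<in> ?V" for z
  proof -
    obtain t x p where e: "(t, x, p) \<in> fst (J c d)" "(t, x, p) \<in> fst (J c' d')" and z: "z = snd (J c d) (t, x, p)"
      using z by fast
    then have *: "(t, x, p) \<in> dual_jet \<A> \<B>" "t \<in> fst c" "t \<in> fst c'" "x \<in> fst d" "x \<in> fst d'"
      by (auto simp: jet_chart_dom box_def)
    have "rep (J c d) (snd (J c' d')) z = (snd c' t, snd d' x, p c' d')"
      using jet_chart_inv[OF c(1) d(1) e(1)] by (simp add: z jet_chart_apply)
    moreover have "F z = (snd c' t, snd d' x, p c' d')"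
      unfolding F_def z jet_chart_apply
      using T.chart_inv[OF c(1) *(2)] X.chart_inv[OF d(1) *(4)]
        jet_transform[OF *(1) c d *(2-5)]
      by (simp add: vec_eq_iff)
    ultimately show ?thesis by simp
  qed
  then show "smooth_on ?V (rep (J c d) (snd (J c' d')))"
    using smooth_on_cong[OF op, of "rep (J c d) (snd (J c' d'))" F] F by blast
qed

lemma jet_smooth_atlas: "smooth_atlas JA"
proof -
  have "inj_on (snd C) (fst C) \<and> open (snd C ` fst C)" if "C \<in> JA" for C
    using that jet_chart_inj jet_transition_smooth(1) unfolding jet_atlas_def by fastforce
  moreover have "open (snd C ` (fst C \<inter> fst C')) \<and> smooth_on (snd C ` (fst C \<inter> fst C')) (rep C (snd C'))"
    if "C \<in> JA" "C' \<in> JA" for C C'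
    using that jet_transition_smooth unfolding jet_atlas_def by fast
  ultimately show ?thesis unfolding smooth_atlas_def by (simp add: split_beta)
qed

end

sublocale jet_bundle \<subseteq> J: atlas "jet_atlas \<A> \<B>"
  by unfold_locales (rule jet_smooth_atlas)

section \<open>Coordinates and adapted frames\<close>

abbreviation tc :: "('t, real^'m) chart \<Rightarrow> 'm::finite \<Rightarrow> ('t, 'x, 'm, 'n::finite) jet \<Rightarrow> real" where
  "tc c a \<equiv> (\<lambda>(t, _, _). snd c t $ a)"

abbreviation xc :: "('x, real^'n) chart \<Rightarrow> 'n::finite \<Rightarrow> ('t, 'x, 'm::finite, 'n) jet \<Rightarrow> real" where
  "xc d i \<equiv> (\<lambda>(_, x, _). snd d x $ i)"

abbreviation pc :: "('t, real^'m) chart \<Rightarrow> ('x, real^'n) chart \<Rightarrow> 'n::finite \<Rightarrow> 'm::finite \<Rightarrow>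
    ('t, 'x, 'm, 'n) jet \<Rightarrow> real" where
  "pc c d i a \<equiv> (\<lambda>(_, _, p). p c d $ i $ a)"

lemma sum_swap3:
  fixes F :: "'i \<Rightarrow> 'j \<Rightarrow> 'k \<Rightarrow> real"
  shows "(\<Sum>g\<in>G. \<Sum>j\<in>I. \<Sum>b\<in>K. F g j b) = (\<Sum>j\<in>I. \<Sum>b\<in>K. \<Sum>g\<in>G. F g j b)"
proof -
  have "(\<Sum>g\<in>G. \<Sum>j\<in>I. \<Sum>b\<in>K. F g j b) = (\<Sum>j\<in>I. \<Sum>g\<in>G. \<Sum>b\<in>K. F g j b)" by (rule sum.swap)
  also have "\<dots> = (\<Sum>j\<in>I. \<Sum>b\<in>K. \<Sum>g\<in>G. F g j b)" by (rule sum.cong[OF refl], rule sum.swap)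
  finally show ?thesis .
qed

lemma (in atlas) coord_field_zero: "C \<in> A \<Longrightarrow> e \<in> fst C \<Longrightarrow> coord_field A C 0 e f = 0"
  using linear_0[OF coord_field_linear] by blast

text \<open>The case \<open>I = {}\<close> is set apart because nothing then places \<open>e\<close>
  in the carrier, where alone constants are smooth.\<close>

lemma (in atlas) tangent_sum:
  assumes v: "v \<in> tangent_space A e" and f: "\<And>i. i \<in> I \<Longrightarrow> smooth_at A e (f i)" and "finite I"
  shows "smooth_at A e (\<lambda>x. \<Sum>i\<in>I. f i x) \<or> I = {}" "v (\<lambda>x. \<Sum>i\<in>I. f i x) = (\<Sum>i\<in>I. v (f i))"
proof -
  have "v (\<lambda>x. \<Sum>i\<in>I. f i x) = (\<Sum>i\<in>I. v (f i)) \<and> (smooth_at A e (\<lambda>x. \<Sum>i\<in>I. f i x) \<or> I = {})"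
    using assms(3) f
  proof (induction I)
    case empty
    then show ?case using tangent_const[OF v, of 0] by simp
  next
    case (insert k I)
    then have *: "smooth_at A e (f k)" "\<And>i. i \<in> I \<Longrightarrow> smooth_at A e (f i)" by auto
    have IH: "v (\<lambda>x. \<Sum>i\<in>I. f i x) = (\<Sum>i\<in>I. v (f i))" "smooth_at A e (\<lambda>x. \<Sum>i\<in>I. f i x) \<or> I = {}"
      using insert.IH[OF *(2)] by auto
    have s: "smooth_at A e (\<lambda>x. \<Sum>i\<in>I. f i x)"
      using IH(2) smooth_at_const[OF smooth_at_carrier[OF *(1)], of 0] by auto
    show ?case
      using tangent_add[OF v *(1) s] smooth_at_add[OF *(1) s] IH(1) insert.hyps by simp
  qed
  then show "smooth_at A e (\<lambda>x. \<Sum>i\<in>I. f i x) \<or> I = {}" "v (\<lambda>x. \<Sum>i\<in>I. f i x) = (\<Sum>i\<in>I. v (f i))"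
    by auto
qed

text \<open>Serves both projections of the bundle onto its bases. In charts such a projection is the
  linear map \<open>L\<close>, which is its own derivative, so a direction \<open>w\<close> is
  pushed forward to \<open>L w\<close>.\<close>

lemma (in atlas) pullback_linear:
  fixes B :: "('b, 'w::euclidean_space) chart set"
  assumes B: "atlas B" and c: "c \<in> B" and S: "openin (atlas_topology B) S" "S \<subseteq> fst c"
    and C: "C \<in> A" and W: "open_in W" "W \<subseteq> fst C"
    and L: "bounded_linear L" and \<pi>: "\<And>e. e \<in> W \<Longrightarrow> \<pi> e \<in> S \<and> snd c (\<pi> e) = L (snd C e)"
    and f: "smooth_fun B S f"
  shows "smooth_fun A W (\<lambda>e. f (\<pi> e))"
    and "e \<in> W \<Longrightarrow> coord_field A C w e (\<lambda>e. f (\<pi> e)) = coord_field B c (L w) (\<pi> e) f"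
proof -
  interpret B: atlas B by (rule B)
  let ?V = "snd C ` W" and ?f = "\<lambda>e. f (\<pi> e)"
  have op: "open ?V" by (rule openin_image_sub[OF W(1) C W(2)])
  have opS: "open (snd c ` S)" by (rule B.openin_image_sub[OF S(1) c S(2)])
  have F: "smooth_on (snd c ` S) (rep c f)" by (rule B.smooth_fun_chartD[OF c S(2) f])
  have sub: "L ` ?V \<subseteq> snd c ` S"
  proof clarify
    fix e assume "e \<in> W"
    then show "L (snd C e) \<in> snd c ` S" using \<pi>[of e] imageI[of "\<pi> e" S "snd c"] by simp
  qed
  have eq: "rep C ?f z = rep c f (L z)" if z: "z \<in> ?V" for z
  proof -
    obtain e where e: "e \<in> W" "z = snd C e" using z by blast
    then have "\<pi> e \<in> fst c" "L z = snd c (\<pi> e)" using \<pi> S(2) by auto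
    then show ?thesis using e chart_inv[OF C, of e] W(2) B.chart_inv[OF c, of "\<pi> e"] by auto
  qed
  have "smooth_on ?V (\<lambda>z. rep c f (L z))"
    by (rule smooth_on_compose[OF op opS sub F smooth_on_linear[OF op L]])
  then have "smooth_on ?V (rep C ?f)"
    using smooth_on_cong[OF op, of "rep C ?f" "\<lambda>z. rep c f (L z)"] eq by blast
  then show sm: "smooth_fun A W ?f" by (rule smooth_fun_chartI[OF C W])
  assume e: "e \<in> W"
  then have t: "\<pi> e \<in> S" "L (snd C e) = snd c (\<pi> e)" using \<pi> by auto
  have "(rep c f has_derivative frechet_derivative (rep c f) (at (snd c (\<pi> e)))) (at (L (snd C e)))"
    unfolding t(2) by (rule smooth_on_imp_has_derivative[OF F opS]) (use t in blast)
  from has_derivative_compose[OF bounded_linear_imp_has_derivative[OF L] this]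
  have "((\<lambda>z. rep c f (L z)) has_derivative
      (\<lambda>w. frechet_derivative (rep c f) (at (snd c (\<pi> e))) (L w))) (at (snd C e))" .
  note 1 = frechet_derivative_at[OF this]
  have "frechet_derivative (rep C ?f) (at (snd C e)) = frechet_derivative (\<lambda>z. rep c f (L z)) (at (snd C e))"
    by (rule frechet_derivative_cong_open[OF op _ eq]) (use e in blast)
  then show "coord_field A C w e ?f = coord_field B c (L w) (\<pi> e) f"
    using smooth_atI[OF W(1) sm e] B.smooth_atI[OF S(1) f t(1)] 1[symmetric]
    by (simp add: B.coord_field_eq coord_field_eq pd_def)
qed

lemma jet_model_expand:
  fixes z :: "('m::finite, 'n::finite) jet_model"
  shows "z = (\<Sum>g\<in>UNIV. fst z $ g *\<^sub>R dir_t g) + (\<Sum>k\<in>UNIV. fst (snd z) $ k *\<^sub>R dir_x k) +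
    (\<Sum>j\<in>UNIV. \<Sum>b\<in>UNIV. snd (snd z) $ j $ b *\<^sub>R dir_p j b)"
proof -
  have fst_sum: "fst (\<Sum>i\<in>I. f i) = (\<Sum>i\<in>I. fst (f i))" for f :: "'i \<Rightarrow> 'u::real_vector \<times> 'v::real_vector" and I
    by (induction I rule: infinite_finite_induct) auto
  have snd_sum: "snd (\<Sum>i\<in>I. f i) = (\<Sum>i\<in>I. snd (f i))" for f :: "'i \<Rightarrow> 'u::real_vector \<times> 'v::real_vector" and I
    by (induction I rule: infinite_finite_induct) auto
  have ax: "(axis j (axis b 1) :: real^'m^'n) $ i $ a = kron i j * kron a b" for i j a b
    by (simp add: axis_def kron_def)
  have 3: "(\<Sum>j\<in>UNIV. \<Sum>b\<in>UNIV. q $ j $ b *\<^sub>R axis j (axis b 1)) = q" for q :: "real^'m^'n"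
  proof -
    have "(\<Sum>j\<in>UNIV. \<Sum>b\<in>UNIV. q $ j $ b * (kron i j * kron a b)) =
        (\<Sum>j\<in>UNIV. (\<Sum>b\<in>UNIV. q $ j $ b * kron a b) * kron i j)" for i a
      by (simp only: sum_distrib_right sum_distrib_left mult_ac)
    then have "(\<Sum>j\<in>UNIV. \<Sum>b\<in>UNIV. q $ j $ b * (kron i j * kron a b)) = q $ i $ a" for i a
      by simp
    then show ?thesis by (simp add: vec_eq_iff ax)
  qed
  have 1: "(\<Sum>g\<in>UNIV. v $ g *\<^sub>R axis g 1) = v" for v :: "real^'k"
    using basis_expansion[of v] by (simp add: scalar_mult_eq_scaleR)
  show ?thesis
    by (simp add: prod_eq_iff fst_sum snd_sum dir_t_def dir_x_def dir_p_def 1 3)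
qed

context jet_bundle
begin

lemma J_mem: "c \<in> \<A> \<Longrightarrow> d \<in> \<B> \<Longrightarrow> J c d \<in> JA"
  unfolding jet_atlas_def by blast

lemma J_open: "c \<in> \<A> \<Longrightarrow> d \<in> \<B> \<Longrightarrow> J.open_in (fst (J c d))"
  by (rule J.openin_chart[OF J_mem])

text \<open>All three kinds of bundle coordinates are bounded linear functions of the chart value,
  so one argument covers their smoothness, and one more their derivatives.\<close>

lemma chart_linear_smooth:
  assumes c: "c \<in> \<A>" and d: "d \<in> \<B>" and L: "bounded_linear L"
  shows "smooth_fun JA (fst (J c d)) (\<lambda>e. L (snd (J c d) e))"
proof (rule J.smooth_fun_chartI[OF J_mem[OF c d] J_open[OF c d] order_refl])
  have op: "open (snd (J c d) ` fst (J c d))"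
    by (rule J.openin_image_sub[OF J_open[OF c d] J_mem[OF c d] order_refl])
  have "rep (J c d) (\<lambda>e. L (snd (J c d) e)) z = L z" if "z \<in> snd (J c d) ` fst (J c d)" for z
    using that jet_chart_inv[OF c d] by auto
  then show "smooth_on (snd (J c d) ` fst (J c d)) (rep (J c d) (\<lambda>e. L (snd (J c d) e)))"
    using smooth_on_cong[OF op, of "rep (J c d) (\<lambda>e. L (snd (J c d) e))" L] smooth_on_linear[OF op L] by blast
qed

lemma chart_linear_coord_field:
  assumes c: "c \<in> \<A>" and d: "d \<in> \<B>" and e: "e \<in> fst (J c d)" and L: "bounded_linear L"
  shows "coord_field JA (J c d) w e (\<lambda>e. L (snd (J c d) e)) = L w"
proof -
  have op: "open (snd (J c d) ` fst (J c d))"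
    by (rule J.openin_image_sub[OF J_open[OF c d] J_mem[OF c d] order_refl])
  have "frechet_derivative (rep (J c d) (\<lambda>e. L (snd (J c d) e))) (at (snd (J c d) e)) =
      frechet_derivative L (at (snd (J c d) e))"
    by (rule frechet_derivative_cong_open[OF op]) (use e jet_chart_inv[OF c d] in auto)
  also have "\<dots> = L"
    by (rule frechet_derivative_at[symmetric], rule bounded_linear_imp_has_derivative, rule L)
  finally show ?thesis
    using J.smooth_atI[OF J_open[OF c d] chart_linear_smooth[OF c d L] e] by (simp add: J.coord_field_eq pd_def)
qed

lemma bounded_linear_coords:
  "bounded_linear (\<lambda>z :: ('m, 'n) jet_model. fst z $ a)"
  "bounded_linear (\<lambda>z :: ('m, 'n) jet_model. fst (snd z) $ i)"
  "bounded_linear (\<lambda>z :: ('m, 'n) jet_model. snd (snd z) $ i $ a)"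
proof -
  show "bounded_linear (\<lambda>z :: ('m, 'n) jet_model. fst z $ a)"
    by (rule bounded_linear_compose[OF bounded_linear_vec_nth bounded_linear_fst])
  show "bounded_linear (\<lambda>z :: ('m, 'n) jet_model. fst (snd z) $ i)"
    by (rule bounded_linear_compose[OF bounded_linear_vec_nth bounded_linear_compose[OF bounded_linear_fst bounded_linear_snd]])
  show "bounded_linear (\<lambda>z :: ('m, 'n) jet_model. snd (snd z) $ i $ a)"
    by (rule bounded_linear_compose[OF bounded_linear_vec_nth bounded_linear_compose[OF bounded_linear_vec_nth
          bounded_linear_compose[OF bounded_linear_snd bounded_linear_snd]]])
qed

lemma coords_eq:
  "tc c a = (\<lambda>e. fst (snd (J c d) e) $ a)"
  "xc d i = (\<lambda>e. fst (snd (snd (J c d) e)) $ i)"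
  "pc c d i a = (\<lambda>e. snd (snd (snd (J c d) e)) $ i $ a)"
  by (auto simp: fun_eq_iff jet_chart_apply)

lemma coords_smooth:
  assumes "c \<in> \<A>" "d \<in> \<B>"
  shows "smooth_fun JA (fst (J c d)) (tc c a)" "smooth_fun JA (fst (J c d)) (xc d i)"
    "smooth_fun JA (fst (J c d)) (pc c d i a)"
  unfolding coords_eq(1)[of c a d] coords_eq(2)[of d i c] coords_eq(3)
  by (rule chart_linear_smooth[OF assms bounded_linear_coords(1)],
      rule chart_linear_smooth[OF assms bounded_linear_coords(2)],
      rule chart_linear_smooth[OF assms bounded_linear_coords(3)])

lemma coord_field_coords:
  assumes "c \<in> \<A>" "d \<in> \<B>" "e \<in> fst (J c d)"
  shows "coord_field JA (J c d) w e (tc c a) = fst w $ a"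
    and "coord_field JA (J c d) w e (xc d i) = fst (snd w) $ i"
    and "coord_field JA (J c d) w e (pc c d i a) = snd (snd w) $ i $ a"
  unfolding coords_eq(1)[of c a d] coords_eq(2)[of d i c] coords_eq(3)
  by (rule chart_linear_coord_field[OF assms bounded_linear_coords(1)],
      rule chart_linear_coord_field[OF assms bounded_linear_coords(2)],
      rule chart_linear_coord_field[OF assms bounded_linear_coords(3)])

lemma coord_field_model_expand:
  assumes c: "c \<in> \<A>" and d: "d \<in> \<B>" and e: "e \<in> fst (J c d)"
  shows "coord_field JA (J c d) z e f = (\<Sum>g\<in>UNIV. fst z $ g * par_t \<A> \<B> c d g e f) +
    (\<Sum>k\<in>UNIV. fst (snd z) $ k * par_x \<A> \<B> c d k e f) +
    (\<Sum>j\<in>UNIV. \<Sum>b\<in>UNIV. snd (snd z) $ j $ b * par_p \<A> \<B> c d j b e f)"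
proof -
  interpret linear "\<lambda>w. coord_field JA (J c d) w e f" by (rule J.coord_field_linear[OF J_mem[OF c d] e])
  show ?thesis
    by (subst jet_model_expand[of z]) (simp only: add sum scaleR par_t_def par_x_def par_p_def real_scaleR_def)
qed

text \<open>The coefficients in the new coordinate frame are the derivatives of the new coordinates;
  a change of frame thus becomes the differentiation of coordinate functions.\<close>

lemma coord_field_frame_change:
  assumes c: "c \<in> \<A>" "c' \<in> \<A>" and d: "d \<in> \<B>" "d' \<in> \<B>"
    and e: "e \<in> fst (J c d)" "e \<in> fst (J c' d')"
  shows "coord_field JA (J c d) w e f =
    (\<Sum>g\<in>UNIV. coord_field JA (J c d) w e (tc c' g) * par_t \<A> \<B> c' d' g e f) +
    (\<Sum>k\<in>UNIV. coord_field JA (J c d) w e (xc d' k) * par_x \<A> \<B> c' d' k e f) +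
    (\<Sum>j\<in>UNIV. \<Sum>b\<in>UNIV. coord_field JA (J c d) w e (pc c' d' j b) * par_p \<A> \<B> c' d' j b e f)"
  unfolding J.coord_field_change[OF J_mem[OF c(1) d(1)] J_mem[OF c(2) d(2)] e]
    coord_field_coords[OF c(2) d(2) e(2)]
  by (rule coord_field_model_expand[OF c(2) d(2) e(2)])

lemma box_open:
  assumes S: "T.open_in S" and R: "X.open_in R"
  shows "J.open_in (box S R)"
  unfolding J.openin_iff
proof (intro conjI ballI)
  show "box S R \<subseteq> atlas_carrier JA"
  proof
    fix e assume "e \<in> box S R"
    then obtain t x p where e: "e = (t, x, p)" "(t, x, p) \<in> dual_jet \<A> \<B>" by (auto simp: box_def)
    then have "t \<in> atlas_carrier \<A>" "x \<in> atlas_carrier \<B>" by (auto simp: dual_jet_def)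
    then obtain c d where cd: "c \<in> \<A>" "t \<in> fst c" "d \<in> \<B>" "x \<in> fst d" by (auto simp: atlas_carrier_def)
    then have "e \<in> fst (J c d)" using e by (simp add: jet_chart_dom box_def)
    then show "e \<in> atlas_carrier JA" unfolding atlas_carrier_def using J_mem cd by blast
  qed
  fix C assume "C \<in> JA"
  then obtain c d where cd: "c \<in> \<A>" "d \<in> \<B>" "C = J c d" unfolding jet_atlas_def by blast
  show "open (snd C ` (fst C \<inter> box S R))"
    unfolding cd(3) jet_chart_image[OF cd(1,2)]
    using T.openin_image[OF S cd(1)] X.openin_image[OF R cd(2)] by (intro open_Times open_UNIV)
qed

lemma pullback_t:
  assumes c: "c \<in> \<A>" and d: "d \<in> \<B>" and S: "T.open_in S" "S \<subseteq> fst c" and f: "smooth_fun \<A> S f"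
  shows "smooth_fun JA (box S (fst d)) (\<lambda>e. f (fst e))"
    and "e \<in> box S (fst d) \<Longrightarrow> coord_field JA (J c d) w e (\<lambda>e. f (fst e)) = coord_field \<A> c (fst w) (fst e) f"
  by (rule J.pullback_linear[OF T.atlas_axioms c S J_mem[OF c d] box_open[OF S(1) X.openin_chart[OF d]]
        _ bounded_linear_fst _ f]; use S(2) in \<open>auto simp: jet_chart_dom box_def jet_chart_apply\<close>)+

lemma pullback_x:
  assumes c: "c \<in> \<A>" and d: "d \<in> \<B>" and S: "X.open_in S" "S \<subseteq> fst d" and f: "smooth_fun \<B> S f"
  shows "smooth_fun JA (box (fst c) S) (\<lambda>e. f (fst (snd e)))"
    and "e \<in> box (fst c) S \<Longrightarrow>
      coord_field JA (J c d) w e (\<lambda>e. f (fst (snd e))) = coord_field \<B> d (fst (snd w)) (fst (snd e)) f"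
  by (rule J.pullback_linear[OF X.atlas_axioms d S J_mem[OF c d] box_open[OF T.openin_chart[OF c] S(1)]
        _ bounded_linear_compose[OF bounded_linear_fst bounded_linear_snd] _ f];
      use S(2) in \<open>auto simp: jet_chart_dom box_def jet_chart_apply\<close>)+

text \<open>Base coordinates are pulled back from the base manifolds. For the fibre coordinates, the
  transformation law is differentiated in a vertical direction, which annihilates its Jacobians
  because they depend on the base point only.\<close>

lemma coord_field_other_coords:
  assumes c: "c \<in> \<A>" "c' \<in> \<A>" and d: "d \<in> \<B>" "d' \<in> \<B>"
    and e: "e \<in> fst (J c d)" "e \<in> fst (J c' d')"
  shows "coord_field JA (J c d) w e (tc c' g) = (\<Sum>a\<in>UNIV. fst w $ a * jac c' c g a (fst e))"
    and "coord_field JA (J c d) w e (xc d' k) = (\<Sum>i\<in>UNIV. fst (snd w) $ i * jac d' d k i (fst (snd e)))"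
    and "par_p \<A> \<B> c d l a e (pc c' d' j b) = jac d d' l j (fst (snd e)) * jac c' c b a (fst e)"
proof -
  let ?t = "fst e" and ?x = "fst (snd e)"
  have t: "?t \<in> fst c" "?t \<in> fst c'" and x: "?x \<in> fst d" "?x \<in> fst d'"
    using e by (auto simp: jet_chart_dom box_def)
  let ?S = "fst c \<inter> fst c'" and ?R = "fst d \<inter> fst d'"
  have S: "T.open_in ?S" "?S \<subseteq> fst c" using T.openin_chart[OF c(1)] T.openin_chart[OF c(2)] by auto
  have R: "X.open_in ?R" "?R \<subseteq> fst d" using X.openin_chart[OF d(1)] X.openin_chart[OF d(2)] by auto
  have eb: "e \<in> box ?S (fst d)" "e \<in> box (fst c) ?R" "e \<in> box ?S ?R"
    using e by (auto simp: jet_chart_dom box_def)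
  have "coord_field JA (J c d) w e (\<lambda>e. snd c' (fst e) $ g) = coord_field \<A> c (fst w) ?t (\<lambda>s. snd c' s $ g)"
    by (rule pullback_t(2)[OF c(1) d(1) S T.smooth_fun_subset[OF T.chart_component_smooth[OF c(2)]] eb(1)]) auto
  then show "coord_field JA (J c d) w e (tc c' g) = (\<Sum>a\<in>UNIV. fst w $ a * jac c' c g a ?t)"
    using T.coord_field_expand[OF c(1) t(1), of "fst w"]
    by (simp add: T.jac_eq_coord_field[OF c t] split_beta')
  have "coord_field JA (J c d) w e (\<lambda>e. snd d' (fst (snd e)) $ k) =
      coord_field \<B> d (fst (snd w)) ?x (\<lambda>s. snd d' s $ k)"
    by (rule pullback_x(2)[OF c(1) d(1) R X.smooth_fun_subset[OF X.chart_component_smooth[OF d(2)]] eb(2)]) auto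
  then show "coord_field JA (J c d) w e (xc d' k) = (\<Sum>i\<in>UNIV. fst (snd w) $ i * jac d' d k i ?x)"
    using X.coord_field_expand[OF d(1) x(1), of "fst (snd w)"]
    by (simp add: X.jac_eq_coord_field[OF d x] split_beta')

  let ?v = "par_p \<A> \<B> c d l a e"
  let ?X = "\<lambda>k e. jac d d' k j (fst (snd e))" and ?T = "\<lambda>g e. jac c' c b g (fst e)"
  have v: "?v \<in> tangent_space JA e"
    unfolding par_p_def by (rule J.coord_field_tangent[OF J_mem[OF c(1) d(1)] e(1)])
  have jT: "smooth_fun \<A> ?S (jac c' c b g)" for g by (rule T.jac_smooth[OF c])
  have jX: "smooth_fun \<B> ?R (jac d d' k j)" for k
    using X.jac_smooth[OF d(2,1)] by (simp add: Int_commute)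
  have sT: "smooth_at JA e (?T g)" for g
    by (rule J.smooth_atI[OF box_open[OF S(1) X.openin_chart[OF d(1)]] pullback_t(1)[OF c(1) d(1) S jT] eb(1)])
  have sX: "smooth_at JA e (?X k)" for k
    by (rule J.smooth_atI[OF box_open[OF T.openin_chart[OF c(1)] R(1)] pullback_x(1)[OF c(1) d(1) R jX] eb(2)])
  have sp: "smooth_at JA e (pc c d k g)" for k g
    by (rule J.smooth_atI[OF J_open[OF c(1) d(1)] coords_smooth(3)[OF c(1) d(1)] e(1)])
  have vT: "?v (?T g) = 0" for g
    using pullback_t(2)[OF c(1) d(1) S jT eb(1), of "dir_p l a"] T.coord_field_zero[OF c(1) t(1)]
    by (simp add: par_p_def dir_p_def)
  have vX: "?v (?X k) = 0" for k
    using pullback_x(2)[OF c(1) d(1) R jX eb(2), of "dir_p l a"] X.coord_field_zero[OF d(1) x(1)]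
    by (simp add: par_p_def dir_p_def)
  have vp: "?v (pc c d k g) = kron k l * kron g a" for k g
    using coord_field_coords(3)[OF c(1) d(1) e(1), of "dir_p l a" k g]
    by (simp add: par_p_def dir_p_def axis_def kron_def)
  note sXT = J.smooth_at_mult[OF sX sT]
  have sXTp: "smooth_at JA e (\<lambda>e. ?X k e * ?T g e * pc c d k g e)" for k g
    by (rule J.smooth_at_mult[OF sXT sp])
  have vterm: "?v (\<lambda>e. ?X k e * ?T g e * pc c d k g e) = ?X k e * ?T g e * (kron k l * kron g a)" for k g
    using J.tangent_mult[OF v sXT sp, of k g k g] J.tangent_mult[OF v sX sT, of k g]
    by (simp add: vX vT vp)
  have bo: "J.open_in (box ?S ?R)" by (rule box_open[OF S(1) R(1)])
  \<comment> \<open>The transformation law holds on the common domain only, so the two functions are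
    exchanged by locality of the derivation.\<close>
  have "?v (pc c' d' j b) = ?v (\<lambda>e. \<Sum>k\<in>UNIV. \<Sum>g\<in>UNIV. ?X k e * ?T g e * pc c d k g e)"
  proof (rule J.tangent_cong[OF v bo eb(3)])
    fix e' assume e': "e' \<in> box ?S ?R"
    obtain t x p where ee: "e' = (t, x, p)" by (cases e')
    have "(t, x, p) \<in> dual_jet \<A> \<B>" "t \<in> fst c" "t \<in> fst c'" "x \<in> fst d" "x \<in> fst d'"
      using e' ee by (auto simp: box_def)
    from jet_transform[OF this(1) c d this(2-5)]
    show "pc c' d' j b e' = (\<Sum>k\<in>UNIV. \<Sum>g\<in>UNIV. ?X k e' * ?T g e' * pc c d k g e')"
      by (simp add: ee)
  qed
  also have "\<dots> = (\<Sum>k\<in>UNIV. \<Sum>g\<in>UNIV. ?X k e * ?T g e * (kron k l * kron g a))"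
  proof -
    have "smooth_at JA e (\<lambda>e. \<Sum>g\<in>UNIV. ?X k e * ?T g e * pc c d k g e)" for k
      using J.tangent_sum(1)[OF v, of UNIV "\<lambda>g e. ?X k e * ?T g e * pc c d k g e"] sXTp by simp
    moreover have "?v (\<lambda>e. \<Sum>g\<in>UNIV. ?X k e * ?T g e * pc c d k g e) =
        (\<Sum>g\<in>UNIV. ?v (\<lambda>e. ?X k e * ?T g e * pc c d k g e))" for k
      using J.tangent_sum(2)[OF v, of UNIV "\<lambda>g e. ?X k e * ?T g e * pc c d k g e"] sXTp by simp
    ultimately show ?thesis
      using J.tangent_sum(2)[OF v, of UNIV "\<lambda>k e. \<Sum>g\<in>UNIV. ?X k e * ?T g e * pc c d k g e"]
      by (simp add: vterm)
  qed
  also have "\<dots> = (\<Sum>k\<in>UNIV. (\<Sum>g\<in>UNIV. ?X k e * ?T g e * kron g a) * kron k l)"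
    by (simp only: sum_distrib_right sum_distrib_left mult_ac)
  also have "\<dots> = ?X l e * ?T a e" by simp
  finally show "?v (pc c' d' j b) = ?X l e * ?T a e" .
qed

text \<open>The fields \<open>hfield c d w F\<close> comprise the adapted basis: \<open>w\<close> is a coordinate direction and
  \<open>F\<close> a column of the nonlinear connection, or 0 for the vertical directions.\<close>

definition hfield :: "('t, real^'m) chart \<Rightarrow> ('x, real^'n) chart \<Rightarrow> ('m, 'n) jet_model \<Rightarrow>
    ('n \<Rightarrow> 'm \<Rightarrow> ('t, 'x, 'm, 'n) jet \<Rightarrow> real) \<Rightarrow> ('t, 'x, 'm, 'n) jet vfield" where
  "hfield c d w F = (\<lambda>e. coord_field JA (J c d) (w - (\<Sum>j\<in>UNIV. \<Sum>b\<in>UNIV. F j b e *\<^sub>R dir_p j b)) e)"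

lemma hfield_apply:
  assumes c: "c \<in> \<A>" and d: "d \<in> \<B>" and e: "e \<in> fst (J c d)"
  shows "hfield c d w F e g = coord_field JA (J c d) w e g -
    (\<Sum>j\<in>UNIV. \<Sum>b\<in>UNIV. F j b e * par_p \<A> \<B> c d j b e g)"
proof -
  interpret linear "\<lambda>w. coord_field JA (J c d) w e g" by (rule J.coord_field_linear[OF J_mem[OF c d] e])
  show ?thesis unfolding hfield_def by (simp only: diff sum scaleR par_p_def real_scaleR_def)
qed

lemma delta_t_hfield:
  assumes "c \<in> \<A>" "d \<in> \<B>" "e \<in> fst (J c d)"
  shows "delta_t \<A> \<B> N1 c d a e = hfield c d (dir_t a) (\<lambda>j b. N1 c d j b a) e"
  using hfield_apply[OF assms] by (simp add: delta_t_def par_t_def fun_eq_iff)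

lemma delta_x_hfield:
  assumes "c \<in> \<A>" "d \<in> \<B>" "e \<in> fst (J c d)"
  shows "delta_x \<A> \<B> N2 c d i e = hfield c d (dir_x i) (\<lambda>j b. N2 c d j b i) e"
  using hfield_apply[OF assms] by (simp add: delta_x_def par_x_def fun_eq_iff)

lemma par_p_hfield:
  assumes "c \<in> \<A>" "d \<in> \<B>" "e \<in> fst (J c d)"
  shows "par_p \<A> \<B> c d j b e = hfield c d (dir_p j b) (\<lambda>_ _ _. 0) e"
  using hfield_apply[OF assms] by (simp add: par_p_def fun_eq_iff)

lemma hfield_direction_smooth:
  assumes c: "c \<in> \<A>" and d: "d \<in> \<B>" and F: "\<And>j b. smooth_fun JA (fst (J c d)) (F j b)"
  shows "smooth_on (snd (J c d) ` fst (J c d))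
    (rep (J c d) (\<lambda>e. w - (\<Sum>j\<in>UNIV. \<Sum>b\<in>UNIV. F j b e *\<^sub>R dir_p j b)))"
proof -
  have op: "open (snd (J c d) ` fst (J c d))"
    by (rule J.openin_image_sub[OF J_open[OF c d] J_mem[OF c d] order_refl])
  have "smooth_on (snd (J c d) ` fst (J c d))
      (\<lambda>z. w - (\<Sum>j\<in>UNIV. \<Sum>b\<in>UNIV. rep (J c d) (F j b) z *\<^sub>R dir_p j b))"
    by (rule smooth_on_diff[OF op smooth_on_const], rule smooth_on_sum[OF op], rule smooth_on_sum[OF op],
        rule smooth_on_scaleR[OF op J.smooth_fun_chartD[OF J_mem[OF c d] order_refl F] smooth_on_const])
  then show ?thesis by (simp add: comp_def)
qed

lemma hfield_vf:
  assumes c: "c \<in> \<A>" and d: "d \<in> \<B>" and F: "\<And>j b. smooth_fun JA (fst (J c d)) (F j b)"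
  shows "hfield c d w F \<in> vector_fields JA (fst (J c d))"
  unfolding hfield_def
  by (rule J.coord_vf[OF J_mem[OF c d] J_open[OF c d] order_refl hfield_direction_smooth[OF c d F]])

lemma hfield_direction_derivative:
  assumes c: "c \<in> \<A>" and d: "d \<in> \<B>" and F: "\<And>j b. smooth_fun JA (fst (J c d)) (F j b)"
    and e: "e \<in> fst (J c d)"
  shows "frechet_derivative (rep (J c d) (\<lambda>e. w - (\<Sum>j\<in>UNIV. \<Sum>b\<in>UNIV. F j b e *\<^sub>R dir_p j b)))
      (at (snd (J c d) e)) u =
    - (\<Sum>j\<in>UNIV. \<Sum>b\<in>UNIV. coord_field JA (J c d) u e (F j b) *\<^sub>R dir_p j b)"
proof -
  have sm: "smooth_at JA e (F j b)" for j b by (rule J.smooth_atI[OF J_open[OF c d] F e])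
  have "((\<lambda>z. w - (\<Sum>j\<in>UNIV. \<Sum>b\<in>UNIV. rep (J c d) (F j b) z *\<^sub>R dir_p j b)) has_derivative
      (\<lambda>u. 0 - (\<Sum>j\<in>UNIV. \<Sum>b\<in>UNIV.
        frechet_derivative (rep (J c d) (F j b)) (at (snd (J c d) e)) u *\<^sub>R dir_p j b))) (at (snd (J c d) e))"
    by (rule has_derivative_diff[OF has_derivative_const], rule has_derivative_sum, rule has_derivative_sum,
        rule has_derivative_scaleR_left, rule J.rep_has_derivative[OF J_mem[OF c d] e sm])
  from frechet_derivative_at[OF this, symmetric] show ?thesis
    using sm by (simp add: comp_def J.coord_field_eq pd_def)
qed

text \<open>The coefficients of each field are differentiated along the other one. Since they enter
  \<open>hfield\<close> with a minus sign, the derivative of \<open>F\<close> along the second field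
  comes out positive.\<close>

lemma lie_bracket_hfield:
  assumes c: "c \<in> \<A>" and d: "d \<in> \<B>" and e: "e \<in> fst (J c d)"
    and F: "\<And>j b. smooth_fun JA (fst (J c d)) (F j b)" and F': "\<And>j b. smooth_fun JA (fst (J c d)) (F' j b)"
  shows "lie_bracket JA (hfield c d w F) (hfield c d w' F') e g =
    (\<Sum>r\<in>UNIV. \<Sum>f\<in>UNIV. (hfield c d w' F' e (F r f) - hfield c d w F e (F' r f)) * par_p \<A> \<B> c d r f e g)"
proof -
  interpret linear "\<lambda>w. coord_field JA (J c d) w e g" by (rule J.coord_field_linear[OF J_mem[OF c d] e])
  note br = J.lie_bracket_coord[OF J_mem[OF c d] J_open[OF c d] order_refl e
      hfield_direction_smooth[OF c d, of F w, OF F] hfield_direction_smooth[OF c d, of F' w', OF F'], of g]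
  show ?thesis
    unfolding hfield_def br hfield_direction_derivative[OF c d, of F, OF F e] hfield_direction_derivative[OF c d, of F', OF F' e]
    by (simp only: neg sum scaleR par_p_def real_scaleR_def left_diff_distrib sum_subtractf)
qed

lemma hfield_coords:
  assumes c: "c \<in> \<A>" and d: "d \<in> \<B>" and e: "e \<in> fst (J c d)"
  shows "hfield c d w F e (tc c a) = fst w $ a"
    and "hfield c d w F e (xc d i) = fst (snd w) $ i"
    and "hfield c d w F e (pc c d i a) = snd (snd w) $ i $ a - F i a e"
proof -
  have "(\<Sum>j\<in>UNIV. \<Sum>b\<in>UNIV. F j b e * (kron i j * kron a b)) = (\<Sum>j\<in>UNIV. (\<Sum>b\<in>UNIV. F j b e * kron a b) * kron i j)"
    by (simp only: sum_distrib_right sum_distrib_left mult_ac)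
  then have k: "(\<Sum>j\<in>UNIV. \<Sum>b\<in>UNIV. F j b e * (kron i j * kron a b)) = F i a e" by simp
  show "hfield c d w F e (tc c a) = fst w $ a" "hfield c d w F e (xc d i) = fst (snd w) $ i"
    unfolding hfield_apply[OF c d e] par_p_def coord_field_coords[OF c d e]
    by (simp_all add: dir_p_def)
  have "(axis j (axis b 1) :: real^'m^'n) $ i $ a = kron i j * kron a b" for j b
    by (simp add: axis_def kron_def)
  then show "hfield c d w F e (pc c d i a) = snd (snd w) $ i $ a - F i a e"
    unfolding hfield_apply[OF c d e] par_p_def coord_field_coords[OF c d e] using k
    by (simp add: dir_p_def)
qed

lemma par_p_vf: "c \<in> \<A> \<Longrightarrow> d \<in> \<B> \<Longrightarrow> par_p \<A> \<B> c d j b \<in> vector_fields JA (fst (J c d))"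
  by (rule J.vf_cong[OF hfield_vf par_p_hfield]) (auto intro: J.smooth_fun_const)

text \<open>A vertical field annihilates the base coordinates of every chart, so only fibre
  components remain in the new frame.\<close>

lemma par_p_change:
  assumes c: "c \<in> \<A>" "c' \<in> \<A>" and d: "d \<in> \<B>" "d' \<in> \<B>"
    and e: "e \<in> fst (J c d)" "e \<in> fst (J c' d')"
  shows "par_p \<A> \<B> c d l a e f = (\<Sum>j\<in>UNIV. \<Sum>b\<in>UNIV.
    jac d d' l j (fst (snd e)) * jac c' c b a (fst e) * par_p \<A> \<B> c' d' j b e f)"
proof -
  have "par_p \<A> \<B> c d l a e (tc c' g) = 0" "par_p \<A> \<B> c d l a e (xc d' k) = 0" for g k
    unfolding par_p_def coord_field_other_coords(1,2)[OF c d e] by (simp_all add: dir_p_def)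
  then show ?thesis
    using coord_field_frame_change[OF c d e, of "dir_p l a" f, folded par_p_def]
      coord_field_other_coords(3)[OF c d e] by simp
qed

end

section \<open>Adapted frames and coframes, and their transformation laws\<close>

locale nonlinear_bundle = jet_bundle \<A> \<B>
  for \<A> :: "('t, real^'m::finite) chart set" and \<B> :: "('x, real^'n::finite) chart set" +
  fixes N1 :: "('t, 'x, 'm, 'n) nlc1" and N2 :: "('t, 'x, 'm, 'n) nlc2"
  assumes nonlinear: "nonlinear_connection \<A> \<B> N1 N2"
begin

abbreviation "dt \<equiv> delta_t \<A> \<B> N1"
abbreviation "dx \<equiv> delta_x \<A> \<B> N2"
abbreviation "dp \<equiv> par_p \<A> \<B>"
abbreviation "co \<equiv> co_p N1 N2"

lemma N_smooth:
  assumes "c \<in> \<A>" "d \<in> \<B>"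
  shows "smooth_fun JA (fst (J c d)) (N1 c d i a b)" "smooth_fun JA (fst (J c d)) (N2 c d i a j)"
  using nonlinear assms unfolding nonlinear_connection_def by blast+

lemma N_change:
  assumes "c \<in> \<A>" "c' \<in> \<A>" "d \<in> \<B>" "d' \<in> \<B>" "e \<in> fst (J c d)" "e \<in> fst (J c' d')"
  shows "(\<Sum>g\<in>UNIV. N1 c' d' j b g e * jac c' c g a (fst e)) =
      (\<Sum>k\<in>UNIV. \<Sum>g\<in>UNIV. N1 c d k g a e * jac c' c b g (fst e) * jac d d' k j (fst (snd e)))
      - pd (J c d) (dir_t a) (pc c' d' j b) e" (is ?N1)
    and "(\<Sum>k\<in>UNIV. N2 c' d' j b k e * jac d' d k i (fst (snd e))) =
      (\<Sum>k\<in>UNIV. \<Sum>g\<in>UNIV. N2 c d k g i e * jac c' c b g (fst e) * jac d d' k j (fst (snd e)))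
      - pd (J c d) (dir_x i) (pc c' d' j b) e" (is ?N2)
proof -
  obtain t x p where e: "e = (t, x, p)" by (cases e)
  have "(t, x, p) \<in> fst (J c d) \<inter> fst (J c' d')" using assms e by simp
  from nonlinear[unfolded nonlinear_connection_def, THEN conjunct2, THEN bspec, OF assms(1), THEN bspec, OF assms(2),
      THEN bspec, OF assms(3), THEN bspec, OF assms(4), THEN spec, THEN spec, THEN spec, THEN mp, OF this]
  show ?N1 and ?N2
    unfolding e by simp_all
qed

lemma delta_t_vf: "c \<in> \<A> \<Longrightarrow> d \<in> \<B> \<Longrightarrow> dt c d a \<in> vector_fields JA (fst (J c d))"
  by (rule J.vf_cong[OF hfield_vf delta_t_hfield]) (auto intro: N_smooth)

lemma delta_x_vf: "c \<in> \<A> \<Longrightarrow> d \<in> \<B> \<Longrightarrow> dx c d i \<in> vector_fields JA (fst (J c d))"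
  by (rule J.vf_cong[OF hfield_vf delta_x_hfield]) (auto intro: N_smooth)

lemma co_delta_t:
  assumes "c \<in> \<A>" "d \<in> \<B>" "e \<in> fst (J c d)"
  shows "co_t c a (dt c d b e) = kron a b" "co_x d i (dt c d b e) = 0" "co c d i a e (dt c d b e) = 0"
proof -
  show 1: "co_t c a (dt c d b e) = kron a b" for a
    unfolding co_t_def delta_t_hfield[OF assms] hfield_coords[OF assms] by (simp add: dir_t_def axis_def kron_def)
  show 2: "co_x d i (dt c d b e) = 0" for i
    unfolding co_x_def delta_t_hfield[OF assms] hfield_coords[OF assms] by (simp add: dir_t_def)
  \<comment> \<open>The fibre coordinate contributes \<open>- N1 c d i a b e\<close>, which is
    compensated by the \<open>N1\<close> part of \<open>co_p\<close>.\<close>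
  show "co c d i a e (dt c d b e) = 0"
    unfolding co_p_def 1 2 unfolding delta_t_hfield[OF assms] hfield_coords[OF assms] by (simp add: dir_t_def)
qed

lemma co_delta_x:
  assumes "c \<in> \<A>" "d \<in> \<B>" "e \<in> fst (J c d)"
  shows "co_t c a (dx c d j e) = 0" "co_x d i (dx c d j e) = kron i j" "co c d i a e (dx c d j e) = 0"
proof -
  show 1: "co_t c a (dx c d j e) = 0" for a
    unfolding co_t_def delta_x_hfield[OF assms] hfield_coords[OF assms] by (simp add: dir_x_def)
  show 2: "co_x d i (dx c d j e) = kron i j" for i
    unfolding co_x_def delta_x_hfield[OF assms] hfield_coords[OF assms] by (simp add: dir_x_def axis_def kron_def)
  show "co c d i a e (dx c d j e) = 0"
    unfolding co_p_def 1 2 unfolding delta_x_hfield[OF assms] hfield_coords[OF assms] by (simp add: dir_x_def)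
qed

lemma co_par_p:
  assumes "c \<in> \<A>" "d \<in> \<B>" "e \<in> fst (J c d)"
  shows "co_t c a (dp c d j b e) = 0" "co_x d i (dp c d j b e) = 0"
    "co c d i a e (dp c d j b e) = kron i j * kron a b"
proof -
  show 1: "co_t c a (dp c d j b e) = 0" for a
    unfolding co_t_def par_p_hfield[OF assms] hfield_coords[OF assms] by (simp add: dir_p_def)
  show 2: "co_x d i (dp c d j b e) = 0" for i
    unfolding co_x_def par_p_hfield[OF assms] hfield_coords[OF assms] by (simp add: dir_p_def)
  show "co c d i a e (dp c d j b e) = kron i j * kron a b"
    unfolding co_p_def 1 2 unfolding par_p_hfield[OF assms] hfield_coords[OF assms]
    by (simp add: dir_p_def axis_def kron_def)
qed

text \<open>The inhomogeneous term \<open>p\<close> in the law of the nonlinear connection cancels the vertical part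
  which the coordinate field \<open>\<Sum>z. \<kappa> z * Q z + \<dots>\<close> acquires in the new frame.\<close>

lemma adapted_change:
  assumes c: "c \<in> \<A>" "c' \<in> \<A>" and d: "d \<in> \<B>" "d' \<in> \<B>"
    and e: "e \<in> fst (J c d)" "e \<in> fst (J c' d')"
    and F: "\<And>j b. (\<Sum>z\<in>Z. F' j b z * \<kappa> z) =
      (\<Sum>k\<in>UNIV. \<Sum>g\<in>UNIV. F k g * jac c' c b g (fst e) * jac d d' k j (fst (snd e))) - p j b"
  shows "(\<Sum>z\<in>Z. \<kappa> z * Q z) + (\<Sum>j\<in>UNIV. \<Sum>b\<in>UNIV. p j b * dp c' d' j b e f)
      - (\<Sum>k\<in>UNIV. \<Sum>g\<in>UNIV. F k g * dp c d k g e f) =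
    (\<Sum>z\<in>Z. \<kappa> z * (Q z - (\<Sum>j\<in>UNIV. \<Sum>b\<in>UNIV. F' j b z * dp c' d' j b e f)))"
proof -
  let ?P = "\<lambda>j b. dp c' d' j b e f"
  let ?t = "\<lambda>j b k g. F k g * jac c' c b g (fst e) * jac d d' k j (fst (snd e))"
  have "(\<Sum>k\<in>UNIV. \<Sum>g\<in>UNIV. F k g * dp c d k g e f) =
     (\<Sum>k\<in>UNIV. \<Sum>g\<in>UNIV. \<Sum>j\<in>UNIV. \<Sum>b\<in>UNIV. ?t j b k g * ?P j b)"
    by (simp add: par_p_change[OF c d e] sum_distrib_left mult_ac)
  also have "\<dots> = (\<Sum>k\<in>UNIV. \<Sum>j\<in>UNIV. \<Sum>b\<in>UNIV. \<Sum>g\<in>UNIV. ?t j b k g * ?P j b)"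
    by (rule sum.cong[OF refl], rule sum_swap3)
  also have "\<dots> = (\<Sum>j\<in>UNIV. \<Sum>b\<in>UNIV. \<Sum>k\<in>UNIV. \<Sum>g\<in>UNIV. ?t j b k g * ?P j b)"
    by (rule sum_swap3)
  finally have 1: "(\<Sum>k\<in>UNIV. \<Sum>g\<in>UNIV. F k g * dp c d k g e f) =
      (\<Sum>j\<in>UNIV. \<Sum>b\<in>UNIV. (\<Sum>k\<in>UNIV. \<Sum>g\<in>UNIV. ?t j b k g) * ?P j b)"
    by (simp only: sum_distrib_right)
  have "(\<Sum>z\<in>Z. \<kappa> z * (\<Sum>j\<in>UNIV. \<Sum>b\<in>UNIV. F' j b z * ?P j b)) =
    (\<Sum>z\<in>Z. \<Sum>j\<in>UNIV. \<Sum>b\<in>UNIV. F' j b z * \<kappa> z * ?P j b)"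
    by (simp add: sum_distrib_left mult_ac)
  also have "\<dots> = (\<Sum>j\<in>UNIV. \<Sum>b\<in>UNIV. \<Sum>z\<in>Z. F' j b z * \<kappa> z * ?P j b)"
    by (rule sum_swap3)
  finally have 2: "(\<Sum>z\<in>Z. \<kappa> z * (\<Sum>j\<in>UNIV. \<Sum>b\<in>UNIV. F' j b z * ?P j b)) =
      (\<Sum>j\<in>UNIV. \<Sum>b\<in>UNIV. (\<Sum>z\<in>Z. F' j b z * \<kappa> z) * ?P j b)"
    by (simp only: sum_distrib_right)
  show ?thesis
    unfolding 1 right_diff_distrib sum_subtractf 2 F by (simp add: left_diff_distrib sum_subtractf)
qed

lemma delta_t_change:
  assumes c: "c \<in> \<A>" "c' \<in> \<A>" and d: "d \<in> \<B>" "d' \<in> \<B>"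
    and e: "e \<in> fst (J c d)" "e \<in> fst (J c' d')"
  shows "dt c d a e f = (\<Sum>g\<in>UNIV. jac c' c g a (fst e) * dt c' d' g e f)"
proof -
  let ?jt = "\<lambda>b g. jac c' c b g (fst e)"
  let ?P = "\<lambda>j b. dp c' d' j b e f"
  let ?p = "\<lambda>j b. pd (J c d) (dir_t a) (pc c' d' j b) e"
  have kr: "(\<Sum>i\<in>UNIV. axis a 1 $ i * h i) = (h a :: real)" for h
    by (simp add: axis_def if_distrib[of "\<lambda>x. x * _"] cong: if_cong)
  have co1: "par_t \<A> \<B> c d a e (tc c' g) = ?jt g a" "par_t \<A> \<B> c d a e (xc d' k) = 0" for g k
    unfolding par_t_def coord_field_other_coords(1,2)[OF c d e] by (simp_all add: dir_t_def kr)
  have pd: "par_t \<A> \<B> c d a e (pc c' d' j b) = ?p j b" for j b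
    using J.smooth_atI[OF J_open[OF c(2) d(2)] coords_smooth(3)[OF c(2) d(2)] e(2)]
    by (simp add: J.coord_field_eq par_t_def)
  have 1: "par_t \<A> \<B> c d a e f = (\<Sum>g\<in>UNIV. ?jt g a * par_t \<A> \<B> c' d' g e f) +
      (\<Sum>j\<in>UNIV. \<Sum>b\<in>UNIV. ?p j b * ?P j b)"
    using coord_field_frame_change[OF c d e, of "dir_t a" f, folded par_t_def] co1 pd by simp
  \<comment> \<open>Here \<open>\<kappa>\<close> is a column of temporal Jacobians and
    \<open>Q\<close> the temporal coordinate frame; the condition on \<open>F'\<close> is the law of
    the nonlinear connection.\<close>
  show ?thesis
    unfolding delta_t_def 1 by (rule adapted_change[OF c d e]) (simp only: N_change(1)[OF c d e])
qed

lemma delta_x_change: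
  assumes c: "c \<in> \<A>" "c' \<in> \<A>" and d: "d \<in> \<B>" "d' \<in> \<B>"
    and e: "e \<in> fst (J c d)" "e \<in> fst (J c' d')"
  shows "dx c d i e f = (\<Sum>k\<in>UNIV. jac d' d k i (fst (snd e)) * dx c' d' k e f)"
proof -
  let ?j = "\<lambda>k i. jac d' d k i (fst (snd e))"
  let ?P = "\<lambda>j b. dp c' d' j b e f"
  let ?p = "\<lambda>j b. pd (J c d) (dir_x i) (pc c' d' j b) e"
  have kr: "(\<Sum>k\<in>UNIV. axis i 1 $ k * h k) = (h i :: real)" for h
    by (simp add: axis_def if_distrib[of "\<lambda>x. x * _"] cong: if_cong)
  have co1: "par_x \<A> \<B> c d i e (tc c' g) = 0" "par_x \<A> \<B> c d i e (xc d' k) = ?j k i" for g k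
    unfolding par_x_def coord_field_other_coords(1,2)[OF c d e] by (simp_all add: dir_x_def kr)
  have pd: "par_x \<A> \<B> c d i e (pc c' d' j b) = ?p j b" for j b
    using J.smooth_atI[OF J_open[OF c(2) d(2)] coords_smooth(3)[OF c(2) d(2)] e(2)]
    by (simp add: J.coord_field_eq par_x_def)
  have 1: "par_x \<A> \<B> c d i e f = (\<Sum>k\<in>UNIV. ?j k i * par_x \<A> \<B> c' d' k e f) +
      (\<Sum>j\<in>UNIV. \<Sum>b\<in>UNIV. ?p j b * ?P j b)"
    using coord_field_frame_change[OF c d e, of "dir_x i" f, folded par_x_def] co1 pd by simp
  show ?thesis
    unfolding delta_x_def 1 by (rule adapted_change[OF c d e]) (simp only: N_change(2)[OF c d e])
qed

end

section \<open>The torsion of an h-normal connection\<close>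

lemma sum_lists_0: "(\<Sum>as | length as = 0. F as) = (F [] :: real)"
  by simp

text \<open>Splitting off the head turns the list-indexed sums of \<open>d_tensor\<close> into
  iterated sums over single indices.\<close>

lemma sum_lists_Suc:
  fixes F :: "'k::finite list \<Rightarrow> real"
  shows "(\<Sum>as | length as = Suc n. F as) = (\<Sum>a\<in>UNIV. \<Sum>as | length as = n. F (a # as))"
proof -
  have "(\<Sum>a\<in>UNIV. \<Sum>as | length as = n. F (a # as)) = (\<Sum>(a, as)\<in>UNIV \<times> {as. length as = n}. F (a # as))"
    by (rule sum.cartesian_product)
  also have "\<dots> = (\<Sum>as | length as = Suc n. F as)"
    by (rule sum.reindex_bij_witness[of _ "\<lambda>as. (hd as, tl as)" "\<lambda>(a, as). a # as"])
      (auto simp: length_Suc_conv)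
  finally show ?thesis by simp
qed

text \<open>The numerals that give the list lengths are put into successor form so that the
  recursion applies.\<close>

lemmas sum_lists = sum_lists_0 sum_lists_Suc numeral_2_eq_2 numeral_3_eq_3 One_nat_def

lemma sum_if_const: "(\<Sum>k\<in>I. if P then g k else 0) = (if P then \<Sum>k\<in>I. g k else (0::real))"
  by simp

locale h_normal_bundle = nonlinear_bundle \<A> \<B> N1 N2
  for \<A> :: "('t, real^'m::finite) chart set" and \<B> :: "('x, real^'n::finite) chart set"
    and N1 :: "('t, 'x, 'm, 'n) nlc1" and N2 :: "('t, 'x, 'm, 'n) nlc2" +
  fixes h :: "('t, real^'m) chart \<Rightarrow> 't \<Rightarrow> real^'m^'m" and D :: "('t, 'x, 'm, 'n) jet_connection"
  assumes metric: "semi_riemannian_metric \<A> h" and h_normal: "h_normal \<A> \<B> N1 N2 h D"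
begin

lemma linear_D: "linear_connection JA D"
  using h_normal unfolding h_normal_def N_linear_def by blast

lemma local_D: "local_operator JA D"
  using linear_D unfolding linear_connection_def by blast

lemma h_normal_temporal:
  assumes "c \<in> \<A>" "d \<in> \<B>" "e \<in> fst (J c d)"
  shows "A_t \<A> \<B> N1 D c d a b g e = christoffel h c a b g (fst e)"
    and "H_t \<A> \<B> N1 N2 D c d a b i e = 0" and "C_t \<A> \<B> N1 D c d a b i g e = 0"
  using h_normal[unfolded h_normal_def, THEN conjunct2, THEN conjunct1] assms by blast+

lemma D_proj:
  assumes c: "c \<in> \<A>" and d: "d \<in> \<B>" and e: "e \<in> fst (J c d)"
    and X: "X \<in> vector_fields JA (fst (J c d))" and Y: "Y \<in> vector_fields JA (fst (J c d))"
  shows "D X (proj_t \<A> \<B> N1 c d Y) e = proj_t \<A> \<B> N1 c d (D X Y) e" (is ?t)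
    and "D X (proj_x \<A> \<B> N2 c d Y) e = proj_x \<A> \<B> N2 c d (D X Y) e" (is ?x)
    and "D X (proj_v \<A> \<B> N1 N2 c d Y) e = proj_v \<A> \<B> N1 N2 c d (D X Y) e" (is ?v)
proof -
  have "N_linear \<A> \<B> N1 N2 D" using h_normal unfolding h_normal_def by blast
  then have "J.open_in W \<and> W \<subseteq> fst (J c d) \<and> {X, Y} \<subseteq> vector_fields JA W \<and> e \<in> W \<longrightarrow> ?t \<and> ?x \<and> ?v" for W
    using c d unfolding N_linear_def by blast
  from this[of "fst (J c d)"] show ?t ?x ?v using J_open[OF c d] X Y e by simp_all
qed

text \<open>Since \<open>D\<close> commutes with the projections, covariant derivatives of an adapted basis field
  stay in its span.\<close>

lemma D_adapted:
  assumes c: "c \<in> \<A>" and d: "d \<in> \<B>" and e: "e \<in> fst (J c d)" and X: "X \<in> vector_fields JA (fst (J c d))"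
  shows "D X (dt c d a) e g = (\<Sum>b\<in>UNIV. co_t c b (D X (dt c d a) e) * dt c d b e g)"
    and "D X (dx c d i) e g = (\<Sum>r\<in>UNIV. co_x d r (D X (dx c d i) e) * dx c d r e g)"
    and "D X (dp c d i a) e g = (\<Sum>r\<in>UNIV. \<Sum>f\<in>UNIV. co c d r f e (D X (dp c d i a) e) * dp c d r f e g)"
proof -
  note loc = J.local_operatorD(2)[OF local_D J_open[OF c d] X]
  \<comment> \<open>The projection fixes the basis field only over the chart domain; there locality
    of \<open>D\<close> allows dropping it.\<close>
  have "D X (proj_t \<A> \<B> N1 c d (dt c d a)) e = D X (dt c d a) e"
    by (rule loc[OF delta_t_vf[OF c d] refl _ e]) (simp add: proj_t_def co_delta_t[OF c d] fun_eq_iff)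
  then show "D X (dt c d a) e g = (\<Sum>b\<in>UNIV. co_t c b (D X (dt c d a) e) * dt c d b e g)"
    using D_proj(1)[OF c d e X delta_t_vf[OF c d], of a] by (simp add: proj_t_def fun_eq_iff)
  have "D X (proj_x \<A> \<B> N2 c d (dx c d i)) e = D X (dx c d i) e"
    by (rule loc[OF delta_x_vf[OF c d] refl _ e]) (simp add: proj_x_def co_delta_x[OF c d] fun_eq_iff)
  then show "D X (dx c d i) e g = (\<Sum>r\<in>UNIV. co_x d r (D X (dx c d i) e) * dx c d r e g)"
    using D_proj(2)[OF c d e X delta_x_vf[OF c d], of i] by (simp add: proj_x_def fun_eq_iff)
  have "proj_v \<A> \<B> N1 N2 c d (dp c d i a) e' = dp c d i a e'" if e': "e' \<in> fst (J c d)" for e'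
  proof
    fix g
    have "(\<Sum>r\<in>UNIV. \<Sum>f\<in>UNIV. kron r i * kron f a * dp c d r f e' g) =
       (\<Sum>r\<in>UNIV. kron r i * (\<Sum>f\<in>UNIV. kron f a * dp c d r f e' g))"
      by (simp only: sum_distrib_left mult.assoc)
    then show "proj_v \<A> \<B> N1 N2 c d (dp c d i a) e' g = dp c d i a e' g"
      by (simp add: proj_v_def co_par_p[OF c d e'])
  qed
  then have "D X (proj_v \<A> \<B> N1 N2 c d (dp c d i a)) e = D X (dp c d i a) e"
    by (intro loc[OF par_p_vf[OF c d] refl _ e])
  then show "D X (dp c d i a) e g = (\<Sum>r\<in>UNIV. \<Sum>f\<in>UNIV. co c d r f e (D X (dp c d i a) e) * dp c d r f e g)"
    using D_proj(3)[OF c d e X par_p_vf[OF c d], of i a] by (simp add: proj_v_def fun_eq_iff)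
qed

section \<open>The metric and the vertical coefficients of the connection\<close>

lemma JJ_eq: "JJ N1 N2 h c d X Y Z e =
    (\<Sum>a\<in>UNIV. \<Sum>b\<in>UNIV. \<Sum>i\<in>UNIV. h c (fst e) $ a $ b * co c d i a e (X e) * co_t c b (Y e) * co_x d i (Z e))"
proof -
  have "(\<Sum>j\<in>UNIV. H * kron i j * p * t * x j) = H * p * t * x i" for H p t :: real and x :: "'n \<Rightarrow> real" and i
  proof -
    have "(\<Sum>j\<in>UNIV. H * kron i j * p * t * x j) = (\<Sum>j\<in>UNIV. kron i j * (H * p * t * x j))"
      by (simp only: mult_ac)
    then show ?thesis by simp
  qed
  then show ?thesis unfolding JJ_def by simp
qed

text \<open>Two slots hold basis fields and the third is left free, because each term of the
  covariant derivative of J, apart from the one that differentiates the value, puts a covariant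
  derivative into one slot.\<close>

lemma JJ_adapted:
  assumes c: "c \<in> \<A>" and d: "d \<in> \<B>" and e: "e \<in> fst (J c d)"
  shows "JJ N1 N2 h c d X (dt c d f) (dx c d r) e = (\<Sum>a\<in>UNIV. h c (fst e) $ a $ f * co c d r a e (X e))"
    and "JJ N1 N2 h c d (dp c d j b) Y (dx c d r) e = kron j r * (\<Sum>a\<in>UNIV. h c (fst e) $ b $ a * co_t c a (Y e))"
    and "JJ N1 N2 h c d (dp c d j b) (dt c d f) Z e = h c (fst e) $ b $ f * co_x d j (Z e)"
  unfolding JJ_eq co_delta_t[OF c d e] co_delta_x[OF c d e] co_par_p[OF c d e]
  by (simp_all add: kron_def mult_delta_left mult_delta_right sum_if_const)

lemma metric_smooth: "c \<in> \<A> \<Longrightarrow> smooth_fun \<A> (fst c) (\<lambda>t. h c t $ a $ b)"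
  using metric unfolding semi_riemannian_metric_def by blast

lemma metric_sym:
  assumes "c \<in> \<A>" "t \<in> fst c"
  shows "h c t $ a $ b = h c t $ b $ a"
proof -
  have "transpose (h c t) = h c t" using metric assms unfolding semi_riemannian_metric_def by blast
  then have "transpose (h c t) $ a $ b = h c t $ a $ b" by simp
  then show ?thesis by (simp add: transpose_def)
qed

lemma metric_inverse:
  assumes "c \<in> \<A>" "t \<in> fst c"
  shows "(\<Sum>f\<in>UNIV. h c t $ a $ f * matrix_inv (h c t) $ f $ b) = kron a b"
proof -
  have "invertible (h c t)" using metric assms unfolding semi_riemannian_metric_def by blast
  then have "h c t ** matrix_inv (h c t) = mat 1 \<and> matrix_inv (h c t) ** h c t = mat 1"
    unfolding invertible_def matrix_inv_def by (rule someI_ex)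
  then have "(h c t ** matrix_inv (h c t)) $ a $ b = mat 1 $ a $ b" by simp
  then show ?thesis by (simp add: matrix_matrix_mult_def mat_def kron_def)
qed

text \<open>Contraction with the nondegenerate matrix is undone by contracting further with its
  inverse.\<close>

lemma metric_cancel:
  assumes c: "c \<in> \<A>" and t: "t \<in> fst c"
    and eq: "\<And>f. (\<Sum>a\<in>UNIV. h c t $ a $ f * u a) = (\<Sum>a\<in>UNIV. h c t $ a $ f * v a)"
  shows "u a = v a"
proof -
  have "(\<Sum>f\<in>UNIV. matrix_inv (h c t) $ f $ k * (\<Sum>a\<in>UNIV. h c t $ a $ f * w a)) = w k" for w :: "'m \<Rightarrow> real" and k
  proof -
    have "(\<Sum>f\<in>UNIV. matrix_inv (h c t) $ f $ k * (\<Sum>a\<in>UNIV. h c t $ a $ f * w a)) =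
        (\<Sum>a\<in>UNIV. \<Sum>f\<in>UNIV. h c t $ a $ f * matrix_inv (h c t) $ f $ k * w a)"
      unfolding sum_distrib_left by (subst sum.swap) (simp only: mult_ac)
    also have "\<dots> = (\<Sum>a\<in>UNIV. kron a k * w a)"
      by (simp only: sum_distrib_right[symmetric] metric_inverse[OF c t])
    finally show ?thesis by simp
  qed
  from this[of a u] this[of a v] show ?thesis by (simp only: eq)
qed

lemma metric_derivative_sym:
  assumes "c \<in> \<A>" "t \<in> fst c"
  shows "pd c w (\<lambda>s. h c s $ a $ b) t = pd c w (\<lambda>s. h c s $ b $ a) t"
  by (rule T.pd_cong[OF assms(1) T.openin_chart[OF assms(1)] order_refl assms(2)]) (rule metric_sym[OF assms(1)])

lemma christoffel_sym:
  assumes "c \<in> \<A>" "t \<in> fst c"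
  shows "christoffel h c a b g t = christoffel h c a g b t"
  unfolding christoffel_def
proof (rule sum.cong[OF refl])
  fix f
  show "matrix_inv (h c t) $ a $ f / 2 * (pd c (axis b 1) (\<lambda>s. h c s $ f $ g) t +
        pd c (axis g 1) (\<lambda>s. h c s $ b $ f) t - pd c (axis f 1) (\<lambda>s. h c s $ b $ g) t) =
      matrix_inv (h c t) $ a $ f / 2 * (pd c (axis g 1) (\<lambda>s. h c s $ f $ b) t +
        pd c (axis b 1) (\<lambda>s. h c s $ g $ f) t - pd c (axis f 1) (\<lambda>s. h c s $ g $ b) t)"
    using metric_derivative_sym[OF assms, of "axis b 1" f g] metric_derivative_sym[OF assms, of "axis g 1" b f]
      metric_derivative_sym[OF assms, of "axis f 1" b g] by simp
qed

text \<open>These are the Christoffel symbols of the first kind: lowering the upper index removes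
  the inverse metric from the definition.\<close>

lemma christoffel_lower:
  assumes c: "c \<in> \<A>" and t: "t \<in> fst c"
  shows "(\<Sum>a\<in>UNIV. h c t $ k $ a * christoffel h c a b g t) =
    (pd c (axis b 1) (\<lambda>s. h c s $ k $ g) t + pd c (axis g 1) (\<lambda>s. h c s $ b $ k) t
      - pd c (axis k 1) (\<lambda>s. h c s $ b $ g) t) / 2"
proof -
  define w where "w f = pd c (axis b 1) (\<lambda>s. h c s $ f $ g) t + pd c (axis g 1) (\<lambda>s. h c s $ b $ f) t
      - pd c (axis f 1) (\<lambda>s. h c s $ b $ g) t" for f
  have "(\<Sum>a\<in>UNIV. h c t $ k $ a * christoffel h c a b g t) =
      (\<Sum>a\<in>UNIV. \<Sum>f\<in>UNIV. h c t $ k $ a * matrix_inv (h c t) $ a $ f * (w f / 2))"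
    unfolding christoffel_def w_def[symmetric] sum_distrib_left by (simp add: mult_ac)
  also have "\<dots> = (\<Sum>f\<in>UNIV. kron k f * (w f / 2))"
    by (subst sum.swap) (simp only: sum_distrib_right[symmetric] metric_inverse[OF c t])
  also have "\<dots> = w k / 2" by (rule sum_kron(1))
  finally show ?thesis unfolding w_def .
qed

text \<open>The metric has vanishing covariant derivative, here solved for one of the two
  Christoffel terms. In the sum of the two first-kind symbols the derivatives in the directions
  \<open>b\<close> and \<open>f\<close> cancel, and the two halves in the direction \<open>g\<close>
  add up.\<close>

lemma metric_compatible:
  assumes c: "c \<in> \<A>" and t: "t \<in> fst c"
  shows "pd c (axis g 1) (\<lambda>s. h c s $ b $ f) t - (\<Sum>a\<in>UNIV. h c t $ b $ a * christoffel h c a f g t) =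
    (\<Sum>a\<in>UNIV. h c t $ a $ f * christoffel h c a b g t)"
proof -
  have "(\<Sum>a\<in>UNIV. h c t $ a $ f * christoffel h c a b g t) = (\<Sum>a\<in>UNIV. h c t $ f $ a * christoffel h c a b g t)"
    using metric_sym[OF c t] by simp
  then show ?thesis
    unfolding christoffel_lower[OF c t]
    using metric_derivative_sym[OF c t, of "axis g 1" b f] metric_derivative_sym[OF c t, of "axis f 1" b g]
      metric_derivative_sym[OF c t, of "axis b 1" f g]
    by (simp add: field_simps)
qed

text \<open>The vanishing of the covariant derivative of J on the triple \<open>dp c d j b\<close>,
  \<open>dt c d f\<close>, \<open>dx c d r\<close>, solved for the term with the derivative of the
  vertical field. On the right only horizontal coefficients of \<open>D\<close> and a derivative of
  the metric remain.\<close>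

lemma DJ:
  assumes c: "c \<in> \<A>" and d: "d \<in> \<B>" and e: "e \<in> fst (J c d)" and V: "V \<in> vector_fields JA (fst (J c d))"
  shows "(\<Sum>a\<in>UNIV. h c (fst e) $ a $ f * co c d r a e (D V (dp c d j b) e)) =
    kron j r * (V e (\<lambda>e. h c (fst e) $ b $ f) - (\<Sum>a\<in>UNIV. h c (fst e) $ b $ a * co_t c a (D V (dt c d f) e)))
    - h c (fst e) $ b $ f * co_x d j (D V (dx c d r) e)"
proof -
  let ?J = "JJ N1 N2 h c d" and ?W = "fst (J c d)"
  have "J.open_in W \<and> W \<subseteq> fst (J c d) \<and> {V, X, Y, Z} \<subseteq> vector_fields JA W \<and> e \<in> W \<longrightarrow>
      V e (?J X Y Z) - ?J (D V X) Y Z e - ?J X (D V Y) Z e - ?J X Y (D V Z) e = 0" for W X Y Z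
    using h_normal[unfolded h_normal_def, THEN conjunct2, THEN conjunct2, THEN bspec, OF c, THEN bspec, OF d] by blast
  from this[of ?W "dp c d j b" "dt c d f" "dx c d r"]
  have 1: "V e (?J (dp c d j b) (dt c d f) (dx c d r)) - ?J (D V (dp c d j b)) (dt c d f) (dx c d r) e -
      ?J (dp c d j b) (D V (dt c d f)) (dx c d r) e - ?J (dp c d j b) (dt c d f) (D V (dx c d r)) e = 0"
    using J_open[OF c d] V par_p_vf[OF c d] delta_t_vf[OF c d] delta_x_vf[OF c d] e by simp
  have Ve: "V e \<in> tangent_space JA e" by (rule J.vf_tangent[OF V e])
  have "box (fst c) (fst d) = ?W" by (simp add: jet_chart_dom)
  then have sm: "smooth_at JA e (\<lambda>e. h c (fst e) $ b $ f)"
    using J.smooth_atI[OF J_open[OF c d] _ e] pullback_t(1)[OF c d T.openin_chart[OF c] order_refl metric_smooth[OF c]]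
    by simp
  \<comment> \<open>Throughout the chart domain J is, on this triple, a fixed Kronecker delta times
    a metric component, so \<open>V\<close> differentiates the metric only.\<close>
  have "V e (?J (dp c d j b) (dt c d f) (dx c d r)) = V e (\<lambda>e. kron j r * (h c (fst e) $ b $ f))"
    by (rule J.tangent_cong[OF Ve J_open[OF c d] e]) (simp add: JJ_adapted(3)[OF c d] co_delta_x[OF c d])
  also have "\<dots> = kron j r * V e (\<lambda>e. h c (fst e) $ b $ f)"
    by (rule J.tangent_cmult[OF Ve sm])
  finally show ?thesis
    using 1 unfolding JJ_adapted[OF c d e] by (simp add: algebra_simps)
qed

text \<open>The metric is a function of \<open>t\<close> alone, so only the temporal adapted fields
  see it; their correction by the nonlinear connection is vertical and contributes nothing.\<close>

lemma metric_derivatives: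
  assumes c: "c \<in> \<A>" and d: "d \<in> \<B>" and e: "e \<in> fst (J c d)"
  shows "dp c d i a e (\<lambda>e. h c (fst e) $ b $ f) = 0"
    and "dt c d g e (\<lambda>e. h c (fst e) $ b $ f) = pd c (axis g 1) (\<lambda>s. h c s $ b $ f) (fst e)"
    and "dx c d k e (\<lambda>e. h c (fst e) $ b $ f) = 0"
proof -
  have t: "fst e \<in> fst c" and eb: "e \<in> box (fst c) (fst d)" using e by (auto simp: jet_chart_dom box_def)
  have cf: "coord_field JA (J c d) w e (\<lambda>e. h c (fst e) $ b $ f) = coord_field \<A> c (fst w) (fst e) (\<lambda>s. h c s $ b $ f)" for w
    by (rule pullback_t(2)[OF c d T.openin_chart[OF c] order_refl metric_smooth[OF c] eb])
  show 1: "dp c d i a e (\<lambda>e. h c (fst e) $ b $ f) = 0" for i a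
    using T.coord_field_zero[OF c t] by (simp add: par_p_def cf dir_p_def)
  show "dt c d g e (\<lambda>e. h c (fst e) $ b $ f) = pd c (axis g 1) (\<lambda>s. h c s $ b $ f) (fst e)"
    using T.smooth_atI[OF T.openin_chart[OF c] metric_smooth[OF c] t]
    by (simp add: delta_t_def 1 par_t_def cf dir_t_def T.coord_field_eq)
  show "dx c d k e (\<lambda>e. h c (fst e) $ b $ f) = 0"
    using T.coord_field_zero[OF c t] by (simp add: delta_x_def 1 par_x_def cf dir_x_def)
qed

text \<open>The metric is cancelled from \<open>DJ\<close>. In temporal directions
  \<open>metric_compatible\<close> turns the derivative of the metric minus one Christoffel term
  into the other Christoffel term, whose upper index is contracted in the position needed for
  cancelling. In the remaining directions the derivative of the metric vanishes, and so do
  \<open>H_t\<close> and \<open>C_t\<close>.\<close>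

lemma D_vertical:
  assumes c: "c \<in> \<A>" and d: "d \<in> \<B>" and e: "e \<in> fst (J c d)"
  shows "co c d r f e (D (dt c d g) (dp c d j b) e) =
      kron r j * christoffel h c f b g (fst e) - kron b f * A_x \<A> \<B> N1 N2 D c d j r g e"
    and "co c d r f e (D (dx c d k) (dp c d j b) e) = - kron b f * H_x \<A> \<B> N2 D c d j r k e"
    and "co c d r f e (D (dp c d k g) (dp c d j b) e) = - kron b f * C_x \<A> \<B> N2 D c d j r k g e"
proof -
  have t: "fst e \<in> fst c" using e by (auto simp: jet_chart_dom box_def)
  let ?h = "h c (fst e)"
  have kr: "(\<Sum>a\<in>UNIV. ?h $ a $ f * (u a - kron b a * y)) = (\<Sum>a\<in>UNIV. ?h $ a $ f * u a) - ?h $ b $ f * y"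
    for f u y
  proof -
    have "(\<Sum>a\<in>UNIV. ?h $ a $ f * (u a - kron b a * y)) =
        (\<Sum>a\<in>UNIV. ?h $ a $ f * u a) - (\<Sum>a\<in>UNIV. kron b a * (?h $ a $ f * y))"
      by (simp only: right_diff_distrib sum_subtractf mult_ac)
    then show ?thesis by simp
  qed
  show "co c d r f e (D (dt c d g) (dp c d j b) e) =
      kron r j * christoffel h c f b g (fst e) - kron b f * A_x \<A> \<B> N1 N2 D c d j r g e"
  proof (rule metric_cancel[OF c t, where u = "\<lambda>f. co c d r f e (D (dt c d g) (dp c d j b) e)"
      and v = "\<lambda>f. kron r j * christoffel h c f b g (fst e) - kron b f * A_x \<A> \<B> N1 N2 D c d j r g e"])
    fix f
    show "(\<Sum>a\<in>UNIV. ?h $ a $ f * co c d r a e (D (dt c d g) (dp c d j b) e)) =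
        (\<Sum>a\<in>UNIV. ?h $ a $ f * (kron r j * christoffel h c a b g (fst e) - kron b a * A_x \<A> \<B> N1 N2 D c d j r g e))"
      unfolding kr DJ[OF c d e delta_t_vf[OF c d]] metric_derivatives[OF c d e]
        A_t_def[symmetric] A_x_def[symmetric] h_normal_temporal[OF c d e] metric_compatible[OF c t]
      by (simp add: sum_distrib_left mult_ac kron_def)
  qed
  show "co c d r f e (D (dx c d k) (dp c d j b) e) = - kron b f * H_x \<A> \<B> N2 D c d j r k e"
  proof (rule metric_cancel[OF c t, where u = "\<lambda>f. co c d r f e (D (dx c d k) (dp c d j b) e)"
      and v = "\<lambda>f. - kron b f * H_x \<A> \<B> N2 D c d j r k e"])
    fix f
    show "(\<Sum>a\<in>UNIV. ?h $ a $ f * co c d r a e (D (dx c d k) (dp c d j b) e)) =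
        (\<Sum>a\<in>UNIV. ?h $ a $ f * (- kron b a * H_x \<A> \<B> N2 D c d j r k e))"
      unfolding DJ[OF c d e delta_x_vf[OF c d]] metric_derivatives[OF c d e]
        H_t_def[symmetric] H_x_def[symmetric] h_normal_temporal[OF c d e]
      using kr[of f "\<lambda>_. 0" "H_x \<A> \<B> N2 D c d j r k e"] by simp
  qed
  show "co c d r f e (D (dp c d k g) (dp c d j b) e) = - kron b f * C_x \<A> \<B> N2 D c d j r k g e"
  proof (rule metric_cancel[OF c t, where u = "\<lambda>f. co c d r f e (D (dp c d k g) (dp c d j b) e)"
      and v = "\<lambda>f. - kron b f * C_x \<A> \<B> N2 D c d j r k g e"])
    fix f
    show "(\<Sum>a\<in>UNIV. ?h $ a $ f * co c d r a e (D (dp c d k g) (dp c d j b) e)) =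
        (\<Sum>a\<in>UNIV. ?h $ a $ f * (- kron b a * C_x \<A> \<B> N2 D c d j r k g e))"
      unfolding DJ[OF c d e par_p_vf[OF c d]] metric_derivatives[OF c d e]
        C_t_def[symmetric] C_x_def[symmetric] h_normal_temporal[OF c d e]
      using kr[of f "\<lambda>_. 0" "C_x \<A> \<B> N2 D c d j r k g e"] by simp
  qed
qed

section \<open>The torsion of pairs of adapted fields\<close>

lemma torsion_hfield:
  assumes c: "c \<in> \<A>" and d: "d \<in> \<B>" and e: "e \<in> fst (J c d)"
    and F: "\<And>j b. smooth_fun JA (fst (J c d)) (F j b)" and F': "\<And>j b. smooth_fun JA (fst (J c d)) (F' j b)"
    and X: "\<forall>e\<in>fst (J c d). X e = hfield c d w F e"
    and Y: "\<forall>e\<in>fst (J c d). Y e = hfield c d w' F' e"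
  shows "torsion JA D X Y e g = D X Y e g - D Y X e g +
    (\<Sum>r\<in>UNIV. \<Sum>f\<in>UNIV. (X e (F' r f) - Y e (F r f)) * dp c d r f e g)"
proof -
  have "lie_bracket JA X Y e g = lie_bracket JA (hfield c d w F) (hfield c d w' F') e g"
    using J.lie_bracket_cong[OF J_open[OF c d] e hfield_vf[OF c d, of F w, OF F] hfield_vf[OF c d, of F' w', OF F'], of X Y] X Y
    by simp
  also have "\<dots> = (\<Sum>r\<in>UNIV. \<Sum>f\<in>UNIV. (Y e (F r f) - X e (F' r f)) * dp c d r f e g)"
    unfolding bspec[OF X e] bspec[OF Y e] by (rule lie_bracket_hfield[OF c d e F F'])
  finally show ?thesis by (simp add: torsion_def left_diff_distrib sum_subtractf)
qed

lemma torsion_adapted: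
  assumes c: "c \<in> \<A>" and d: "d \<in> \<B>" and e: "e \<in> fst (J c d)"
  shows "torsion JA D (dt c d b) (dt c d a) e g =
        (\<Sum>r\<in>UNIV. \<Sum>f\<in>UNIV. R_tt \<A> \<B> N1 c d f r a b e * dp c d r f e g)" (is ?tt)
    and "torsion JA D (dx c d j) (dt c d a) e g =
        (\<Sum>r\<in>UNIV. T_tx \<A> \<B> N1 N2 D c d r a j e * dx c d r e g) +
        (\<Sum>r\<in>UNIV. \<Sum>f\<in>UNIV. R_tx \<A> \<B> N1 N2 c d f r a j e * dp c d r f e g)" (is ?tx)
    and "torsion JA D (dp c d j b) (dt c d a) e g =
        (\<Sum>r\<in>UNIV. \<Sum>f\<in>UNIV. P_tp \<A> \<B> N1 N2 h D c d f r a j b e * dp c d r f e g)" (is ?tp)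
    and "torsion JA D (dx c d j) (dx c d i) e g =
        (\<Sum>r\<in>UNIV. T_xx \<A> \<B> N2 D c d r i j e * dx c d r e g) +
        (\<Sum>r\<in>UNIV. \<Sum>f\<in>UNIV. R_xx \<A> \<B> N2 c d f r i j e * dp c d r f e g)" (is ?xx)
    and "torsion JA D (dp c d j b) (dx c d i) e g =
        (\<Sum>r\<in>UNIV. P_xp \<A> \<B> N2 D c d r i j b e * dx c d r e g) +
        (\<Sum>r\<in>UNIV. \<Sum>f\<in>UNIV. P_xpv \<A> \<B> N2 D c d f r i j b e * dp c d r f e g)" (is ?xp)
    and "torsion JA D (dp c d j b) (dp c d i a) e g =
        (\<Sum>r\<in>UNIV. \<Sum>f\<in>UNIV. S_pp \<A> \<B> N2 D c d f r i a j b e * dp c d r f e g)" (is ?pp)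
proof -
  have t: "fst e \<in> fst c" using e by (auto simp: jet_chart_dom box_def)
  note vt = delta_t_vf[OF c d] and vx = delta_x_vf[OF c d] and vp = par_p_vf[OF c d]
  note N = N_smooth[OF c d] and Z = J.smooth_fun_const[of "fst (J c d)" 0]
  have ht: "\<forall>e\<in>fst (J c d). dt c d a e = hfield c d (dir_t a) (\<lambda>r f. N1 c d r f a) e"
    and hx: "\<forall>e\<in>fst (J c d). dx c d i e = hfield c d (dir_x i) (\<lambda>r f. N2 c d r f i) e"
    and hp: "\<forall>e\<in>fst (J c d). dp c d i a e = hfield c d (dir_p i a) (\<lambda>_ _ _. 0) e" for i a
    using delta_t_hfield[OF c d] delta_x_hfield[OF c d] par_p_hfield[OF c d] by blast+
  note ad = D_adapted[OF c d e] and co = h_normal_temporal[OF c d e] D_vertical[OF c d e]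
  \<comment> \<open>Vertical basis fields have coefficient family 0 in \<open>hfield\<close>; these
    facts remove its derivatives along the other field.\<close>
  note zt = J.tangent_const[OF J.vf_tangent[OF vt e], of _ 0] and zx = J.tangent_const[OF J.vf_tangent[OF vx e], of _ 0]
    and zp = J.tangent_const[OF J.vf_tangent[OF vp e], of _ _ 0]
  note At = A_t_def[symmetric] H_t_def[symmetric] C_t_def[symmetric] A_x_def[symmetric] H_x_def[symmetric] C_x_def[symmetric]
  \<comment> \<open>The temporal parts of the two covariant derivatives have Christoffel
    coefficients and cancel by symmetry, so only the bracket remains.\<close>
  show ?tt
    unfolding torsion_hfield[OF c d e, of "\<lambda>r f. N1 c d r f b" "\<lambda>r f. N1 c d r f a"
        "dt c d b" "dir_t b" "dt c d a" "dir_t a", OF N(1) N(1) ht ht] ad(1)[OF vt] At co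
    using christoffel_sym[OF c t, of _ a b] by (simp add: R_tt_def)
  \<comment> \<open>\<open>H_t\<close> vanishes, which removes the temporal part; the spatial
    covariant derivative is the subtracted one, whence the sign in \<open>T_tx\<close>.\<close>
  show ?tx
    unfolding torsion_hfield[OF c d e, of "\<lambda>r f. N2 c d r f j" "\<lambda>r f. N1 c d r f a"
        "dx c d j" "dir_x j" "dt c d a" "dir_t a", OF N(2) N(1) hx ht] ad(1)[OF vx] ad(2)[OF vt] At co
    by (simp add: R_tx_def T_tx_def sum_negf)
  \<comment> \<open>\<open>C_t\<close> vanishes, which removes one covariant derivative; the other,
    of the vertical field, is subtracted and supplies the \<open>A_x\<close> and Christoffel terms
    with reversed signs.\<close>
  show ?tp
    unfolding torsion_hfield[OF c d e, of "\<lambda>_ _ _. 0" "\<lambda>r f. N1 c d r f a"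
        "dp c d j b" "dir_p j b" "dt c d a" "dir_t a", OF Z N(1) hp ht] ad(1)[OF vp] ad(3)[OF vt] At co zt
    by (simp add: P_tp_def ring_distribs sum.distrib sum_subtractf)
  show ?xx
    unfolding torsion_hfield[OF c d e, of "\<lambda>r f. N2 c d r f j" "\<lambda>r f. N2 c d r f i"
        "dx c d j" "dir_x j" "dx c d i" "dir_x i", OF N(2) N(2) hx hx] ad(2)[OF vx] At co
    by (simp add: R_xx_def T_xx_def left_diff_distrib sum_subtractf)
  show ?xp
    unfolding torsion_hfield[OF c d e, of "\<lambda>_ _ _. 0" "\<lambda>r f. N2 c d r f i"
        "dp c d j b" "dir_p j b" "dx c d i" "dir_x i", OF Z N(2) hp hx] ad(2)[OF vp] ad(3)[OF vx] At co zx
    by (simp add: P_xp_def P_xpv_def ring_distribs sum.distrib sum_subtractf sum_negf)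
  show ?pp
    unfolding torsion_hfield[OF c d e, of "\<lambda>_ _ _. 0" "\<lambda>_ _ _. 0"
        "dp c d j b" "dir_p j b" "dp c d i a" "dir_p i a", OF Z Z hp hp] ad(3)[OF vp] At co zp
    by (simp add: S_pp_def ring_distribs sum.distrib sum_subtractf sum_negf)
qed

section \<open>The torsion components are d-tensors\<close>

abbreviation "\<tau> \<equiv> torsion JA D"

lemma torsion_vf:
  "J.open_in W \<Longrightarrow> X \<in> vector_fields JA W \<Longrightarrow> Y \<in> vector_fields JA W \<Longrightarrow>
    \<tau> X Y \<in> vector_fields JA W"
  by (rule J.local_operatorD(1)[OF J.torsion_local[OF local_D]])

text \<open>Bilinearity over functions, for fields that are combinations of others over
  \<open>W\<close> only. The index types are kept arbitrary because the vertical frame is indexed by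
  pairs.\<close>

lemma torsion_change:
  fixes X :: "'i::finite \<Rightarrow> ('t, 'x, 'm, 'n) jet vfield" and Y :: "'j::finite \<Rightarrow> ('t, 'x, 'm, 'n) jet vfield"
  assumes W: "J.open_in W" "e \<in> W"
    and X: "\<And>q. X q \<in> vector_fields JA W" "\<And>q. smooth_fun JA W (k q)"
    and Y: "\<And>w. Y w \<in> vector_fields JA W" "\<And>w. smooth_fun JA W (l w)"
    and X': "\<forall>e\<in>W. X' e = (\<lambda>g. \<Sum>q\<in>UNIV. k q e * X q e g)"
    and Y': "\<forall>e\<in>W. Y' e = (\<lambda>g. \<Sum>w\<in>UNIV. l w e * Y w e g)"
  shows "\<tau> X' Y' e = (\<lambda>g. \<Sum>q\<in>UNIV. \<Sum>w\<in>UNIV. k q e * l w e * \<tau> (X q) (Y w) e g)"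
proof
  fix g
  let ?X = "\<lambda>e g. \<Sum>q\<in>UNIV. k q e * X q e g" and ?Y = "\<lambda>e g. \<Sum>w\<in>UNIV. l w e * Y w e g"
  have vX: "?X \<in> vector_fields JA W" and vY: "?Y \<in> vector_fields JA W"
    by (rule J.vf_sum_mem[OF W(1) finite X], rule J.vf_sum_mem[OF W(1) finite Y])
  have "\<tau> X' Y' e g = \<tau> ?X ?Y e g"
    using J.local_operatorD(2)[OF J.torsion_local[OF local_D] W(1) vX vY, of X' Y' e] X' Y' W(2) by simp
  also have "\<dots> = (\<Sum>q\<in>UNIV. k q e * \<tau> (X q) ?Y e g)"
    by (rule J.tensor_sum_left[OF J.torsion_tensor[OF linear_D] W finite X vY])
  also have "\<dots> = (\<Sum>q\<in>UNIV. \<Sum>w\<in>UNIV. k q e * l w e * \<tau> (X q) (Y w) e g)"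
  proof (rule sum.cong[OF refl])
    fix q
    have "\<tau> (X q) ?Y e g = - \<tau> ?Y (X q) e g" by (rule J.torsion_skew)
    also have "\<tau> ?Y (X q) e g = (\<Sum>w\<in>UNIV. l w e * \<tau> (Y w) (X q) e g)"
      by (rule J.tensor_sum_left[OF J.torsion_tensor[OF linear_D] W finite Y X(1)])
    also have "- (\<Sum>w\<in>UNIV. l w e * \<tau> (Y w) (X q) e g) = (\<Sum>w\<in>UNIV. l w e * \<tau> (X q) (Y w) e g)"
      unfolding J.torsion_skew[of D "X q"] by (simp add: sum_negf)
    finally show "k q e * \<tau> (X q) ?Y e g = (\<Sum>w\<in>UNIV. k q e * l w e * \<tau> (X q) (Y w) e g)"
      by (simp only: sum_distrib_left mult.assoc)
  qed
  finally show "\<tau> X' Y' e g = (\<Sum>q\<in>UNIV. \<Sum>w\<in>UNIV. k q e * l w e * \<tau> (X q) (Y w) e g)" .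
qed

text \<open>The coframe evaluates a functional at coordinate functions, which is linear in the
  functional itself, so the identities hold for arbitrary functionals.\<close>

lemma co_sum:
  "co_x d r (\<lambda>g. \<Sum>q\<in>I. \<Sum>w\<in>K. k q w * V q w g) = (\<Sum>q\<in>I. \<Sum>w\<in>K. k q w * co_x d r (V q w))"
  "co c d r f e (\<lambda>g. \<Sum>q\<in>I. \<Sum>w\<in>K. k q w * V q w g) = (\<Sum>q\<in>I. \<Sum>w\<in>K. k q w * co c d r f e (V q w))"
proof -
  show "co_x d r (\<lambda>g. \<Sum>q\<in>I. \<Sum>w\<in>K. k q w * V q w g) = (\<Sum>q\<in>I. \<Sum>w\<in>K. k q w * co_x d r (V q w))"
    by (simp add: co_x_def)
  have swap: "(\<Sum>b\<in>B. n b * (\<Sum>q\<in>I. \<Sum>w\<in>K. k q w * u q w b)) =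
      (\<Sum>q\<in>I. \<Sum>w\<in>K. k q w * (\<Sum>b\<in>B. n b * u q w b))" for B and n :: "'z \<Rightarrow> real" and u
    unfolding sum_distrib_left sum_swap3[of _ _ _ B] by (simp only: mult_ac)
  show "co c d r f e (\<lambda>g. \<Sum>q\<in>I. \<Sum>w\<in>K. k q w * V q w g) = (\<Sum>q\<in>I. \<Sum>w\<in>K. k q w * co c d r f e (V q w))"
    unfolding co_p_def co_t_def co_x_def swap by (simp add: ring_distribs sum.distrib)
qed

text \<open>The transformation laws of \<open>delta_x\<close> and \<open>par_p\<close> keep the
  spatial and the vertical span apart, so the new coframe reads the two groups of coefficients
  separately, each with its own Jacobians.\<close>

lemma co_combination:
  assumes c: "c \<in> \<A>" "c' \<in> \<A>" and d: "d \<in> \<B>" "d' \<in> \<B>"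
    and e: "e \<in> fst (J c d)" "e \<in> fst (J c' d')"
    and v: "v = (\<lambda>g. (\<Sum>y\<in>UNIV. \<alpha> y * dx c d y e g) + (\<Sum>y\<in>UNIV. \<Sum>z\<in>UNIV. \<beta> y z * dp c d y z e g))"
  shows "co_x d' r v = (\<Sum>y\<in>UNIV. jac d' d r y (fst (snd e)) * \<alpha> y)"
    and "co c' d' r f e v = (\<Sum>y\<in>UNIV. \<Sum>z\<in>UNIV. jac d d' y r (fst (snd e)) * jac c' c f z (fst e) * \<beta> y z)"
proof -
  \<comment> \<open>The dummy sum over \<open>unit\<close> brings a single sum into the double-sum
    form of \<open>co_sum\<close>.\<close>
  have X: "dx c d y e = (\<lambda>g. \<Sum>k\<in>UNIV. \<Sum>u\<in>(UNIV :: unit set). jac d' d k y (fst (snd e)) * dx c' d' k e g)" for y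
    by (simp add: delta_x_change[OF c d e] fun_eq_iff)
  have P: "dp c d y z e = (\<lambda>g. \<Sum>j\<in>UNIV. \<Sum>b\<in>UNIV. jac d d' y j (fst (snd e)) * jac c' c b z (fst e) * dp c' d' j b e g)" for y z
    by (simp add: par_p_change[OF c d e] fun_eq_iff)
  have kr: "(\<Sum>j\<in>UNIV. \<Sum>b\<in>UNIV. m j b * (kron r j * kron f b)) = m r f" for m :: "'n \<Rightarrow> 'm \<Rightarrow> real" and r f
  proof -
    have "(\<Sum>j\<in>UNIV. \<Sum>b\<in>UNIV. m j b * (kron r j * kron f b)) = (\<Sum>j\<in>UNIV. (\<Sum>b\<in>UNIV. m j b * kron f b) * kron r j)"
      by (simp only: sum_distrib_right sum_distrib_left mult_ac)
    then show ?thesis by simp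
  qed
  have x: "co_x d' r (dx c d y e) = jac d' d r y (fst (snd e))" "co_x d' r (dp c d y z e) = 0"
    "co c' d' r f e (dx c d y e) = 0"
    "co c' d' r f e (dp c d y z e) = jac d d' y r (fst (snd e)) * jac c' c f z (fst e)" for y z r f
    unfolding X P co_sum co_delta_x[OF c(2) d(2) e(2)] co_par_p[OF c(2) d(2) e(2)] kr by simp_all
  have add: "co_x d' r (\<lambda>g. p g + q g) = co_x d' r p + co_x d' r q"
    "co c' d' r f e (\<lambda>g. p g + q g) = co c' d' r f e p + co c' d' r f e q" for p q
    by (simp_all add: co_x_def co_t_def co_p_def ring_distribs sum.distrib)
  have single: "(\<lambda>g. \<Sum>y\<in>UNIV. \<alpha> y * dx c d y e g) = (\<lambda>g. \<Sum>y\<in>UNIV. \<Sum>u\<in>(UNIV :: unit set). \<alpha> y * dx c d y e g)"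
    by simp
  show "co_x d' r v = (\<Sum>y\<in>UNIV. jac d' d r y (fst (snd e)) * \<alpha> y)"
    unfolding v add single co_sum x by (simp add: mult.commute)
  show "co c' d' r f e v = (\<Sum>y\<in>UNIV. \<Sum>z\<in>UNIV. jac d d' y r (fst (snd e)) * jac c' c f z (fst e) * \<beta> y z)"
    unfolding v add single co_sum x by (simp add: mult.commute)
qed

lemma co_smooth:
  assumes c: "c \<in> \<A>" and d: "d \<in> \<B>" and V: "V \<in> vector_fields JA (fst (J c d))"
  shows "smooth_fun JA (fst (J c d)) (\<lambda>e. co_x d r (V e))"
    and "smooth_fun JA (fst (J c d)) (\<lambda>e. co c d r f e (V e))"
proof -
  note W = J_open[OF c d] and sm = J.vf_smooth[OF V J_open[OF c d] order_refl]
  have t: "smooth_fun JA (fst (J c d)) (\<lambda>e. co_t c a (V e))" for a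
    unfolding co_t_def by (rule sm[OF coords_smooth(1)[OF c d]])
  show x: "smooth_fun JA (fst (J c d)) (\<lambda>e. co_x d r (V e))" for r
    unfolding co_x_def by (rule sm[OF coords_smooth(2)[OF c d]])
  show "smooth_fun JA (fst (J c d)) (\<lambda>e. co c d r f e (V e))"
    unfolding co_p_def
    by (rule J.smooth_fun_add[OF W J.smooth_fun_add[OF W sm[OF coords_smooth(3)[OF c d]]
            J.smooth_fun_sum[OF W J.smooth_fun_mult[OF W N_smooth(1)[OF c d] t]]]
          J.smooth_fun_sum[OF W J.smooth_fun_mult[OF W N_smooth(2)[OF c d] x]]])
qed

text \<open>The torsion of frame fields of one chart pair is read with the coframe of another.
  Together with the change of frame in the arguments this gives all transformation laws; for equal
  chart pairs it identifies the components.\<close>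

lemma torsion_components:
  assumes c: "c \<in> \<A>" "c' \<in> \<A>" and d: "d \<in> \<B>" "d' \<in> \<B>"
    and e: "e \<in> fst (J c d)" "e \<in> fst (J c' d')"
  defines "jx \<equiv> \<lambda>i j. jac d' d i j (fst (snd e))"
    and "jp \<equiv> \<lambda>r f y z. jac d d' y r (fst (snd e)) * jac c' c f z (fst e)"
  shows "co_x d' r (\<tau> (dx c d j) (dt c d a) e) = (\<Sum>y\<in>UNIV. jx r y * T_tx \<A> \<B> N1 N2 D c d y a j e)" (is ?c1)
    and "co_x d' r (\<tau> (dx c d j) (dx c d i) e) = (\<Sum>y\<in>UNIV. jx r y * T_xx \<A> \<B> N2 D c d y i j e)" (is ?c2)
    and "co_x d' r (\<tau> (dp c d j b) (dx c d i) e) = (\<Sum>y\<in>UNIV. jx r y * P_xp \<A> \<B> N2 D c d y i j b e)" (is ?c3)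
    and "co c' d' r f e (\<tau> (dp c d j b) (dt c d a) e) =
      (\<Sum>y\<in>UNIV. \<Sum>z\<in>UNIV. jp r f y z * P_tp \<A> \<B> N1 N2 h D c d z y a j b e)" (is ?c4)
    and "co c' d' r f e (\<tau> (dp c d j b) (dx c d i) e) =
      (\<Sum>y\<in>UNIV. \<Sum>z\<in>UNIV. jp r f y z * P_xpv \<A> \<B> N2 D c d z y i j b e)" (is ?c5)
    and "co c' d' r f e (\<tau> (dt c d b) (dt c d a) e) =
      (\<Sum>y\<in>UNIV. \<Sum>z\<in>UNIV. jp r f y z * R_tt \<A> \<B> N1 c d z y a b e)" (is ?c6)
    and "co c' d' r f e (\<tau> (dx c d j) (dt c d a) e) =
      (\<Sum>y\<in>UNIV. \<Sum>z\<in>UNIV. jp r f y z * R_tx \<A> \<B> N1 N2 c d z y a j e)" (is ?c7)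
    and "co c' d' r f e (\<tau> (dx c d j) (dx c d i) e) =
      (\<Sum>y\<in>UNIV. \<Sum>z\<in>UNIV. jp r f y z * R_xx \<A> \<B> N2 c d z y i j e)" (is ?c8)
    and "co c' d' r f e (\<tau> (dp c d j b) (dp c d i a) e) =
      (\<Sum>y\<in>UNIV. \<Sum>z\<in>UNIV. jp r f y z * S_pp \<A> \<B> N2 D c d z y i a j b e)" (is ?c9)
proof -
  note ta = ext[OF torsion_adapted(1)[OF c(1) d(1) e(1)]] ext[OF torsion_adapted(2)[OF c(1) d(1) e(1)]]
    ext[OF torsion_adapted(3)[OF c(1) d(1) e(1)]] ext[OF torsion_adapted(4)[OF c(1) d(1) e(1)]]
    ext[OF torsion_adapted(5)[OF c(1) d(1) e(1)]] ext[OF torsion_adapted(6)[OF c(1) d(1) e(1)]]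
  note cc = co_combination[OF c d e]
  \<comment> \<open>Torsions without spatial part are the case \<open>\<alpha> = 0\<close> of
    \<open>co_combination\<close>.\<close>
  have pure: "co c' d' r f e (\<lambda>g. \<Sum>y\<in>UNIV. \<Sum>z\<in>UNIV. \<beta> y z * dp c d y z e g) =
      (\<Sum>y\<in>UNIV. \<Sum>z\<in>UNIV. jp r f y z * \<beta> y z)" for \<beta>
    using cc(2)[where \<alpha> = "\<lambda>_. 0" and \<beta> = \<beta> and r = r and f = f, OF refl] by (simp add: jp_def)
  show ?c1
    unfolding jx_def jp_def by (rule cc(1)[OF ta(2)])
  show ?c2
    unfolding jx_def jp_def by (rule cc(1)[OF ta(4)])
  show ?c3
    unfolding jx_def jp_def by (rule cc(1)[OF ta(5)])
  show ?c4
    unfolding ta(3) by (rule pure)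
  show ?c5
    unfolding jx_def jp_def by (rule cc(2)[OF ta(5)])
  show ?c6
    unfolding ta(1) by (rule pure)
  show ?c7
    unfolding jx_def jp_def by (rule cc(2)[OF ta(2)])
  show ?c8
    unfolding jx_def jp_def by (rule cc(2)[OF ta(4)])
  show ?c9
    unfolding ta(6) by (rule pure)
qed

text \<open>For equal chart pairs the Jacobians are Kronecker deltas and the sums collapse. As a
  value of the coframe on the torsion, each component is open to the arguments for smoothness and
  for change of charts.\<close>

lemma torsion_components_self:
  assumes c: "c \<in> \<A>" and d: "d \<in> \<B>" and e: "e \<in> fst (J c d)"
  shows "T_tx \<A> \<B> N1 N2 D c d r a j e = co_x d r (\<tau> (dx c d j) (dt c d a) e)"
    and "T_xx \<A> \<B> N2 D c d r i j e = co_x d r (\<tau> (dx c d j) (dx c d i) e)"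
    and "P_xp \<A> \<B> N2 D c d r i j b e = co_x d r (\<tau> (dp c d j b) (dx c d i) e)"
    and "P_tp \<A> \<B> N1 N2 h D c d f r a j b e = co c d r f e (\<tau> (dp c d j b) (dt c d a) e)"
    and "P_xpv \<A> \<B> N2 D c d f r i j b e = co c d r f e (\<tau> (dp c d j b) (dx c d i) e)"
    and "R_tt \<A> \<B> N1 c d f r a b e = co c d r f e (\<tau> (dt c d b) (dt c d a) e)"
    and "R_tx \<A> \<B> N1 N2 c d f r a j e = co c d r f e (\<tau> (dx c d j) (dt c d a) e)"
    and "R_xx \<A> \<B> N2 c d f r i j e = co c d r f e (\<tau> (dx c d j) (dx c d i) e)"
    and "S_pp \<A> \<B> N2 D c d f r i a j b e = co c d r f e (\<tau> (dp c d j b) (dp c d i a) e)"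
  unfolding torsion_components[OF c c d d e e] T.jac_self[OF c jet_dom(1)[OF e]] X.jac_self[OF d jet_dom(2)[OF e]]
    mult.assoc sum_distrib_left[symmetric] sum_kron by (rule refl)+

lemma torsion_co_smooth:
  assumes c: "c \<in> \<A>" and d: "d \<in> \<B>"
    and X: "X \<in> vector_fields JA (fst (J c d))" and Y: "Y \<in> vector_fields JA (fst (J c d))"
  shows "(\<And>e. e \<in> fst (J c d) \<Longrightarrow> K e = co_x d r (\<tau> X Y e)) \<Longrightarrow> smooth_fun JA (fst (J c d)) K"
    and "(\<And>e. e \<in> fst (J c d) \<Longrightarrow> K e = co c d r f e (\<tau> X Y e)) \<Longrightarrow> smooth_fun JA (fst (J c d)) K"
  using co_smooth[OF c d torsion_vf[OF J_open[OF c d] X Y]]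
    J.smooth_fun_cong[OF J_open[OF c d], of K "\<lambda>e. co_x d r (\<tau> X Y e)"]
    J.smooth_fun_cong[OF J_open[OF c d], of K "\<lambda>e. co c d r f e (\<tau> X Y e)"]
  by blast+

lemma jac_pullback_smooth:
  assumes c: "c \<in> \<A>" "c' \<in> \<A>" and d: "d \<in> \<B>" "d' \<in> \<B>"
  shows "smooth_fun JA (fst (J c d) \<inter> fst (J c' d')) (\<lambda>e. jac c c' q a (fst e))"
    and "smooth_fun JA (fst (J c d) \<inter> fst (J c' d')) (\<lambda>e. jac d d' k i (fst (snd e)))"
    and "smooth_fun JA (fst (J c d) \<inter> fst (J c' d')) (\<lambda>e. jac d' d k i (fst (snd e)))"
proof -
  let ?S = "fst c \<inter> fst c'" and ?R = "fst d \<inter> fst d'"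
  have S: "T.open_in ?S" "?S \<subseteq> fst c" using T.openin_chart[OF c(1)] T.openin_chart[OF c(2)] by auto
  have R: "X.open_in ?R" "?R \<subseteq> fst d" using X.openin_chart[OF d(1)] X.openin_chart[OF d(2)] by auto
  have sub: "fst (J c d) \<inter> fst (J c' d') \<subseteq> box ?S (fst d)" "fst (J c d) \<inter> fst (J c' d') \<subseteq> box (fst c) ?R"
    by (auto simp: jet_chart_dom box_def)
  have jT: "smooth_fun \<A> ?S (jac c c' q a)" for q a
    using T.jac_smooth[OF c(2,1)] by (simp add: Int_commute)
  have jX: "smooth_fun \<B> ?R (jac d d' k i)" "smooth_fun \<B> ?R (jac d' d k i)" for k i
    using X.jac_smooth[OF d(2,1)] X.jac_smooth[OF d] by (simp_all add: Int_commute)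
  show "smooth_fun JA (fst (J c d) \<inter> fst (J c' d')) (\<lambda>e. jac c c' q a (fst e))"
    by (rule J.smooth_fun_subset[OF pullback_t(1)[OF c(1) d(1) S jT] sub(1)])
  show "smooth_fun JA (fst (J c d) \<inter> fst (J c' d')) (\<lambda>e. jac d d' k i (fst (snd e)))"
    by (rule J.smooth_fun_subset[OF pullback_x(1)[OF c(1) d(1) R jX(1)] sub(2)])
  show "smooth_fun JA (fst (J c d) \<inter> fst (J c' d')) (\<lambda>e. jac d' d k i (fst (snd e)))"
    by (rule J.smooth_fun_subset[OF pullback_x(1)[OF c(1) d(1) R jX(2)] sub(2)])
qed

text \<open>The frame of \<open>c'\<close>, \<open>d'\<close> is expanded in that of
  \<open>c\<close>, \<open>d\<close>; hence the Jacobians \<open>jac c c'\<close> and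
  \<open>jac d d'\<close> for horizontal fields, and the opposite order in the spatial factor for
  vertical ones. A vertical index is a pair with the spatial index in front.\<close>

lemma torsion_frame_change:
  assumes c: "c \<in> \<A>" "c' \<in> \<A>" and d: "d \<in> \<B>" "d' \<in> \<B>"
    and e: "e \<in> fst (J c d)" "e \<in> fst (J c' d')"
  defines "kt \<equiv> \<lambda>a q e. jac c c' q a (fst e)" and "kx \<equiv> \<lambda>i q e. jac d d' q i (fst (snd e))"
    and "kp \<equiv> \<lambda>j b q e. jac d' d j (fst q) (fst (snd e)) * jac c c' (snd q) b (fst e)"
  shows
    "\<tau> (dt c' d' b) (dt c' d' a) e = (\<lambda>g. \<Sum>q\<in>UNIV. \<Sum>w\<in>UNIV.
      kt b q e * kt a w e * \<tau> (dt c d q) (dt c d w) e g)" (is ?tt)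
    and "\<tau> (dx c' d' j) (dt c' d' a) e = (\<lambda>g. \<Sum>q\<in>UNIV. \<Sum>w\<in>UNIV.
      kx j q e * kt a w e * \<tau> (dx c d q) (dt c d w) e g)" (is ?tx)
    and "\<tau> (dp c' d' j b) (dt c' d' a) e = (\<lambda>g. \<Sum>q\<in>UNIV. \<Sum>w\<in>UNIV.
      kp j b q e * kt a w e * \<tau> (dp c d (fst q) (snd q)) (dt c d w) e g)" (is ?tp)
    and "\<tau> (dx c' d' j) (dx c' d' i) e = (\<lambda>g. \<Sum>q\<in>UNIV. \<Sum>w\<in>UNIV.
      kx j q e * kx i w e * \<tau> (dx c d q) (dx c d w) e g)" (is ?xx)
    and "\<tau> (dp c' d' j b) (dx c' d' i) e = (\<lambda>g. \<Sum>q\<in>UNIV. \<Sum>w\<in>UNIV.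
      kp j b q e * kx i w e * \<tau> (dp c d (fst q) (snd q)) (dx c d w) e g)" (is ?xp)
    and "\<tau> (dp c' d' j b) (dp c' d' i a) e = (\<lambda>g. \<Sum>q\<in>UNIV. \<Sum>w\<in>UNIV.
      kp j b q e * kp i a w e * \<tau> (dp c d (fst q) (snd q)) (dp c d (fst w) (snd w)) e g)" (is ?pp)
proof -
  let ?U = "fst (J c d) \<inter> fst (J c' d')"
  have U: "J.open_in ?U" "e \<in> ?U"
    using J_open[OF c(1) d(1)] J_open[OF c(2) d(2)] e by auto
  have sub: "?U \<subseteq> fst (J c d)" by blast
  note vt = J.vf_subset[OF delta_t_vf[OF c(1) d(1)] sub] and vx = J.vf_subset[OF delta_x_vf[OF c(1) d(1)] sub]
    and vp = J.vf_subset[OF par_p_vf[OF c(1) d(1)] sub]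
  have kt: "smooth_fun JA ?U (kt a q)" and kx: "smooth_fun JA ?U (kx i k)" and kp: "smooth_fun JA ?U (kp j b p)" for a q i k j b p
    unfolding kt_def kx_def kp_def
    by (rule jac_pullback_smooth[OF c d] J.smooth_fun_mult[OF U(1) jac_pullback_smooth(3,1)[OF c d]])+
  have ft: "\<forall>e\<in>?U. dt c' d' a e = (\<lambda>g. \<Sum>q\<in>UNIV. kt a q e * dt c d q e g)" for a
    unfolding kt_def using delta_t_change[OF c(2,1) d(2,1)] by (simp add: fun_eq_iff)
  have fx: "\<forall>e\<in>?U. dx c' d' i e = (\<lambda>g. \<Sum>q\<in>UNIV. kx i q e * dx c d q e g)" for i
    unfolding kx_def using delta_x_change[OF c(2,1) d(2,1)] by (simp add: fun_eq_iff)
  have fp: "\<forall>e\<in>?U. dp c' d' j b e = (\<lambda>g. \<Sum>q\<in>UNIV. kp j b q e * dp c d (fst q) (snd q) e g)" for j b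
    unfolding kp_def using par_p_change[OF c(2,1) d(2,1)]
    by (simp add: fun_eq_iff sum.cartesian_product split_beta)
  show ?tt
    by (rule torsion_change[OF U, of "dt c d" "kt b" "dt c d" "kt a", OF vt kt vt kt ft ft])
  show ?tx
    by (rule torsion_change[OF U, of "dx c d" "kx j" "dt c d" "kt a", OF vx kx vt kt fx ft])
  show ?tp
    by (rule torsion_change[OF U, of "\<lambda>q. dp c d (fst q) (snd q)" "kp j b" "dt c d" "kt a", OF vp kp vt kt fp ft])
  show ?xx
    by (rule torsion_change[OF U, of "dx c d" "kx j" "dx c d" "kx i", OF vx kx vx kx fx fx])
  show ?xp
    by (rule torsion_change[OF U, of "\<lambda>q. dp c d (fst q) (snd q)" "kp j b" "dx c d" "kx i", OF vp kp vx kx fp fx])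
  show ?pp
    by (rule torsion_change[OF U, of "\<lambda>q. dp c d (fst q) (snd q)" "kp j b" "\<lambda>q. dp c d (fst q) (snd q)" "kp i a", OF vp kp vp kp fp fp])
qed

text \<open>Drops the conditions on list lengths, as the families below are smooth for lists of any
  length, and treats a bundle point as a whole rather than as a triple.\<close>

lemma d_tensorI:
  assumes "\<And>c d as bs us vs. c \<in> \<A> \<Longrightarrow> d \<in> \<B> \<Longrightarrow> smooth_fun JA (fst (J c d)) (K c d as bs us vs)"
    and "\<And>c c' d d' e as bs us vs. c \<in> \<A> \<Longrightarrow> c' \<in> \<A> \<Longrightarrow> d \<in> \<B> \<Longrightarrow> d' \<in> \<B> \<Longrightarrow>
      e \<in> fst (J c d) \<Longrightarrow> e \<in> fst (J c' d') \<Longrightarrow>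
      K c' d' as bs us vs e =
        (\<Sum>as' | length as' = k. \<Sum>bs' | length bs' = l. \<Sum>us' | length us' = q. \<Sum>vs' | length vs' = r.
          (\<Prod>s<k. jac c' c (as ! s) (as' ! s) (fst e)) * (\<Prod>s<l. jac c c' (bs' ! s) (bs ! s) (fst e)) *
          (\<Prod>s<q. jac d' d (us ! s) (us' ! s) (fst (snd e))) *
          (\<Prod>s<r. jac d d' (vs' ! s) (vs ! s) (fst (snd e))) * K c d as' bs' us' vs' e)"
  shows "d_tensor \<A> \<B> k l q r K"
  unfolding d_tensor_def
proof (intro allI impI conjI ballI)
  fix as bs us vs c c' d d' t x p
  assume "c \<in> \<A>" "c' \<in> \<A>" "d \<in> \<B>" "d' \<in> \<B>" "(t, x, p) \<in> fst (J c d) \<inter> fst (J c' d')"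
  then show "K c' d' as bs us vs (t, x, p) =
        (\<Sum>as' | length as' = k. \<Sum>bs' | length bs' = l. \<Sum>us' | length us' = q. \<Sum>vs' | length vs' = r.
          (\<Prod>s<k. jac c' c (as ! s) (as' ! s) t) * (\<Prod>s<l. jac c c' (bs' ! s) (bs ! s) t) *
          (\<Prod>s<q. jac d' d (us ! s) (us' ! s) x) *
          (\<Prod>s<r. jac d d' (vs' ! s) (vs ! s) x) * K c d as' bs' us' vs' (t, x, p))"
    using assms(2)[of c c' d d' "(t, x, p)" as bs us vs] by simp
qed (rule assms(1))

section \<open>Smoothness and transformation law of each of the nine families\<close>

lemma T_tx_smooth:
  assumes c: "c \<in> \<A>" and d: "d \<in> \<B>"
  shows "smooth_fun JA (fst (J c d)) (T_tx \<A> \<B> N1 N2 D c d r a j)"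
  by (rule torsion_co_smooth(1)[OF c d delta_x_vf[OF c d] delta_t_vf[OF c d] torsion_components_self(1)[OF c d]])

text \<open>Pattern of all nine laws: the component is a coframe value on the torsion of new frame
  fields; these are expanded in the old frame, and the new coframe is applied to the resulting
  torsions. The sums are ordered as in \<open>d_tensor\<close>: temporal upper, temporal lower,
  spatial upper, spatial lower.\<close>

lemma T_tx_change:
  assumes c: "c \<in> \<A>" "c' \<in> \<A>" and d: "d \<in> \<B>" "d' \<in> \<B>"
    and e: "e \<in> fst (J c d)" "e \<in> fst (J c' d')"
  shows "T_tx \<A> \<B> N1 N2 D c' d' r a j e =
    (\<Sum>w\<in>UNIV. \<Sum>y\<in>UNIV. \<Sum>q\<in>UNIV.
      jac c c' w a (fst e) * jac d' d r y (fst (snd e)) * jac d d' q j (fst (snd e)) *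
      T_tx \<A> \<B> N1 N2 D c d y w q e)" (is "?L = ?R")
proof -
  have "?L = (\<Sum>q\<in>UNIV. \<Sum>w\<in>UNIV.
      jac d d' q j (fst (snd e)) * jac c c' w a (fst e) *
      (\<Sum>y\<in>UNIV. jac d' d r y (fst (snd e)) * T_tx \<A> \<B> N1 N2 D c d y w q e))"
    unfolding torsion_components_self(1)[OF c(2) d(2) e(2)] torsion_frame_change(2)[OF c d e] co_sum
      torsion_components(1)[OF c d e] by (rule refl)
  also have "\<dots> = ?R"
    unfolding sum_distrib_left sum.cartesian_product UNIV_Times_UNIV
    by (rule sum.reindex_bij_witness[of _ "\<lambda>(w, y, q). (q, w, y)" "\<lambda>(q, w, y). (w, y, q)"]) auto
  finally show ?thesis .
qed

lemma d_tensor_T_tx: "d_tensor \<A> \<B> 0 1 1 1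
    (\<lambda>c d as bs us vs. T_tx \<A> \<B> N1 N2 D c d (us ! 0) (bs ! 0) (vs ! 0))"
proof (rule d_tensorI, goal_cases)
  case 1
  then show ?case by (rule T_tx_smooth)
next
  case 2
  show ?case unfolding T_tx_change[OF 2] sum_lists by (simp add: mult_ac)
qed

lemma T_xx_smooth:
  assumes c: "c \<in> \<A>" and d: "d \<in> \<B>"
  shows "smooth_fun JA (fst (J c d)) (T_xx \<A> \<B> N2 D c d r i j)"
  by (rule torsion_co_smooth(1)[OF c d delta_x_vf[OF c d] delta_x_vf[OF c d] torsion_components_self(2)[OF c d]])

text \<open>\<open>H_x\<close> alone does not transform tensorially: second derivatives of the
  change of the \<open>x\<close> coordinates enter, symmetrically in the two lower indices, and its
  skew part is free of them.\<close>

lemma T_xx_change: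
  assumes c: "c \<in> \<A>" "c' \<in> \<A>" and d: "d \<in> \<B>" "d' \<in> \<B>"
    and e: "e \<in> fst (J c d)" "e \<in> fst (J c' d')"
  shows "T_xx \<A> \<B> N2 D c' d' r i j e =
    (\<Sum>y\<in>UNIV. \<Sum>w\<in>UNIV. \<Sum>q\<in>UNIV.
      jac d' d r y (fst (snd e)) * jac d d' w i (fst (snd e)) * jac d d' q j (fst (snd e)) *
      T_xx \<A> \<B> N2 D c d y w q e)" (is "?L = ?R")
proof -
  have "?L = (\<Sum>q\<in>UNIV. \<Sum>w\<in>UNIV.
      jac d d' q j (fst (snd e)) * jac d d' w i (fst (snd e)) *
      (\<Sum>y\<in>UNIV. jac d' d r y (fst (snd e)) * T_xx \<A> \<B> N2 D c d y w q e))"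
    unfolding torsion_components_self(2)[OF c(2) d(2) e(2)] torsion_frame_change(4)[OF c d e] co_sum
      torsion_components(2)[OF c d e] by (rule refl)
  also have "\<dots> = ?R"
    unfolding sum_distrib_left sum.cartesian_product UNIV_Times_UNIV
    by (rule sum.reindex_bij_witness[of _ "\<lambda>(y, w, q). (q, w, y)" "\<lambda>(q, w, y). (y, w, q)"]) auto
  finally show ?thesis .
qed

lemma d_tensor_T_xx: "d_tensor \<A> \<B> 0 0 1 2
    (\<lambda>c d as bs us vs. T_xx \<A> \<B> N2 D c d (us ! 0) (vs ! 0) (vs ! 1))"
proof (rule d_tensorI, goal_cases)
  case 1
  then show ?case by (rule T_xx_smooth)
next
  case 2
  show ?case unfolding T_xx_change[OF 2] sum_lists by (simp add: mult_ac)
qed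

lemma P_xp_smooth:
  assumes c: "c \<in> \<A>" and d: "d \<in> \<B>"
  shows "smooth_fun JA (fst (J c d)) (P_xp \<A> \<B> N2 D c d r i j b)"
  by (rule torsion_co_smooth(1)[OF c d par_p_vf[OF c d] delta_x_vf[OF c d] torsion_components_self(3)[OF c d]])

lemma P_xp_change:
  assumes c: "c \<in> \<A>" "c' \<in> \<A>" and d: "d \<in> \<B>" "d' \<in> \<B>"
    and e: "e \<in> fst (J c d)" "e \<in> fst (J c' d')"
  shows "P_xp \<A> \<B> N2 D c' d' r i j b e =
    (\<Sum>q2\<in>UNIV. \<Sum>y\<in>UNIV. \<Sum>q1\<in>UNIV. \<Sum>w\<in>UNIV.
      jac c c' q2 b (fst e) * jac d' d r y (fst (snd e)) * jac d' d j q1 (fst (snd e)) * jac d d' w i (fst (snd e)) *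
      P_xp \<A> \<B> N2 D c d y w q1 q2 e)" (is "?L = ?R")
proof -
  have "?L = (\<Sum>q\<in>UNIV. \<Sum>w\<in>UNIV.
      (jac d' d j (fst q) (fst (snd e)) * jac c c' (snd q) b (fst e)) * jac d d' w i (fst (snd e)) *
      (\<Sum>y\<in>UNIV. jac d' d r y (fst (snd e)) * P_xp \<A> \<B> N2 D c d y w (fst q) (snd q) e))"
    unfolding torsion_components_self(3)[OF c(2) d(2) e(2)] torsion_frame_change(5)[OF c d e] co_sum
      torsion_components(3)[OF c d e] by (rule refl)
  also have "\<dots> = ?R"
    unfolding sum_distrib_left sum.cartesian_product UNIV_Times_UNIV
    by (rule sum.reindex_bij_witness[of _ "\<lambda>(q2, y, q1, w). ((q1, q2), w, y)" "\<lambda>((q1, q2), w, y). (q2, y, q1, w)"]) auto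
  finally show ?thesis .
qed

text \<open>The indices \<open>j\<close> and \<open>b\<close> come from a vertical field, whose
  spatial index counts as upper and whose temporal index as lower; hence \<open>j\<close> is read
  from \<open>us\<close> and \<open>b\<close> from \<open>bs\<close>.\<close>

lemma d_tensor_P_xp: "d_tensor \<A> \<B> 0 1 2 1
    (\<lambda>c d as bs us vs. P_xp \<A> \<B> N2 D c d (us ! 0) (vs ! 0) (us ! 1) (bs ! 0))"
proof (rule d_tensorI, goal_cases)
  case 1
  then show ?case by (rule P_xp_smooth)
next
  case 2
  show ?case unfolding P_xp_change[OF 2] sum_lists by (simp add: mult_ac)
qed

lemma P_tp_smooth:
  assumes c: "c \<in> \<A>" and d: "d \<in> \<B>"
  shows "smooth_fun JA (fst (J c d)) (P_tp \<A> \<B> N1 N2 h D c d f r a j b)"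
  by (rule torsion_co_smooth(2)[OF c d par_p_vf[OF c d] delta_t_vf[OF c d] torsion_components_self(4)[OF c d]])

text \<open>Neither the vertical derivative of \<open>N1\<close> nor the Christoffel term is
  tensorial by itself: both produce second derivatives of the change of the \<open>t\<close>
  coordinates, which cancel in the sum.\<close>

lemma P_tp_change:
  assumes c: "c \<in> \<A>" "c' \<in> \<A>" and d: "d \<in> \<B>" "d' \<in> \<B>"
    and e: "e \<in> fst (J c d)" "e \<in> fst (J c' d')"
  shows "P_tp \<A> \<B> N1 N2 h D c' d' f r a j b e =
    (\<Sum>z\<in>UNIV. \<Sum>w\<in>UNIV. \<Sum>q2\<in>UNIV. \<Sum>q1\<in>UNIV. \<Sum>y\<in>UNIV.
      jac c' c f z (fst e) * jac c c' w a (fst e) * jac c c' q2 b (fst e) * jac d' d j q1 (fst (snd e)) * jac d d' y r (fst (snd e)) *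
      P_tp \<A> \<B> N1 N2 h D c d z y w q1 q2 e)" (is "?L = ?R")
proof -
  have "?L = (\<Sum>q\<in>UNIV. \<Sum>w\<in>UNIV.
      (jac d' d j (fst q) (fst (snd e)) * jac c c' (snd q) b (fst e)) * jac c c' w a (fst e) *
      (\<Sum>y\<in>UNIV. \<Sum>z\<in>UNIV. jac d d' y r (fst (snd e)) * jac c' c f z (fst e) * P_tp \<A> \<B> N1 N2 h D c d z y w (fst q) (snd q) e))"
    unfolding torsion_components_self(4)[OF c(2) d(2) e(2)] torsion_frame_change(3)[OF c d e] co_sum
      torsion_components(4)[OF c d e] by (rule refl)
  also have "\<dots> = ?R"
    unfolding sum_distrib_left sum.cartesian_product UNIV_Times_UNIV
    by (rule sum.reindex_bij_witness[of _ "\<lambda>(z, w, q2, q1, y). ((q1, q2), w, y, z)" "\<lambda>((q1, q2), w, y, z). (z, w, q2, q1, y)"]) auto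
  finally show ?thesis .
qed

lemma d_tensor_P_tp: "d_tensor \<A> \<B> 1 2 1 1
    (\<lambda>c d as bs us vs. P_tp \<A> \<B> N1 N2 h D c d (as ! 0) (vs ! 0) (bs ! 0) (us ! 0) (bs ! 1))"
proof (rule d_tensorI, goal_cases)
  case 1
  then show ?case by (rule P_tp_smooth)
next
  case 2
  show ?case unfolding P_tp_change[OF 2] sum_lists by (simp add: mult_ac)
qed

lemma P_xpv_smooth:
  assumes c: "c \<in> \<A>" and d: "d \<in> \<B>"
  shows "smooth_fun JA (fst (J c d)) (P_xpv \<A> \<B> N2 D c d f r i j b)"
  by (rule torsion_co_smooth(2)[OF c d par_p_vf[OF c d] delta_x_vf[OF c d] torsion_components_self(5)[OF c d]])

text \<open>The same compensation in spatial directions: second derivatives of the change of the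
  \<open>x\<close> coordinates arise from the vertical derivative of \<open>N2\<close> and from
  \<open>H_x\<close>.\<close>

lemma P_xpv_change:
  assumes c: "c \<in> \<A>" "c' \<in> \<A>" and d: "d \<in> \<B>" "d' \<in> \<B>"
    and e: "e \<in> fst (J c d)" "e \<in> fst (J c' d')"
  shows "P_xpv \<A> \<B> N2 D c' d' f r i j b e =
    (\<Sum>z\<in>UNIV. \<Sum>q2\<in>UNIV. \<Sum>q1\<in>UNIV. \<Sum>y\<in>UNIV. \<Sum>w\<in>UNIV.
      jac c' c f z (fst e) * jac c c' q2 b (fst e) * jac d' d j q1 (fst (snd e)) * jac d d' y r (fst (snd e)) * jac d d' w i (fst (snd e)) *
      P_xpv \<A> \<B> N2 D c d z y w q1 q2 e)" (is "?L = ?R")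
proof -
  have "?L = (\<Sum>q\<in>UNIV. \<Sum>w\<in>UNIV.
      (jac d' d j (fst q) (fst (snd e)) * jac c c' (snd q) b (fst e)) * jac d d' w i (fst (snd e)) *
      (\<Sum>y\<in>UNIV. \<Sum>z\<in>UNIV. jac d d' y r (fst (snd e)) * jac c' c f z (fst e) * P_xpv \<A> \<B> N2 D c d z y w (fst q) (snd q) e))"
    unfolding torsion_components_self(5)[OF c(2) d(2) e(2)] torsion_frame_change(5)[OF c d e] co_sum
      torsion_components(5)[OF c d e] by (rule refl)
  also have "\<dots> = ?R"
    unfolding sum_distrib_left sum.cartesian_product UNIV_Times_UNIV
    by (rule sum.reindex_bij_witness[of _ "\<lambda>(z, q2, q1, y, w). ((q1, q2), w, y, z)" "\<lambda>((q1, q2), w, y, z). (z, q2, q1, y, w)"]) auto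
  finally show ?thesis .
qed

lemma d_tensor_P_xpv: "d_tensor \<A> \<B> 1 1 1 2
    (\<lambda>c d as bs us vs. P_xpv \<A> \<B> N2 D c d (as ! 0) (vs ! 0) (vs ! 1) (us ! 0) (bs ! 0))"
proof (rule d_tensorI, goal_cases)
  case 1
  then show ?case by (rule P_xpv_smooth)
next
  case 2
  show ?case unfolding P_xpv_change[OF 2] sum_lists by (simp add: mult_ac)
qed

lemma R_tt_smooth:
  assumes c: "c \<in> \<A>" and d: "d \<in> \<B>"
  shows "smooth_fun JA (fst (J c d)) (R_tt \<A> \<B> N1 c d f r a b)"
  by (rule torsion_co_smooth(2)[OF c d delta_t_vf[OF c d] delta_t_vf[OF c d] torsion_components_self(6)[OF c d]])

text \<open>A direct computation would differentiate the law of the nonlinear connection once more.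
  As a coefficient of the torsion, \<open>R_tt\<close> follows from the laws of the frames
  themselves; the same holds for \<open>R_tx\<close> and \<open>R_xx\<close>.\<close>

lemma R_tt_change:
  assumes c: "c \<in> \<A>" "c' \<in> \<A>" and d: "d \<in> \<B>" "d' \<in> \<B>"
    and e: "e \<in> fst (J c d)" "e \<in> fst (J c' d')"
  shows "R_tt \<A> \<B> N1 c' d' f r a b e =
    (\<Sum>z\<in>UNIV. \<Sum>w\<in>UNIV. \<Sum>q\<in>UNIV. \<Sum>y\<in>UNIV.
      jac c' c f z (fst e) * jac c c' w a (fst e) * jac c c' q b (fst e) * jac d d' y r (fst (snd e)) *
      R_tt \<A> \<B> N1 c d z y w q e)" (is "?L = ?R")
proof -
  have "?L = (\<Sum>q\<in>UNIV. \<Sum>w\<in>UNIV.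
      jac c c' q b (fst e) * jac c c' w a (fst e) *
      (\<Sum>y\<in>UNIV. \<Sum>z\<in>UNIV. jac d d' y r (fst (snd e)) * jac c' c f z (fst e) * R_tt \<A> \<B> N1 c d z y w q e))"
    unfolding torsion_components_self(6)[OF c(2) d(2) e(2)] torsion_frame_change(1)[OF c d e] co_sum
      torsion_components(6)[OF c d e] by (rule refl)
  also have "\<dots> = ?R"
    unfolding sum_distrib_left sum.cartesian_product UNIV_Times_UNIV
    by (rule sum.reindex_bij_witness[of _ "\<lambda>(z, w, q, y). (q, w, y, z)" "\<lambda>(q, w, y, z). (z, w, q, y)"]) auto
  finally show ?thesis .
qed

lemma d_tensor_R_tt: "d_tensor \<A> \<B> 1 2 0 1
    (\<lambda>c d as bs us vs. R_tt \<A> \<B> N1 c d (as ! 0) (vs ! 0) (bs ! 0) (bs ! 1))"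
proof (rule d_tensorI, goal_cases)
  case 1
  then show ?case by (rule R_tt_smooth)
next
  case 2
  show ?case unfolding R_tt_change[OF 2] sum_lists by (simp add: mult_ac)
qed

lemma R_tx_smooth:
  assumes c: "c \<in> \<A>" and d: "d \<in> \<B>"
  shows "smooth_fun JA (fst (J c d)) (R_tx \<A> \<B> N1 N2 c d f r a j)"
  by (rule torsion_co_smooth(2)[OF c d delta_x_vf[OF c d] delta_t_vf[OF c d] torsion_components_self(7)[OF c d]])

lemma R_tx_change:
  assumes c: "c \<in> \<A>" "c' \<in> \<A>" and d: "d \<in> \<B>" "d' \<in> \<B>"
    and e: "e \<in> fst (J c d)" "e \<in> fst (J c' d')"
  shows "R_tx \<A> \<B> N1 N2 c' d' f r a j e =
    (\<Sum>z\<in>UNIV. \<Sum>w\<in>UNIV. \<Sum>y\<in>UNIV. \<Sum>q\<in>UNIV.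
      jac c' c f z (fst e) * jac c c' w a (fst e) * jac d d' y r (fst (snd e)) * jac d d' q j (fst (snd e)) *
      R_tx \<A> \<B> N1 N2 c d z y w q e)" (is "?L = ?R")
proof -
  have "?L = (\<Sum>q\<in>UNIV. \<Sum>w\<in>UNIV.
      jac d d' q j (fst (snd e)) * jac c c' w a (fst e) *
      (\<Sum>y\<in>UNIV. \<Sum>z\<in>UNIV. jac d d' y r (fst (snd e)) * jac c' c f z (fst e) * R_tx \<A> \<B> N1 N2 c d z y w q e))"
    unfolding torsion_components_self(7)[OF c(2) d(2) e(2)] torsion_frame_change(2)[OF c d e] co_sum
      torsion_components(7)[OF c d e] by (rule refl)
  also have "\<dots> = ?R"
    unfolding sum_distrib_left sum.cartesian_product UNIV_Times_UNIV
    by (rule sum.reindex_bij_witness[of _ "\<lambda>(z, w, y, q). (q, w, y, z)" "\<lambda>(q, w, y, z). (z, w, y, q)"]) auto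
  finally show ?thesis .
qed

lemma d_tensor_R_tx: "d_tensor \<A> \<B> 1 1 0 2
    (\<lambda>c d as bs us vs. R_tx \<A> \<B> N1 N2 c d (as ! 0) (vs ! 0) (bs ! 0) (vs ! 1))"
proof (rule d_tensorI, goal_cases)
  case 1
  then show ?case by (rule R_tx_smooth)
next
  case 2
  show ?case unfolding R_tx_change[OF 2] sum_lists by (simp add: mult_ac)
qed

lemma R_xx_smooth:
  assumes c: "c \<in> \<A>" and d: "d \<in> \<B>"
  shows "smooth_fun JA (fst (J c d)) (R_xx \<A> \<B> N2 c d f r i j)"
  by (rule torsion_co_smooth(2)[OF c d delta_x_vf[OF c d] delta_x_vf[OF c d] torsion_components_self(8)[OF c d]])

lemma R_xx_change:
  assumes c: "c \<in> \<A>" "c' \<in> \<A>" and d: "d \<in> \<B>" "d' \<in> \<B>"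
    and e: "e \<in> fst (J c d)" "e \<in> fst (J c' d')"
  shows "R_xx \<A> \<B> N2 c' d' f r i j e =
    (\<Sum>z\<in>UNIV. \<Sum>y\<in>UNIV. \<Sum>w\<in>UNIV. \<Sum>q\<in>UNIV.
      jac c' c f z (fst e) * jac d d' y r (fst (snd e)) * jac d d' w i (fst (snd e)) * jac d d' q j (fst (snd e)) *
      R_xx \<A> \<B> N2 c d z y w q e)" (is "?L = ?R")
proof -
  have "?L = (\<Sum>q\<in>UNIV. \<Sum>w\<in>UNIV.
      jac d d' q j (fst (snd e)) * jac d d' w i (fst (snd e)) *
      (\<Sum>y\<in>UNIV. \<Sum>z\<in>UNIV. jac d d' y r (fst (snd e)) * jac c' c f z (fst e) * R_xx \<A> \<B> N2 c d z y w q e))"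
    unfolding torsion_components_self(8)[OF c(2) d(2) e(2)] torsion_frame_change(4)[OF c d e] co_sum
      torsion_components(8)[OF c d e] by (rule refl)
  also have "\<dots> = ?R"
    unfolding sum_distrib_left sum.cartesian_product UNIV_Times_UNIV
    by (rule sum.reindex_bij_witness[of _ "\<lambda>(z, y, w, q). (q, w, y, z)" "\<lambda>(q, w, y, z). (z, y, w, q)"]) auto
  finally show ?thesis .
qed

lemma d_tensor_R_xx: "d_tensor \<A> \<B> 1 0 0 3
    (\<lambda>c d as bs us vs. R_xx \<A> \<B> N2 c d (as ! 0) (vs ! 0) (vs ! 1) (vs ! 2))"
proof (rule d_tensorI, goal_cases)
  case 1
  then show ?case by (rule R_xx_smooth)
next
  case 2
  show ?case unfolding R_xx_change[OF 2] sum_lists by (simp add: mult_ac)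
qed

lemma S_pp_smooth:
  assumes c: "c \<in> \<A>" and d: "d \<in> \<B>"
  shows "smooth_fun JA (fst (J c d)) (S_pp \<A> \<B> N2 D c d f r i a j b)"
  by (rule torsion_co_smooth(2)[OF c d par_p_vf[OF c d] par_p_vf[OF c d] torsion_components_self(9)[OF c d]])

text \<open>Both arguments are vertical, so two of the four sums run over pairs of indices, and six
  sums over single indices result.\<close>

lemma S_pp_change:
  assumes c: "c \<in> \<A>" "c' \<in> \<A>" and d: "d \<in> \<B>" "d' \<in> \<B>"
    and e: "e \<in> fst (J c d)" "e \<in> fst (J c' d')"
  shows "S_pp \<A> \<B> N2 D c' d' f r i a j b e =
    (\<Sum>z\<in>UNIV. \<Sum>w2\<in>UNIV. \<Sum>q2\<in>UNIV. \<Sum>w1\<in>UNIV. \<Sum>q1\<in>UNIV. \<Sum>y\<in>UNIV.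
      jac c' c f z (fst e) * jac c c' w2 a (fst e) * jac c c' q2 b (fst e) * jac d' d i w1 (fst (snd e)) * jac d' d j q1 (fst (snd e)) * jac d d' y r (fst (snd e)) *
      S_pp \<A> \<B> N2 D c d z y w1 w2 q1 q2 e)" (is "?L = ?R")
proof -
  have "?L = (\<Sum>q\<in>UNIV. \<Sum>w\<in>UNIV.
      (jac d' d j (fst q) (fst (snd e)) * jac c c' (snd q) b (fst e)) * (jac d' d i (fst w) (fst (snd e)) * jac c c' (snd w) a (fst e)) *
      (\<Sum>y\<in>UNIV. \<Sum>z\<in>UNIV. jac d d' y r (fst (snd e)) * jac c' c f z (fst e) * S_pp \<A> \<B> N2 D c d z y (fst w) (snd w) (fst q) (snd q) e))"
    unfolding torsion_components_self(9)[OF c(2) d(2) e(2)] torsion_frame_change(6)[OF c d e] co_sum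
      torsion_components(9)[OF c d e] by (rule refl)
  also have "\<dots> = ?R"
    unfolding sum_distrib_left sum.cartesian_product UNIV_Times_UNIV
    by (rule sum.reindex_bij_witness[of _ "\<lambda>(z, w2, q2, w1, q1, y). ((q1, q2), (w1, w2), y, z)" "\<lambda>((q1, q2), (w1, w2), y, z). (z, w2, q2, w1, q1, y)"]) auto
  finally show ?thesis .
qed

lemma d_tensor_S_pp: "d_tensor \<A> \<B> 1 2 2 1
    (\<lambda>c d as bs us vs. S_pp \<A> \<B> N2 D c d (as ! 0) (vs ! 0) (us ! 0) (bs ! 0) (us ! 1) (bs ! 1))"
proof (rule d_tensorI, goal_cases)
  case 1
  then show ?case by (rule S_pp_smooth)
next
  case 2
  show ?case unfolding S_pp_change[OF 2] sum_lists by (simp add: mult_ac)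
qed

end

theorem theorem4p1:
  fixes \<A> :: "('t, real^'m::finite) chart set"
    and \<B> :: "('x, real^'n::finite) chart set"
    and N1 :: "('t, 'x, 'm, 'n) nlc1"
    and N2 :: "('t, 'x, 'm, 'n) nlc2"
    and h :: "('t, real^'m) chart \<Rightarrow> 't \<Rightarrow> real^'m^'m"
    and D :: "('t, 'x, 'm, 'n) jet_connection"
  assumes "smooth_manifold \<A>"
    and "smooth_manifold \<B>"
    and "nonlinear_connection \<A> \<B> N1 N2"
    and "semi_riemannian_metric \<A> h"
    and "h_normal \<A> \<B> N1 N2 h D"
  shows "tensor_field (jet_atlas \<A> \<B>) (torsion (jet_atlas \<A> \<B>) D) \<and>
    (\<forall>X Y e g. torsion (jet_atlas \<A> \<B>) D Y X e g = - torsion (jet_atlas \<A> \<B>) D X Y e g) \<and>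
    (\<forall>c\<in>\<A>. \<forall>d\<in>\<B>. \<forall>e\<in>fst (jet_chart \<A> \<B> c d). \<forall>a b i j g.
      torsion (jet_atlas \<A> \<B>) D (delta_t \<A> \<B> N1 c d b) (delta_t \<A> \<B> N1 c d a) e g =
        (\<Sum>r\<in>UNIV. \<Sum>f\<in>UNIV. R_tt \<A> \<B> N1 c d f r a b e * par_p \<A> \<B> c d r f e g) \<and>
      torsion (jet_atlas \<A> \<B>) D (delta_x \<A> \<B> N2 c d j) (delta_t \<A> \<B> N1 c d a) e g =
        (\<Sum>r\<in>UNIV. T_tx \<A> \<B> N1 N2 D c d r a j e * delta_x \<A> \<B> N2 c d r e g) +
        (\<Sum>r\<in>UNIV. \<Sum>f\<in>UNIV. R_tx \<A> \<B> N1 N2 c d f r a j e * par_p \<A> \<B> c d r f e g) \<and>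
      torsion (jet_atlas \<A> \<B>) D (par_p \<A> \<B> c d j b) (delta_t \<A> \<B> N1 c d a) e g =
        (\<Sum>r\<in>UNIV. \<Sum>f\<in>UNIV. P_tp \<A> \<B> N1 N2 h D c d f r a j b e * par_p \<A> \<B> c d r f e g) \<and>
      torsion (jet_atlas \<A> \<B>) D (delta_x \<A> \<B> N2 c d j) (delta_x \<A> \<B> N2 c d i) e g =
        (\<Sum>r\<in>UNIV. T_xx \<A> \<B> N2 D c d r i j e * delta_x \<A> \<B> N2 c d r e g) +
        (\<Sum>r\<in>UNIV. \<Sum>f\<in>UNIV. R_xx \<A> \<B> N2 c d f r i j e * par_p \<A> \<B> c d r f e g) \<and>
      torsion (jet_atlas \<A> \<B>) D (par_p \<A> \<B> c d j b) (delta_x \<A> \<B> N2 c d i) e g =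
        (\<Sum>r\<in>UNIV. P_xp \<A> \<B> N2 D c d r i j b e * delta_x \<A> \<B> N2 c d r e g) +
        (\<Sum>r\<in>UNIV. \<Sum>f\<in>UNIV. P_xpv \<A> \<B> N2 D c d f r i j b e * par_p \<A> \<B> c d r f e g) \<and>
      torsion (jet_atlas \<A> \<B>) D (par_p \<A> \<B> c d j b) (par_p \<A> \<B> c d i a) e g =
        (\<Sum>r\<in>UNIV. \<Sum>f\<in>UNIV. S_pp \<A> \<B> N2 D c d f r i a j b e * par_p \<A> \<B> c d r f e g)) \<and>
    d_tensor \<A> \<B> 0 1 1 1
      (\<lambda>c d as bs us vs. T_tx \<A> \<B> N1 N2 D c d (us ! 0) (bs ! 0) (vs ! 0)) \<and>
    d_tensor \<A> \<B> 0 0 1 2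
      (\<lambda>c d as bs us vs. T_xx \<A> \<B> N2 D c d (us ! 0) (vs ! 0) (vs ! 1)) \<and>
    d_tensor \<A> \<B> 0 1 2 1
      (\<lambda>c d as bs us vs. P_xp \<A> \<B> N2 D c d (us ! 0) (vs ! 0) (us ! 1) (bs ! 0)) \<and>
    d_tensor \<A> \<B> 1 2 1 1
      (\<lambda>c d as bs us vs. P_tp \<A> \<B> N1 N2 h D c d (as ! 0) (vs ! 0) (bs ! 0) (us ! 0) (bs ! 1)) \<and>
    d_tensor \<A> \<B> 1 1 1 2
      (\<lambda>c d as bs us vs. P_xpv \<A> \<B> N2 D c d (as ! 0) (vs ! 0) (vs ! 1) (us ! 0) (bs ! 0)) \<and>
    d_tensor \<A> \<B> 1 2 0 1
      (\<lambda>c d as bs us vs. R_tt \<A> \<B> N1 c d (as ! 0) (vs ! 0) (bs ! 0) (bs ! 1)) \<and>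
    d_tensor \<A> \<B> 1 1 0 2
      (\<lambda>c d as bs us vs. R_tx \<A> \<B> N1 N2 c d (as ! 0) (vs ! 0) (bs ! 0) (vs ! 1)) \<and>
    d_tensor \<A> \<B> 1 0 0 3
      (\<lambda>c d as bs us vs. R_xx \<A> \<B> N2 c d (as ! 0) (vs ! 0) (vs ! 1) (vs ! 2)) \<and>
    d_tensor \<A> \<B> 1 2 2 1
      (\<lambda>c d as bs us vs. S_pp \<A> \<B> N2 D c d (as ! 0) (vs ! 0) (us ! 0) (bs ! 0) (us ! 1) (bs ! 1))"
proof -
  interpret h_normal_bundle \<A> \<B> N1 N2 h D
    by unfold_locales (use assms in \<open>auto simp: smooth_manifold_def\<close>)
  show ?thesis
    by (intro conjI ballI allI J.torsion_tensor[OF linear_D] J.torsion_skew torsion_adapted d_tensor_T_tx d_tensor_T_xx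
        d_tensor_P_xp d_tensor_P_tp d_tensor_P_xpv d_tensor_R_tt d_tensor_R_tx d_tensor_R_xx d_tensor_S_pp)
qed

end
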